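(* There is an algorithm that, given a $2$-edge-colored graph $G$ and a positive integer $k$, decides whether $G$ has a $2$-simultaneous feedback vertex set of size at most $k$ in time $\mathcal{O}^\star(81^{k})$.
   Context: A $2$-edge-colored graph is a finite undirected multigraph $G=(V,E_1,E_2)$ (loops and multiple edges allowed) whose edge set is partitioned into two color classes; $G_i=(V,E_i)$. A loop and a double edge count as cycles. A set $S\subseteq V$ is a $2$-simultaneous feedback vertex set if both $G_1\setminus S$ and $G_2\setminus S$ are forests. $\mathcal{O}^\star(f(k))$ means $f(k)$ times a polynomial in the input size. *)

theory Defs
  imports Main "HOL-Library.Multiset" "HOL-Library.Uprod"
    "HOL-Computational_Algebra.Polynomial"
begin

section \<open>Multigraphs and simultaneous feedback vertex sets\<close>

text \<open>
  An undirected multigraph is a vertex set with a multiset of unordered pairs: the multiplicity of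
  a pair is the number of parallel edges, and \<open>Upair v v\<close> is a loop at \<open>v\<close>.
\<close>

record 'v multigraph =
  mverts :: "'v set"
  medges :: "'v uprod multiset"

record 'v colored_graph =
  verts :: "'v set"
  edges1 :: "'v uprod multiset"
  edges2 :: "'v uprod multiset"

definition wf_colored_graph :: "'v colored_graph \<Rightarrow> bool" where
  "wf_colored_graph G \<longleftrightarrow>
     finite (verts G) \<and> (\<forall>e \<in># edges1 G + edges2 G. set_uprod e \<subseteq> verts G)"

definition class1 :: "'v colored_graph \<Rightarrow> 'v multigraph" where
  "class1 G = \<lparr>mverts = verts G, medges = edges1 G\<rparr>"

definition class2 :: "'v colored_graph \<Rightarrow> 'v multigraph" where
  "class2 G = \<lparr>mverts = verts G, medges = edges2 G\<rparr>"

definition delete_verts :: "'v multigraph \<Rightarrow> 'v set \<Rightarrow> 'v multigraph" where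
  "delete_verts H S =
     \<lparr>mverts = mverts H - S, medges = filter_mset (\<lambda>e. set_uprod e \<inter> S = {}) (medges H)\<rparr>"

text \<open>
  For \<open>vs = [v\<^sub>0, \<dots>, v\<^sub>m]\<close> these are the edges \<open>v\<^sub>0v\<^sub>1, \<dots>, v\<^sub>mv\<^sub>0\<close>, counted with multiplicity. Hence a
  one-element list needs a loop, and a two-element list needs two parallel edges.
\<close>

definition closed_walk_edges :: "'v list \<Rightarrow> 'v uprod multiset" where
  "closed_walk_edges vs = mset (map2 Upair vs (rotate1 vs))"

definition is_cycle :: "'v multigraph \<Rightarrow> 'v list \<Rightarrow> bool" where
  "is_cycle H vs \<longleftrightarrow>
     vs \<noteq> [] \<and> distinct vs \<and> set vs \<subseteq> mverts H \<and> closed_walk_edges vs \<subseteq># medges H"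

definition forest :: "'v multigraph \<Rightarrow> bool" where
  "forest H \<longleftrightarrow> (\<nexists>vs. is_cycle H vs)"

definition sim_fvs :: "'v colored_graph \<Rightarrow> 'v set \<Rightarrow> bool" where
  "sim_fvs G S \<longleftrightarrow>
     S \<subseteq> verts G \<and> forest (delete_verts (class1 G) S) \<and> forest (delete_verts (class2 G) S)"


section \<open>Algorithms and their running time\<close>

text \<open>
  Algorithms are programs of a first-order, call-by-value functional language on binary trees (pure
  Lisp with a single atom \<open>Leaf\<close>). Every evaluation step costs one unit. Trees are immutable, so an
  implementation represents them by pointers to shared cells, and each step takes a number of
  pointer operations that depends only on the program. Conversely, storing a memory as a balanced
  tree of cells simulates a step of a random access machine (with words of logarithmic length) in
  time polynomial in the word length. The two models therefore agree up to factors polylogarithmic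
  in the running time, so a bound \<open>c^k\<close> times a polynomial in the input size has the same meaning
  in both.
\<close>

datatype tree = Leaf | Node tree tree

fun left :: "tree \<Rightarrow> tree" where
  "left Leaf = Leaf"
| "left (Node l r) = l"

fun right :: "tree \<Rightarrow> tree" where
  "right Leaf = Leaf"
| "right (Node l r) = r"

text \<open>
  Variables are de Bruijn indices into the environment. \<open>LetE a b\<close> evaluates \<open>b\<close> with the value of
  \<open>a\<close> in front of the environment; the body of a called function sees exactly its arguments.
  \<open>Call f as\<close> refers to the function at position \<open>f\<close> of the program, and \<open>IfE\<close> takes the first
  branch iff the condition is not \<open>Leaf\<close>.
\<close>

datatype expr =
    Var nat
  | LeafE
  | NodeE expr expr
  | LeftE expr
  | RightE expr
  | IfE expr expr expr
  | LetE expr expr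
  | Call nat "expr list"

type_synonym program = "expr list"

text \<open>\<open>eval P env a v t\<close>: the expression \<open>a\<close> evaluates to \<open>v\<close> in exactly \<open>t\<close> steps.\<close>

inductive
  eval :: "program \<Rightarrow> tree list \<Rightarrow> expr \<Rightarrow> tree \<Rightarrow> nat \<Rightarrow> bool" and
  evals :: "program \<Rightarrow> tree list \<Rightarrow> expr list \<Rightarrow> tree list \<Rightarrow> nat \<Rightarrow> bool"
  for P :: program
where
  Var: "i < length env \<Longrightarrow> eval P env (Var i) (env ! i) 1"
| LeafE: "eval P env LeafE Leaf 1"
| NodeE: "eval P env a v s \<Longrightarrow> eval P env b w t \<Longrightarrow>
    eval P env (NodeE a b) (Node v w) (s + t + 1)"
| LeftE: "eval P env a v t \<Longrightarrow> eval P env (LeftE a) (left v) (t + 1)"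
| RightE: "eval P env a v t \<Longrightarrow> eval P env (RightE a) (right v) (t + 1)"
| IfTrue: "eval P env a v s \<Longrightarrow> v \<noteq> Leaf \<Longrightarrow> eval P env b w t \<Longrightarrow>
    eval P env (IfE a b c) w (s + t + 1)"
| IfFalse: "eval P env a Leaf s \<Longrightarrow> eval P env c w t \<Longrightarrow>
    eval P env (IfE a b c) w (s + t + 1)"
| Let: "eval P env a v s \<Longrightarrow> eval P (v # env) b w t \<Longrightarrow>
    eval P env (LetE a b) w (s + t + 1)"
| Call: "f < length P \<Longrightarrow> evals P env as vs s \<Longrightarrow> eval P vs (P ! f) w t \<Longrightarrow>
    eval P env (Call f as) w (s + t + 1)"
| Nil: "evals P env [] [] 0"
| Cons: "eval P env a v s \<Longrightarrow> evals P env as vs t \<Longrightarrow>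
    evals P env (a # as) (v # vs) (s + t)"

text \<open>The result and the running time are determined by the program and the input.\<close>

lemma eval_deterministic:
  "eval P env a v s \<Longrightarrow> eval P env a w t \<Longrightarrow> v = w \<and> s = t"
  "evals P env as vs s \<Longrightarrow> evals P env as ws t \<Longrightarrow> vs = ws \<and> s = t"
proof (induction arbitrary: w t and ws t rule: eval_evals.inducts)
  case (Var i env)
  then show ?case by (auto elim: eval.cases)
next
  case (LeafE env)
  then show ?case by (auto elim: eval.cases)
next
  case (NodeE env a v s b u r)
  from NodeE.prems show ?case by cases (use NodeE.IH in blast)
next
  case (LeftE env a v s)
  from LeftE.prems show ?case by cases (use LeftE.IH in blast)
next
  case (RightE env a v s)
  from RightE.prems show ?case by cases (use RightE.IH in blast)
next
  case (IfTrue env a v s b u r c)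
  from IfTrue.prems show ?case by cases (use IfTrue.IH IfTrue.hyps in blast)+
next
  case (IfFalse env a s c u r b)
  from IfFalse.prems show ?case by cases (use IfFalse.IH in blast)+
next
  case (Let env a v s b u r)
  from Let.prems show ?case by cases (use Let.IH in blast)
next
  case (Call f env as vs s u r)
  from Call.prems show ?case by cases (use Call.IH in blast)
next
  case (Nil env)
  then show ?case by (auto elim: evals.cases)
next
  case (Cons env a v s as vs r)
  from Cons.prems show ?case by cases (use Cons.IH in blast)
qed

text \<open>Function 0 is the main function; a result other than \<open>Leaf\<close> means ``yes''.\<close>

definition runs :: "program \<Rightarrow> tree \<Rightarrow> bool \<Rightarrow> nat \<Rightarrow> bool" where
  "runs P x b t \<longleftrightarrow> (\<exists>v. eval P [x] (Call 0 [Var 0]) v t \<and> (b \<longleftrightarrow> v \<noteq> Leaf))"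


section \<open>Encoding of instances\<close>

text \<open>Numbers are written in binary, least significant bit first.\<close>

fun enc_bool :: "bool \<Rightarrow> tree" where
  "enc_bool False = Leaf"
| "enc_bool True = Node Leaf Leaf"

fun enc_nat :: "nat \<Rightarrow> tree" where
  "enc_nat n = (if n = 0 then Leaf else Node (enc_bool (odd n)) (enc_nat (n div 2)))"

declare enc_nat.simps [simp del]

fun enc_pair :: "nat \<times> nat \<Rightarrow> tree" where
  "enc_pair (u, v) = Node (enc_nat u) (enc_nat v)"

fun enc_list :: "('a \<Rightarrow> tree) \<Rightarrow> 'a list \<Rightarrow> tree" where
  "enc_list f [] = Leaf"
| "enc_list f (x # xs) = Node (f x) (enc_list f xs)"

text \<open>
  Vertices are named by arbitrary natural numbers. The input lists the vertices, the edges of each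
  color and the number \<open>k\<close>; the order of the lists and of the end points of an edge is arbitrary.
\<close>

definition encodes :: "tree \<Rightarrow> nat colored_graph \<Rightarrow> nat \<Rightarrow> bool" where
  "encodes x G k \<longleftrightarrow>
     (\<exists>vs es1 es2.
        distinct vs \<and> set vs = verts G \<and>
        mset (map (\<lambda>(u, v). Upair u v) es1) = edges1 G \<and>
        mset (map (\<lambda>(u, v). Upair u v) es2) = edges2 G \<and>
        x = Node (enc_list enc_nat vs)
              (Node (enc_list enc_pair es1)
                (Node (enc_list enc_pair es2) (enc_nat k))))"

text \<open>
  A program decides a problem on pairs of a graph and a parameter in time \<open>O\<^sup>*(f k)\<close> if on every
  encoding \<open>x\<close> of such a pair it halts with the right answer after at most \<open>f k\<close> times a polynomial
  in the input size many steps. The input size is the number \<open>size x\<close> of inner nodes of \<open>x\<close>.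
\<close>

definition decides_in_Ostar ::
  "program \<Rightarrow> (nat colored_graph \<Rightarrow> nat \<Rightarrow> bool) \<Rightarrow> (nat \<Rightarrow> nat) \<Rightarrow> bool" where
  "decides_in_Ostar P Q f \<longleftrightarrow>
     (\<exists>p :: nat poly. \<forall>G k x. wf_colored_graph G \<and> 0 < k \<and> encodes x G k \<longrightarrow>
        (\<exists>t. runs P x (Q G k) t \<and> t \<le> f k * poly p (size x)))"

end

theory Submission
  imports Defs
begin

text \<open>
  Call a set of vertices dense if it spans a subgraph of minimum degree at least 2, and let the
  core of a set be its largest dense subset; a set induces a forest iff its core is empty. The
  algorithm keeps a set \<open>A\<close> of vertices that are not deleted and branches on an undecided vertex of
  maximal degree \<open>D \<ge> 3\<close> in the two cores of \<open>A\<close>: delete it (at most \<open>k\<close> times) or keep it. Keeping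
  adds \<open>D - 2\<close> to the excess degree of the kept vertices, deleting destroys at most \<open>2 D \<le> 6 (D - 2)\<close>
  of it, and a solution with \<open>k\<close> further deletions leaves room for \<open>2 D k\<close>; so at most \<open>6 k\<close> vertices
  are kept in total.

  When all undecided vertices have degree at most 2 in both cores, the effect of deleting \<open>u\<close> in one
  color is determined by the core of \<open>A - {u}\<close>, that is, by the path of degree-2 vertices that contains
  \<open>u\<close>. With \<open>k\<close> deletions left there are at most \<open>3 k\<close> such paths in each color. For each of the at most
  \<open>2 ^ (6 k) = 64 ^ k\<close> choices of the paths to be hit, the least number of vertices hitting them is
  the number of paths minus a maximum matching between the paths of the two colors. The search
  tree has at most \<open>64 ^ k (64 / 63) ^ (6 k + 1) \<le> (64 / 63) 81 ^ k\<close> leaves.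
\<close>

text \<open>The edge lists are therefore never changed. Only the list of remaining vertices shrinks,
  and both pruning and the paths are expressed through cores: the set
  \<open>core M (A - {u})\<close>, called the label of \<open>u\<close>, identifies the path of
  \<open>u\<close> without computing that path.

  The factor 6 is the maximum of \<open>2 D / (D - 2)\<close> over \<open>D \<ge> 3\<close>,
  attained at \<open>D = 3\<close>. The factor \<open>64 / 63\<close> is forced by 64: since
  \<open>1 / 64 + 63 / 64 = 1\<close>, the two children of a node share out its potential exactly.
  As \<open>64 (64 / 63) ^ 6 < 71\<close>, the base 81 leaves slack.

  The machine has neither numbers nor equality. Counters and degrees are therefore lists compared by
  length, and the running times are derived from closure properties of polynomial-time functions,
  with a single rule for exponential search.\<close>

section \<open>Injective encodings of data as trees\<close>

class encodable =
  fixes enc :: "'a \<Rightarrow> tree"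
  assumes enc_inject: "enc x = enc y \<Longrightarrow> x = y"

lemma enc_eq_iff [simp]: "enc x = enc y \<longleftrightarrow> x = y"
  using enc_inject by blast

instantiation tree :: encodable
begin
definition enc_tree_def [simp]: "enc (t :: tree) = t"
instance by standard simp
end

instantiation bool :: encodable
begin
definition enc_bool_eq [simp]: "enc b = enc_bool b"
instance proof
  fix x y :: bool
  show "enc x = enc y \<Longrightarrow> x = y" by (cases x; cases y) auto
qed
end

lemma enc_bool_eq_Leaf [simp]: "enc_bool b = Leaf \<longleftrightarrow> \<not> b"
  by (cases b) auto

lemma enc_nat_inject: "enc_nat m = enc_nat n \<Longrightarrow> m = n"
proof (induction m arbitrary: n rule: less_induct)
  case (less m)
  show ?case
  proof (cases "m = 0")
    case True
    with less.prems show ?thesis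
      by (subst (asm) (1 2) enc_nat.simps) (auto split: if_splits)
  next
    case False
    have n: "n \<noteq> 0"
      using less.prems False by (subst (asm) (1 2) enc_nat.simps) (auto split: if_splits)
    have eq: "enc_bool (odd m) = enc_bool (odd n)" "enc_nat (m div 2) = enc_nat (n div 2)"
      using less.prems False n by (subst (asm) (1 2) enc_nat.simps; simp)+
    have "odd m = odd n"
      using eq(1) enc_bool_eq_Leaf by metis
    moreover have "m div 2 = n div 2"
      using less.IH[OF _ eq(2)] False by simp
    ultimately show ?thesis
      by (metis div_mult_mod_eq odd_iff_mod_2_eq_one not_mod_2_eq_1_eq_0)
  qed
qed

instantiation nat :: encodable
begin
definition enc_nat_eq [simp]: "enc (n :: nat) = enc_nat n"
instance by standard (use enc_nat_inject in simp)
end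

instantiation prod :: (encodable, encodable) encodable
begin
definition enc_prod_def: "enc p = Node (enc (fst p)) (enc (snd p))"
instance by standard (auto simp: enc_prod_def prod_eq_iff)
end

lemma enc_Pair [simp]: "enc (a, b) = Node (enc a) (enc b)"
  by (simp add: enc_prod_def)

lemma enc_list_inject:
  "(\<And>x y. f x = f y \<Longrightarrow> x = y) \<Longrightarrow> enc_list f xs = enc_list f ys \<Longrightarrow> xs = ys"
proof (induction xs arbitrary: ys)
  case Nil
  then show ?case by (cases ys) auto
next
  case (Cons x xs)
  then show ?case by (cases ys) auto
qed

instantiation list :: (encodable) encodable
begin
definition enc_list_eq: "enc xs = enc_list enc xs"
instance by standard (auto simp: enc_list_eq intro: enc_list_inject[OF enc_inject])
end

lemma enc_Nil [simp]: "enc [] = Leaf" and enc_Cons [simp]: "enc (x # xs) = Node (enc x) (enc xs)"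
  by (simp_all add: enc_list_eq)

definition esize :: "'a::encodable \<Rightarrow> nat" where
  "esize x = size (enc x)"

lemma esize_simps [simp]:
  "esize (a, b) = esize a + esize b + 1"
  "esize ([] :: 'c::encodable list) = 0"
  "esize (x # xs) = esize x + esize xs + 1"
  by (simp_all add: esize_def)

lemma esize_bool: "esize (b :: bool) \<le> 1"
  by (cases b) (auto simp: esize_def)

lemma esize_fst_snd: "esize p = esize (fst p) + esize (snd p) + 1"
  by (cases p) simp

lemma esize_append [simp]: "esize (xs @ ys) = esize xs + esize ys"
  by (induction xs) auto

lemma esize_member: "x \<in> set xs \<Longrightarrow> esize x < esize xs"
  by (induction xs) auto

lemma length_le_esize: "length xs \<le> esize xs"
  by (induction xs) auto

lemma esize_filter: "esize (filter P xs) \<le> esize xs"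
  by (induction xs) auto

lemma esize_tl: "esize (tl xs) \<le> esize xs"
  by (cases xs) auto

lemma esize_concat: "esize (concat xss) \<le> esize xss"
  by (induction xss) auto

lemma esize_list_le: "(\<And>x. x \<in> set xs \<Longrightarrow> esize x \<le> b) \<Longrightarrow> esize xs \<le> length xs * (b + 1)"
proof (induction xs)
  case (Cons x xs)
  then have "esize x \<le> b" "esize xs \<le> length xs * (b + 1)" by auto
  then show ?case by simp
qed simp

subsection \<open>Polynomial bounds\<close>

text \<open>The base is at least 2, so constant factors and sums can be absorbed by a larger
  exponent alone.\<close>

definition pbd :: "('a::encodable \<Rightarrow> real) \<Rightarrow> bool" where
  "pbd T \<longleftrightarrow> (\<exists>d. \<forall>x. \<bar>T x\<bar> \<le> (real (esize x) + 2) ^ d)"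

lemma pbdI: "(\<And>x. \<bar>T x\<bar> \<le> (real (esize x) + 2) ^ d) \<Longrightarrow> pbd T"
  by (auto simp: pbd_def)

lemma pbd_mono: "pbd U \<Longrightarrow> (\<And>x. \<bar>T x\<bar> \<le> \<bar>U x\<bar>) \<Longrightarrow> pbd T"
  unfolding pbd_def by (meson order_trans)

lemma pbd_const [intro]: "pbd (\<lambda>_. c)"
proof (rule pbdI)
  fix x :: 'a
  show "\<bar>c\<bar> \<le> (real (esize x) + 2) ^ nat \<lceil>\<bar>c\<bar>\<rceil>"
  proof -
    have "\<bar>c\<bar> \<le> real (nat \<lceil>\<bar>c\<bar>\<rceil>)" by linarith
    also have "\<dots> \<le> 2 ^ nat \<lceil>\<bar>c\<bar>\<rceil>" by (rule of_nat_less_two_power[THEN less_imp_le])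
    also have "\<dots> \<le> (real (esize x) + 2) ^ nat \<lceil>\<bar>c\<bar>\<rceil>" by (rule power_mono) auto
    finally show ?thesis .
  qed
qed

lemma pbd_add [intro]:
  fixes T U :: "'a::encodable \<Rightarrow> real"
  assumes "pbd T" "pbd U" shows "pbd (\<lambda>x. T x + U x)"
proof -
  obtain d e where d: "\<And>x. \<bar>T x\<bar> \<le> (real (esize x) + 2) ^ d"
    and e: "\<And>x. \<bar>U x\<bar> \<le> (real (esize x) + 2) ^ e"
    using assms by (auto simp: pbd_def)
  show ?thesis
  proof (rule pbdI)
    fix x :: 'a
    let ?n = "real (esize x) + 2"
    have "\<bar>T x + U x\<bar> \<le> ?n ^ d + ?n ^ e" using d[of x] e[of x] by linarith
    also have "\<dots> \<le> ?n ^ (d + e) + ?n ^ (d + e)"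
      by (intro add_mono power_increasing) auto
    also have "\<dots> \<le> ?n * ?n ^ (d + e)"
      by (simp add: algebra_simps)
    finally show "\<bar>T x + U x\<bar> \<le> ?n ^ Suc (d + e)" by simp
  qed
qed

lemma pbd_mult [intro]:
  fixes T U :: "'a::encodable \<Rightarrow> real"
  assumes "pbd T" "pbd U" shows "pbd (\<lambda>x. T x * U x)"
proof -
  obtain d e where d: "\<And>x. \<bar>T x\<bar> \<le> (real (esize x) + 2) ^ d"
    and e: "\<And>x. \<bar>U x\<bar> \<le> (real (esize x) + 2) ^ e"
    using assms by (auto simp: pbd_def)
  show ?thesis
    by (rule pbdI[of _ "d + e"]) (auto simp: abs_mult power_add intro!: mult_mono d e)
qed

lemma pbd_esize [intro]: "pbd (\<lambda>x. real (esize x))"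
  by (rule pbdI[of _ 1]) auto

lemma pbd_power [intro]: "pbd T \<Longrightarrow> pbd (\<lambda>x. T x ^ d)"
  by (induction d) auto

subsection \<open>Polynomial time\<close>

definition computes :: "program \<Rightarrow> nat \<Rightarrow> ('a::encodable \<Rightarrow> 'b::encodable) \<Rightarrow> ('a \<Rightarrow> real) \<Rightarrow> bool" where
  "computes P g f T \<longleftrightarrow> g < length P \<and>
     (\<forall>x. \<exists>t. eval P [enc x] (P ! g) (enc (f x)) t \<and> real t \<le> T x)"

text \<open>
  Quantifying over the program \<open>P\<close> that is extended makes the notion compositional: the
  programs of two functions can be linked without renaming calls.
\<close>

definition ctime :: "('a::encodable \<Rightarrow> 'b::encodable) \<Rightarrow> ('a \<Rightarrow> real) \<Rightarrow> bool" where
  "ctime f W \<longleftrightarrow>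
     (\<exists>d. \<forall>P. \<exists>Q g. computes (P @ Q) g f (\<lambda>x. W x * (real (esize x) + 2) ^ d))"

text \<open>The size of the result has to be bounded separately: trees share cells, so pairing a
  value with itself doubles its size in a constant number of steps, and a time bound alone allows
  results of exponential size.\<close>

definition ptime :: "('a::encodable \<Rightarrow> 'b::encodable) \<Rightarrow> bool" where
  "ptime f \<longleftrightarrow> pbd (\<lambda>x. real (esize (f x))) \<and> ctime f (\<lambda>_. 1)"

lemma ctimeI:
  assumes "pbd T" "\<And>x. 0 \<le> W x"
    and "\<And>P. \<exists>Q g. computes (P @ Q) g f (\<lambda>x. W x * T x)"
  shows "ctime f W"
proof -
  obtain d where d: "\<And>x. \<bar>T x\<bar> \<le> (real (esize x) + 2) ^ d"
    using assms(1) by (auto simp: pbd_def)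
  have "W x * T x \<le> W x * (real (esize x) + 2) ^ d" for x
    using d[of x] assms(2)[of x] by (intro mult_left_mono) auto
  then show ?thesis
    using assms(3) unfolding ctime_def computes_def by (meson order_trans)
qed

lemma ptimeI:
  assumes "pbd (\<lambda>x. real (esize (f x)))" "pbd T" "\<And>P. \<exists>Q g. computes (P @ Q) g f T"
  shows "ptime f"
  unfolding ptime_def using assms by (auto intro!: ctimeI[of T])

lemma eval_extend:
  "eval P env a v t \<Longrightarrow> eval (P @ Q) env a v t"
  "evals P env as vs t \<Longrightarrow> evals (P @ Q) env as vs t"
proof (induction rule: eval_evals.inducts)
  case (Call f env as vs s w t)
  then show ?case
    by (intro eval_evals.Call) (auto simp: nth_append)
qed (blast intro: eval_evals.intros)+

lemma computes_extend: "computes P g f T \<Longrightarrow> computes (P @ Q) g f T"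
  unfolding computes_def by (auto simp: nth_append) (meson eval_extend(1))

text \<open>The body is evaluated in the program that already contains it, so it may call
  itself.\<close>

lemma computes_last:
  assumes "\<And>x. \<exists>t. eval (P @ [b]) [enc x] b (enc (f x)) t \<and> real t \<le> T x"
  shows "computes (P @ [b]) (length P) f T"
  using assms by (auto simp: computes_def)

lemma computes_call:
  assumes "computes P g f T" "eval P env a (enc x) s" "real s \<le> r"
  shows "\<exists>t. eval P env (Call g [a]) (enc (f x)) t \<and> real t \<le> r + T x + 1"
proof -
  obtain t where t: "eval P [enc x] (P ! g) (enc (f x)) t" "real t \<le> T x"
    using assms(1) by (auto simp: computes_def)
  have "evals P env [a] [enc x] (s + 0)"
    by (rule eval_evals.Cons[OF assms(2) eval_evals.Nil])
  then have "eval P env (Call g [a]) (enc (f x)) ((s + 0) + t + 1)"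
    by (rule eval_evals.Call[rotated]) (use assms t in \<open>auto simp: computes_def\<close>)
  then show ?thesis using t assms(3) by (intro exI conjI) auto
qed

lemma eval_cong: "eval P env a v t \<Longrightarrow> v = w \<Longrightarrow> t = u \<Longrightarrow> eval P env a w u"
  by simp

lemma eval_Var0: "eval P (v # env) (Var 0) v 1"
  using eval_evals.Var[of 0 "v # env" P] by simp

lemma eval_Var1: "eval P (u # v # env) (Var 1) v 1"
  using eval_evals.Var[of 1 "u # v # env" P] by simp

section \<open>Closure properties of polynomial time\<close>

named_theorems ptime_intros

lemma ptime_id [ptime_intros]: "ptime (\<lambda>x. x)"
proof (rule ptimeI[of _ "\<lambda>_. 1"])
  fix P
  have "computes (P @ [Var 0]) (length P) (\<lambda>x. x) (\<lambda>_. 1)"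
    by (rule computes_last) (auto intro: eval_Var0)
  then show "\<exists>Q g. computes (P @ Q) g (\<lambda>x. x) (\<lambda>_. 1)" by blast
qed auto

fun tree_expr :: "tree \<Rightarrow> expr" where
  "tree_expr Leaf = LeafE"
| "tree_expr (Node l r) = NodeE (tree_expr l) (tree_expr r)"

lemma eval_tree_expr: "eval P env (tree_expr v) v (2 * size v + 1)"
proof (induction v)
  case (Node l r)
  then have "eval P env (tree_expr (Node l r)) (Node l r) (2 * size l + 1 + (2 * size r + 1) + 1)"
    unfolding tree_expr.simps by (intro eval_evals.intros)
  then show ?case by (simp add: algebra_simps)
qed (use eval_evals.LeafE[of P env] in simp)

lemma ptime_const [ptime_intros]: "ptime (\<lambda>x. c)"
proof (rule ptimeI[of _ "\<lambda>_. real (2 * size (enc c) + 1)"])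
  fix P
  have "computes (P @ [tree_expr (enc c)]) (length P) (\<lambda>_. c) (\<lambda>_. real (2 * size (enc c) + 1))"
    by (rule computes_last) (blast intro: eval_tree_expr)
  then show "\<exists>Q g. computes (P @ Q) g (\<lambda>_. c) (\<lambda>_. real (2 * size (enc c) + 1))" by blast
qed auto

lemma ptimeE:
  assumes "ptime f"
  obtains d where "\<And>x. real (esize (f x)) \<le> (real (esize x) + 2) ^ d"
    "\<And>P. \<exists>Q g. computes (P @ Q) g f (\<lambda>x. (real (esize x) + 2) ^ d)"
proof -
  obtain d e where d: "\<And>x. real (esize (f x)) \<le> (real (esize x) + 2) ^ d"
    and e: "\<And>P. \<exists>Q g. computes (P @ Q) g f (\<lambda>x. (real (esize x) + 2) ^ e)"
    using assms by (auto simp: ptime_def pbd_def ctime_def)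
  have le: "(real (esize x) + 2) ^ d \<le> (real (esize x) + 2) ^ (d + e)"
    "(real (esize x) + 2) ^ e \<le> (real (esize x) + 2) ^ (d + e)" for x :: 'a
    by (intro power_increasing; simp)+
  show thesis
  proof (rule that[of "d + e"])
    show "real (esize (f x)) \<le> (real (esize x) + 2) ^ (d + e)" for x
      using d le(1) order_trans by blast
    show "\<exists>Q g. computes (P @ Q) g f (\<lambda>x. (real (esize x) + 2) ^ (d + e))" for P
      using e[of P] unfolding computes_def by (meson le(2) order_trans)
  qed
qed

lemma ptime_programs:
  assumes "ptime f"
  shows "\<exists>d. \<forall>P. \<exists>Q g. computes (P @ Q) g f (\<lambda>x. (real (esize x) + 2) ^ d)"
  using assms by (elim ptimeE) blast

lemma ptime_esize:
  assumes "ptime f"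
  shows "\<exists>d. \<forall>x. real (esize (f x)) \<le> (real (esize x) + 2) ^ d"
  using assms by (elim ptimeE) blast

lemma ptime_pbd: "ptime f \<Longrightarrow> pbd (\<lambda>x. real (esize (f x)))"
  by (simp add: ptime_def)

text \<open>The cost of \<open>g\<close> is added to the weighted cost of \<open>f\<close>; the
  assumption \<open>1 \<le> W x\<close> lets it be absorbed into the product.\<close>

lemma ctime_comp:
  assumes f: "ctime f W" and g: "ptime g" and W: "\<And>x. 1 \<le> W x"
  shows "ctime (\<lambda>x. f (g x)) (\<lambda>x. W (g x))"
proof -
  obtain d where d: "\<And>P. \<exists>Q i. computes (P @ Q) i f (\<lambda>x. W x * (real (esize x) + 2) ^ d)"
    using f by (auto simp: ctime_def)
  obtain e where e: "\<And>P. \<exists>Q i. computes (P @ Q) i g (\<lambda>x. (real (esize x) + 2) ^ e)"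
    using ptime_programs[OF g] by blast
  define T where "T x = (real (esize (g x)) + 2) ^ d + (real (esize x) + 2) ^ e + 3" for x
  show ?thesis
  proof (rule ctimeI)
    show "pbd T" unfolding T_def by (intro pbd_add pbd_power pbd_const pbd_esize ptime_pbd g)
    show "0 \<le> W (g x)" for x using W[of "g x"] by linarith
    fix P
    obtain Q i where i: "computes (P @ Q) i g (\<lambda>x. (real (esize x) + 2) ^ e)" using e by blast
    obtain R j where j: "computes ((P @ Q) @ R) j f (\<lambda>x. W x * (real (esize x) + 2) ^ d)"
      using d by blast
    let ?P = "(P @ Q) @ R" and ?b = "Call j [Call i [Var 0]]"
    have "computes (?P @ [?b]) (length ?P) (\<lambda>x. f (g x)) (\<lambda>x. W (g x) * T x)"
    proof (rule computes_last)
      fix x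
      obtain s where s: "eval (?P @ [?b]) [enc x] (Call i [Var 0]) (enc (g x)) s"
        "real s \<le> 1 + (real (esize x) + 2) ^ e + 1"
        using computes_call[OF computes_extend[OF computes_extend[OF i]] eval_Var0] by fastforce
      obtain t where t: "eval (?P @ [?b]) [enc x] ?b (enc (f (g x))) t"
        "real t \<le> (1 + (real (esize x) + 2) ^ e + 1) + W (g x) * (real (esize (g x)) + 2) ^ d + 1"
        using computes_call[OF computes_extend[OF j] s] by blast
      have "1 * ((real (esize x) + 2) ^ e + 3) \<le> W (g x) * ((real (esize x) + 2) ^ e + 3)"
        using W by (intro mult_right_mono) auto
      then have "real t \<le> W (g x) * T x"
        using t(2) by (simp add: T_def algebra_simps)
      with t(1) show "\<exists>t. eval (?P @ [?b]) [enc x] ?b (enc (f (g x))) t \<and> real t \<le> W (g x) * T x"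
        by blast
    qed
    then show "\<exists>Q i. computes (P @ Q) i (\<lambda>x. f (g x)) (\<lambda>x. W (g x) * T x)"
      by (metis append.assoc)
  qed
qed

lemma ptime_comp:
  assumes "ptime f" "ptime g"
  shows "ptime (\<lambda>x. f (g x))"
proof -
  obtain d where d: "\<And>x. real (esize (f x)) \<le> (real (esize x) + 2) ^ d"
    using ptime_esize[OF assms(1)] by blast
  have "pbd (\<lambda>x. (real (esize (g x)) + 2) ^ d)"
    by (intro pbd_power pbd_add pbd_const ptime_pbd assms)
  then have "pbd (\<lambda>x. real (esize (f (g x))))"
    by (rule pbd_mono) (use d in \<open>auto intro: order_trans\<close>)
  moreover have "ctime (\<lambda>x. f (g x)) (\<lambda>_. 1)"
    using ctime_comp[of f "\<lambda>_. 1" g] assms by (simp add: ptime_def)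
  ultimately show ?thesis by (simp add: ptime_def)
qed

lemma ptime_Pair [ptime_intros]:
  assumes f: "ptime f" and g: "ptime g"
  shows "ptime (\<lambda>x. (f x, g x))"
proof -
  obtain d where d: "\<And>P. \<exists>Q i. computes (P @ Q) i f (\<lambda>x. (real (esize x) + 2) ^ d)"
    using ptime_programs[OF f] by blast
  obtain e where e: "\<And>P. \<exists>Q i. computes (P @ Q) i g (\<lambda>x. (real (esize x) + 2) ^ e)"
    using ptime_programs[OF g] by blast
  define T where "T x = (real (esize x) + 2) ^ d + (real (esize x) + 2) ^ e + 5" for x :: 'a
  show ?thesis
  proof (rule ptimeI)
    show "pbd T" unfolding T_def by (intro pbd_add pbd_power pbd_const pbd_esize)
    have "pbd (\<lambda>x. real (esize (f x)) + real (esize (g x)) + 1)"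
      by (intro pbd_add pbd_const ptime_pbd f g)
    then show "pbd (\<lambda>x. real (esize (f x, g x)))"
      by (rule pbd_mono) auto
    fix P
    obtain Q i where i: "computes (P @ Q) i f (\<lambda>x. (real (esize x) + 2) ^ d)" using d by blast
    obtain R j where j: "computes ((P @ Q) @ R) j g (\<lambda>x. (real (esize x) + 2) ^ e)"
      using e by blast
    let ?P = "(P @ Q) @ R" and ?b = "NodeE (Call i [Var 0]) (Call j [Var 0])"
    have "computes (?P @ [?b]) (length ?P) (\<lambda>x. (f x, g x)) T"
    proof (rule computes_last)
      fix x
      obtain s where s: "eval (?P @ [?b]) [enc x] (Call i [Var 0]) (enc (f x)) s"
        "real s \<le> 1 + (real (esize x) + 2) ^ d + 1"
        using computes_call[OF computes_extend[OF computes_extend[OF i]] eval_Var0] by fastforce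
      obtain t where t: "eval (?P @ [?b]) [enc x] (Call j [Var 0]) (enc (g x)) t"
        "real t \<le> 1 + (real (esize x) + 2) ^ e + 1"
        using computes_call[OF computes_extend[OF j] eval_Var0] by fastforce
      show "\<exists>t. eval (?P @ [?b]) [enc x] ?b (enc (f x, g x)) t \<and> real t \<le> T x"
        using eval_evals.NodeE[OF s(1) t(1)] s(2) t(2) by (intro exI[of _ "s + t + 1"]) (simp add: T_def)
    qed
    then show "\<exists>Q i. computes (P @ Q) i (\<lambda>x. (f x, g x)) T"
      by (metis append.assoc)
  qed
qed

lemma ptime_expr:
  assumes "\<And>x. real (esize (f x)) \<le> T x" "pbd T"
    and "\<And>P x. \<exists>t. eval P [enc x] b (enc (f x)) t \<and> real t \<le> T x"
  shows "ptime f"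
proof (rule ptimeI[of _ T])
  show "pbd (\<lambda>x. real (esize (f x)))"
    using assms(2) by (rule pbd_mono) (use assms(1) in \<open>auto intro: order_trans[OF _ abs_ge_self]\<close>)
  show "pbd T" by fact
  fix P
  have "computes (P @ [b]) (length P) f T"
    by (rule computes_last) (rule assms(3))
  then show "\<exists>Q g. computes (P @ Q) g f T" by blast
qed

lemma ptime_fst': "ptime (fst :: 'a::encodable \<times> 'b::encodable \<Rightarrow> 'a)"
proof (rule ptime_expr[where b = "LeftE (Var 0)" and T = "\<lambda>x. real (esize x) + 2"])
  fix P and x :: "'a \<times> 'b"
  have "eval P [enc x] (LeftE (Var 0)) (left (enc x)) (1 + 1)"
    by (intro eval_evals.LeftE eval_Var0)
  then show "\<exists>t. eval P [enc x] (LeftE (Var 0)) (enc (fst x)) t \<and> real t \<le> real (esize x) + 2"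
    by (intro exI conjI) (auto simp: enc_prod_def)
qed (simp add: esize_fst_snd, intro pbd_add pbd_const pbd_esize)

lemma ptime_snd': "ptime (snd :: 'a::encodable \<times> 'b::encodable \<Rightarrow> 'b)"
proof (rule ptime_expr[where b = "RightE (Var 0)" and T = "\<lambda>x. real (esize x) + 2"])
  fix P and x :: "'a \<times> 'b"
  have "eval P [enc x] (RightE (Var 0)) (right (enc x)) (1 + 1)"
    by (intro eval_evals.RightE eval_Var0)
  then show "\<exists>t. eval P [enc x] (RightE (Var 0)) (enc (snd x)) t \<and> real t \<le> real (esize x) + 2"
    by (intro exI conjI) (auto simp: enc_prod_def)
qed (simp add: esize_fst_snd, intro pbd_add pbd_const pbd_esize)

lemma ptime_tl': "ptime (tl :: 'a::encodable list \<Rightarrow> 'a list)"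
proof (rule ptime_expr[where b = "RightE (Var 0)" and T = "\<lambda>x. real (esize x) + 2"])
  fix P and x :: "'a list"
  have "eval P [enc x] (RightE (Var 0)) (right (enc x)) (1 + 1)"
    by (intro eval_evals.RightE eval_Var0)
  moreover have "right (enc x) = enc (tl x)" by (cases x) auto
  ultimately show "\<exists>t. eval P [enc x] (RightE (Var 0)) (enc (tl x)) t \<and> real t \<le> real (esize x) + 2"
    by (intro exI conjI) auto
next
  fix x :: "'a list"
  show "real (esize (tl x)) \<le> real (esize x) + 2" using esize_tl[of x] by linarith
qed auto

lemmas ptime_fst [ptime_intros] = ptime_comp[OF ptime_fst']
lemmas ptime_snd [ptime_intros] = ptime_comp[OF ptime_snd']
lemmas ptime_tl [ptime_intros] = ptime_comp[OF ptime_tl']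

text \<open>The identity program performs every change of type that leaves the tree unchanged: a
  pair is a list cell, any value is a tree, a number is its list of bits.\<close>

lemma ptime_retype:
  assumes "\<And>x. enc (f x) = enc x"
  shows "ptime f"
proof (rule ptime_expr[where b = "Var 0" and T = "\<lambda>x. real (esize x) + 1"])
  fix P x
  show "\<exists>t. eval P [enc x] (Var 0) (enc (f x)) t \<and> real t \<le> real (esize x) + 1"
    using eval_Var0[of P "enc x" "[]"] assms by (intro exI conjI) auto
qed (auto simp: assms esize_def[symmetric], simp add: assms esize_def)

lemma ptime_Cons [ptime_intros]:
  assumes "ptime f" "ptime g"
  shows "ptime (\<lambda>x. f x # g x)"
proof -
  have "ptime (\<lambda>p. fst p # snd p)"
    by (rule ptime_retype) (auto simp: enc_prod_def)
  from ptime_comp[OF this ptime_Pair[OF assms]] show ?thesis by simp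
qed

lemma ptime_if [ptime_intros]:
  assumes b: "ptime b" and f: "ptime f" and g: "ptime g"
  shows "ptime (\<lambda>x. if b x then f x else g x)"
proof -
  obtain a where a: "\<And>P. \<exists>Q i. computes (P @ Q) i b (\<lambda>x. (real (esize x) + 2) ^ a)"
    using ptime_programs[OF b] by blast
  obtain d where d: "\<And>P. \<exists>Q i. computes (P @ Q) i f (\<lambda>x. (real (esize x) + 2) ^ d)"
    using ptime_programs[OF f] by blast
  obtain e where e: "\<And>P. \<exists>Q i. computes (P @ Q) i g (\<lambda>x. (real (esize x) + 2) ^ e)"
    using ptime_programs[OF g] by blast
  define T where "T x = (real (esize x) + 2) ^ a + (real (esize x) + 2) ^ d
    + (real (esize x) + 2) ^ e + 5" for x :: 'a
  show ?thesis
  proof (rule ptimeI)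
    show "pbd T" unfolding T_def by (intro pbd_add pbd_power pbd_const pbd_esize)
    have "pbd (\<lambda>x. real (esize (f x)) + real (esize (g x)))"
      by (intro pbd_add pbd_const ptime_pbd f g)
    then show "pbd (\<lambda>x. real (esize (if b x then f x else g x)))"
      by (rule pbd_mono) auto
    fix P
    obtain O1 h where h: "computes (P @ O1) h b (\<lambda>x. (real (esize x) + 2) ^ a)" using a by blast
    obtain Q i where i: "computes ((P @ O1) @ Q) i f (\<lambda>x. (real (esize x) + 2) ^ d)"
      using d by blast
    obtain R j where j: "computes (((P @ O1) @ Q) @ R) j g (\<lambda>x. (real (esize x) + 2) ^ e)"
      using e by blast
    let ?P = "((P @ O1) @ Q) @ R" and ?b = "IfE (Call h [Var 0]) (Call i [Var 0]) (Call j [Var 0])"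
    have "computes (?P @ [?b]) (length ?P) (\<lambda>x. if b x then f x else g x) T"
    proof (rule computes_last)
      fix x
      obtain r where r: "eval (?P @ [?b]) [enc x] (Call h [Var 0]) (enc (b x)) r"
        "real r \<le> 1 + (real (esize x) + 2) ^ a + 1"
        using computes_call[OF computes_extend[OF computes_extend[OF computes_extend[OF h]]] eval_Var0]
        by fastforce
      obtain s where s: "eval (?P @ [?b]) [enc x] (Call i [Var 0]) (enc (f x)) s"
        "real s \<le> 1 + (real (esize x) + 2) ^ d + 1"
        using computes_call[OF computes_extend[OF computes_extend[OF i]] eval_Var0] by fastforce
      obtain t where t: "eval (?P @ [?b]) [enc x] (Call j [Var 0]) (enc (g x)) t"
        "real t \<le> 1 + (real (esize x) + 2) ^ e + 1"
        using computes_call[OF computes_extend[OF j] eval_Var0] by fastforce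
      have pos: "(real (esize x) + 2) ^ d \<ge> 0" "(real (esize x) + 2) ^ e \<ge> 0" by auto
      show "\<exists>t. eval (?P @ [?b]) [enc x] ?b (enc (if b x then f x else g x)) t \<and> real t \<le> T x"
      proof (cases "b x")
        case True
        then have "enc (b x) \<noteq> Leaf" by simp
        from eval_evals.IfTrue[OF r(1) this s(1)] True show ?thesis
          using r(2) s(2) pos unfolding T_def by (intro exI[of _ "r + s + 1"] conjI) (simp, linarith)
      next
        case False
        then have "enc (b x) = Leaf" by simp
        from eval_evals.IfFalse[OF r(1)[unfolded this] t(1)] False show ?thesis
          using r(2) t(2) pos unfolding T_def by (intro exI[of _ "r + t + 1"] conjI) (simp, linarith)
      qed
    qed
    then show "\<exists>Q i. computes (P @ Q) i (\<lambda>x. if b x then f x else g x) T"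
      by (metis append.assoc)
  qed
qed

lemma ptime_not [ptime_intros]: "ptime f \<Longrightarrow> ptime (\<lambda>x. \<not> f x)"
proof -
  assume "ptime f"
  moreover have "(\<lambda>x. \<not> f x) = (\<lambda>x. if f x then False else True)" by auto
  ultimately show ?thesis using ptime_if[OF _ ptime_const[of False] ptime_const[of True], of f] by simp
qed

lemma ptime_conj [ptime_intros]:
  assumes "ptime f" "ptime g" shows "ptime (\<lambda>x. f x \<and> g x)"
proof -
  have "(\<lambda>x. f x \<and> g x) = (\<lambda>x. if f x then g x else False)" by auto
  then show ?thesis using ptime_if[OF assms ptime_const[of False]] by simp
qed

lemma ptime_disj [ptime_intros]:
  assumes "ptime f" "ptime g" shows "ptime (\<lambda>x. f x \<or> g x)"
proof -
  have "(\<lambda>x. f x \<or> g x) = (\<lambda>x. if f x then True else g x)" by auto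
  then show ?thesis using ptime_if[OF assms(1) ptime_const[of True] assms(2)] by simp
qed

subsection \<open>Recursion on lists\<close>

text \<open>Functions are first-order, so the parameter \<open>e\<close> travels in a pair with the
  rest of the list. Only suffixes of \<open>xs\<close> are met, hence \<open>C\<close> has to bound
  the cost of a step on the intermediate results of those suffixes alone.\<close>

lemma eval_rec_list:
  fixes f :: "('e::encodable \<times> 'a::encodable) \<times> 'b::encodable \<Rightarrow> 'b" and i :: "'e \<Rightarrow> 'b"
  assumes f: "computes P h f Tf" and i: "computes P j i Ti"
    and g: "g < length P" "P ! g = IfE (RightE (Var 0))
      (LetE (Call g [NodeE (LeftE (Var 0)) (RightE (RightE (Var 0)))])
        (Call h [NodeE (NodeE (LeftE (Var 1)) (LeftE (RightE (Var 1)))) (Var 0)]))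
      (Call j [LeftE (Var 0)])"
    and F: "F = (\<lambda>ys. foldr (\<lambda>y a. f ((e, y), a)) ys (i e))"
    and C: "\<And>y ys zs. xs = zs @ y # ys \<Longrightarrow> Tf ((e, y), F ys) \<le> C"
    and xs: "xs = zs @ ys"
  shows "\<exists>t. eval P [enc (e, ys)] (P ! g) (enc (F ys)) t \<and>
    real t \<le> Ti e + 10 + real (length ys) * (C + 25)"
  using xs
proof (induction ys arbitrary: zs)
  case Nil
  have "eval P [enc (e, [] :: 'a list)] (RightE (Var 0)) (right (enc (e, [] :: 'a list))) (1 + 1)"
    by (intro eval_evals.RightE eval_Var0)
  then have 1: "eval P [enc (e, [] :: 'a list)] (RightE (Var 0)) Leaf 2"
    by (rule eval_cong) simp_all
  have "eval P [enc (e, [] :: 'a list)] (LeftE (Var 0)) (left (enc (e, [] :: 'a list))) (1 + 1)"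
    by (intro eval_evals.LeftE eval_Var0)
  then have "eval P [enc (e, [] :: 'a list)] (LeftE (Var 0)) (enc e) 2"
    by (rule eval_cong) simp_all
  from computes_call[OF i this, of 2] obtain t where
    t: "eval P [enc (e, [] :: 'a list)] (Call j [LeftE (Var 0)]) (enc (i e)) t" "real t \<le> 2 + Ti e + 1"
    by auto
  from eval_evals.IfFalse[OF 1 t(1)] show ?case
    unfolding g(2) using t(2) by (intro exI[of _ "2 + t + 1"] conjI) (simp_all add: F)
next
  case (Cons y ys)
  let ?env = "[enc (e, y # ys)]"
  have "eval P ?env (RightE (Var 0)) (right (enc (e, y # ys))) (1 + 1)"
    by (intro eval_evals.RightE eval_Var0)
  then have 1: "eval P ?env (RightE (Var 0)) (enc (y # ys)) 2"
    by (rule eval_cong) simp_all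
  have "eval P ?env (NodeE (LeftE (Var 0)) (RightE (RightE (Var 0))))
    (Node (left (enc (e, y # ys))) (right (right (enc (e, y # ys))))) ((1 + 1) + ((1 + 1) + 1) + 1)"
    by (intro eval_evals.NodeE eval_evals.RightE eval_evals.LeftE eval_Var0)
  then have 2: "eval P ?env (NodeE (LeftE (Var 0)) (RightE (RightE (Var 0)))) (enc (e, ys)) 6"
    by (rule eval_cong) simp_all
  obtain s where s: "eval P [enc (e, ys)] (P ! g) (enc (F ys)) s"
    "real s \<le> Ti e + 10 + real (length ys) * (C + 25)"
    using Cons.IH[of "zs @ [y]"] Cons.prems by auto
  have 3: "eval P ?env (Call g [NodeE (LeftE (Var 0)) (RightE (RightE (Var 0)))]) (enc (F ys)) ((6 + 0) + s + 1)"
    by (rule eval_evals.Call[OF g(1) eval_evals.Cons[OF 2 eval_evals.Nil] s(1)])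
  let ?env2 = "enc (F ys) # ?env"
  have "eval P ?env2 (NodeE (NodeE (LeftE (Var 1)) (LeftE (RightE (Var 1)))) (Var 0))
    (Node (Node (left (enc (e, y # ys))) (left (right (enc (e, y # ys))))) (enc (F ys)))
    (((1 + 1) + ((1 + 1) + 1) + 1) + 1 + 1)"
    by (intro eval_evals.NodeE eval_evals.RightE eval_evals.LeftE eval_Var0 eval_Var1)
  then have "eval P ?env2 (NodeE (NodeE (LeftE (Var 1)) (LeftE (RightE (Var 1)))) (Var 0))
    (enc ((e, y), F ys)) 8" by (rule eval_cong) simp_all
  from computes_call[OF f this, of 8] obtain t where
    t: "eval P ?env2 (Call h [NodeE (NodeE (LeftE (Var 1)) (LeftE (RightE (Var 1)))) (Var 0)])
      (enc (f ((e, y), F ys))) t" "real t \<le> 8 + Tf ((e, y), F ys) + 1"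
    by auto
  have "enc (y # ys) \<noteq> Leaf" by simp
  from eval_evals.IfTrue[OF 1 this eval_evals.Let[OF 3 t(1)]]
  have "eval P ?env (P ! g) (enc (F (y # ys))) (2 + (((6 + 0) + s + 1) + t + 1) + 1)"
    unfolding g(2) by (simp add: F)
  moreover have "Tf ((e, y), F ys) \<le> C"
    by (rule C[OF Cons.prems])
  ultimately show ?case
    using s(2) t(2)
    by (intro exI[of _ "2 + (((6 + 0) + s + 1) + t + 1) + 1"] conjI) (simp_all add: algebra_simps)
qed

text \<open>Iterating a polynomial-time step can square the accumulator again and again. The bound
  \<open>B\<close> on all intermediate results excludes this; it is needed for suffixes of the
  actual list only.\<close>

lemma ptime_foldr:
  fixes f :: "'e::encodable \<Rightarrow> 'a::encodable \<Rightarrow> 'b::encodable \<Rightarrow> 'b"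
  assumes f: "ptime (\<lambda>p. f (fst (fst p)) (snd (fst p)) (snd p))"
    and xs: "ptime xs" and i: "ptime i"
    and B: "pbd B" "\<And>e ys zs. xs e = zs @ ys \<Longrightarrow> real (esize (foldr (f e) ys (i e))) \<le> B e"
  shows "ptime (\<lambda>e. foldr (f e) (xs e) (i e))"
proof -
  let ?f = "\<lambda>p. f (fst (fst p)) (snd (fst p)) (snd p)"
  obtain d where d: "\<And>P. \<exists>Q h. computes (P @ Q) h ?f (\<lambda>x. (real (esize x) + 2) ^ d)"
    using ptime_programs[OF f] by blast
  obtain c where c: "\<And>P. \<exists>Q h. computes (P @ Q) h i (\<lambda>x. (real (esize x) + 2) ^ c)"
    using ptime_programs[OF i] by blast
  obtain a where a: "\<And>P. \<exists>Q h. computes (P @ Q) h xs (\<lambda>x. (real (esize x) + 2) ^ a)"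
    using ptime_programs[OF xs] by blast
  define C where "C e = (real (esize e) + real (esize (xs e)) + \<bar>B e\<bar> + 4) ^ d" for e
  define T where "T e = ((real (esize e) + 2) ^ c + 10 + real (esize (xs e)) * (C e + 25))
    + (real (esize e) + 2) ^ a + 10" for e
  have pbdC: "pbd C" unfolding C_def
    by (intro pbd_add pbd_power pbd_const pbd_esize ptime_pbd xs pbd_mono[OF B(1)]) auto
  show ?thesis
  proof (rule ptimeI)
    show "pbd (\<lambda>x. real (esize (foldr (f x) (xs x) (i x))))"
      by (rule pbd_mono[OF B(1)]) (use B(2)[of _ "[]"] in \<open>force intro: order_trans[OF _ abs_ge_self]\<close>)
    show "pbd T" unfolding T_def
      by (intro pbd_add pbd_mult pbd_power pbd_const pbd_esize ptime_pbd xs pbdC)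
    fix P
    obtain Q h where h: "computes (P @ Q) h ?f (\<lambda>x. (real (esize x) + 2) ^ d)" using d by blast
    obtain R j where j: "computes ((P @ Q) @ R) j i (\<lambda>x. (real (esize x) + 2) ^ c)" using c by blast
    obtain S k where k: "computes (((P @ Q) @ R) @ S) k xs (\<lambda>x. (real (esize x) + 2) ^ a)"
      using a by blast
    let ?P = "((P @ Q) @ R) @ S"
    define g where "g = length ?P"
    let ?b = "IfE (RightE (Var 0))
      (LetE (Call g [NodeE (LeftE (Var 0)) (RightE (RightE (Var 0)))])
        (Call h [NodeE (NodeE (LeftE (Var 1)) (LeftE (RightE (Var 1)))) (Var 0)]))
      (Call j [LeftE (Var 0)])"
    let ?P' = "?P @ [?b]" and ?b' = "Call g [NodeE (Var 0) (Call k [Var 0])]"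
    let ?P'' = "?P' @ [?b']"
    have "computes ?P'' (length ?P') (\<lambda>e. foldr (f e) (xs e) (i e)) T"
    proof (rule computes_last)
      fix e
      let ?F = "\<lambda>ys. foldr (\<lambda>y a. ?f ((e, y), a)) ys (i e)"
      have g: "g < length ?P''" "?P'' ! g = ?b" by (auto simp: g_def nth_append)
      have "\<exists>t. eval ?P'' [enc (e, xs e)] (?P'' ! g) (enc (?F (xs e))) t \<and>
        real t \<le> (real (esize e) + 2) ^ c + 10 + real (length (xs e)) * (C e + 25)"
      proof (rule eval_rec_list[OF _ _ g refl, where zs = "[]" and f = ?f])
        show "computes ?P'' h ?f (\<lambda>x. (real (esize x) + 2) ^ d)"
          by (intro computes_extend h)
        show "computes ?P'' j i (\<lambda>x. (real (esize x) + 2) ^ c)"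
          by (intro computes_extend j)
        fix y ys zs assume eq: "xs e = zs @ y # ys"
        have "esize y < esize (xs e)" using eq by (intro esize_member) simp
        moreover have "real (esize (?F ys)) \<le> B e" using B(2)[of e "zs @ [y]" ys] eq by simp
        ultimately show "(real (esize ((e, y), ?F ys)) + 2) ^ d \<le> C e"
          unfolding C_def by (intro power_mono) auto
      qed simp
      then obtain t where t: "eval ?P'' [enc (e, xs e)] (?P'' ! g) (enc (foldr (f e) (xs e) (i e))) t"
        "real t \<le> (real (esize e) + 2) ^ c + 10 + real (length (xs e)) * (C e + 25)" by auto
      obtain s where s: "eval ?P'' [enc e] (Call k [Var 0]) (enc (xs e)) s"
        "real s \<le> 1 + (real (esize e) + 2) ^ a + 1"
        using computes_call[OF computes_extend[OF computes_extend[OF k]] eval_Var0] by fastforce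
      have "eval ?P'' [enc e] (NodeE (Var 0) (Call k [Var 0])) (enc (e, xs e)) (1 + s + 1)"
        unfolding enc_Pair by (intro eval_evals.NodeE eval_Var0 s(1))
      from eval_evals.Call[OF g(1) eval_evals.Cons[OF this eval_evals.Nil] t(1)]
      have ev: "eval ?P'' [enc e] ?b' (enc (foldr (f e) (xs e) (i e))) ((1 + s + 1 + 0) + t + 1)" .
      have "real (length (xs e)) * (C e + 25) \<le> real (esize (xs e)) * (C e + 25)"
        by (intro mult_right_mono) (auto simp: C_def length_le_esize)
      with ev t(2) s(2) show "\<exists>t. eval ?P'' [enc e] ?b' (enc (foldr (f e) (xs e) (i e))) t \<and> real t \<le> T e"
        unfolding T_def by (intro exI[of _ "(1 + s + 1 + 0) + t + 1"] conjI) (assumption, simp)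
    qed
    then show "\<exists>Q g. computes (P @ Q) g (\<lambda>e. foldr (f e) (xs e) (i e)) T"
      by (metis append.assoc)
  qed
qed

section \<open>Polynomial-time list operations\<close>

lemma ptime_filter [ptime_intros]:
  assumes "ptime (\<lambda>p. f (fst p) (snd p))" and xs: "ptime xs"
  shows "ptime (\<lambda>e. filter (f e) (xs e))"
proof -
  have eq: "filter (f e) ys = foldr (\<lambda>y a. if f e y then y # a else a) ys []" for e ys
    by (induction ys) auto
  note f = ptime_comp[OF assms(1) ptime_fst[OF ptime_id]]
  have "ptime (\<lambda>e. foldr (\<lambda>y a. if f e y then y # a else a) (xs e) [])"
    by (intro ptime_foldr[where B = "\<lambda>e. real (esize (xs e))"] ptime_intros xs ptime_pbd f)
      (simp flip: eq, intro order_trans[OF of_nat_mono[OF esize_filter]], simp)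
  then show ?thesis unfolding eq .
qed

lemma ptime_map [ptime_intros]:
  assumes f: "ptime (\<lambda>p. f (fst p) (snd p))" and xs: "ptime xs"
  shows "ptime (\<lambda>e. map (f e) (xs e))"
proof -
  have eq: "map (f e) ys = foldr (\<lambda>y a. f e y # a) ys []" for e ys
    by (induction ys) auto
  obtain d where d: "\<And>p. real (esize (f (fst p) (snd p))) \<le> (real (esize p) + 2) ^ d"
    using ptime_esize[OF f] by blast
  let ?B = "\<lambda>e. real (esize (xs e)) * ((real (esize e) + real (esize (xs e)) + 3) ^ d + 1)"
  have "real (esize (map (f e) ys)) \<le> ?B e" if "xs e = zs @ ys" for e ys zs
  proof -
    let ?N = "(real (esize e) + real (esize (xs e)) + 3) ^ d + 1"
    have "real (esize (map (f e) ws)) \<le> real (length ws) * ?N" if "set ws \<subseteq> set (xs e)" for ws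
      using that
    proof (induction ws)
      case (Cons w ws)
      have "esize w < esize (xs e)" using Cons.prems by (intro esize_member) simp
      then have "(real (esize (e, w)) + 2) ^ d \<le> (real (esize e) + real (esize (xs e)) + 3) ^ d"
        by (intro power_mono) auto
      with d[of "(e, w)"] have "real (esize (f e w)) + 1 \<le> ?N" by simp
      with Cons show ?case by (simp add: algebra_simps)
    qed simp
    then have "real (esize (map (f e) ys)) \<le> real (length ys) * ?N" using that by simp
    also have "\<dots> \<le> ?B e"
      using length_le_esize[of "xs e"] that by (intro mult_right_mono) auto
    finally show ?thesis .
  qed
  moreover have "pbd ?B"
    by (intro pbd_add pbd_mult pbd_power pbd_const pbd_esize ptime_pbd xs)
  moreover have "ptime (\<lambda>p. f (fst (fst p)) (snd (fst p)))"
    using ptime_comp[OF f ptime_fst[OF ptime_id]] .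
  ultimately have "ptime (\<lambda>e. foldr (\<lambda>y a. f e y # a) (xs e) [])"
    by (intro ptime_foldr[where B = ?B] ptime_intros xs) (auto simp flip: eq)
  then show ?thesis unfolding eq .
qed

lemma ptime_ball [ptime_intros]:
  assumes f: "ptime (\<lambda>p. f (fst p) (snd p))" and xs: "ptime xs"
  shows "ptime (\<lambda>e. \<forall>y\<in>set (xs e). f e y)"
proof -
  have eq: "(\<forall>y\<in>set ys. f e y) = foldr (\<lambda>y a. f e y \<and> a) ys True" for e ys
    by (induction ys) auto
  have "ptime (\<lambda>p. f (fst (fst p)) (snd (fst p)))"
    using ptime_comp[OF f ptime_fst[OF ptime_id]] .
  then have "ptime (\<lambda>e. foldr (\<lambda>y a. f e y \<and> a) (xs e) True)"
    by (intro ptime_foldr[where B = "\<lambda>_. 1"] ptime_intros xs pbd_const)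
      (use esize_bool in auto)
  then show ?thesis unfolding eq .
qed

lemma ptime_bex [ptime_intros]:
  assumes f: "ptime (\<lambda>p. f (fst p) (snd p))" and xs: "ptime xs"
  shows "ptime (\<lambda>e. \<exists>y\<in>set (xs e). f e y)"
  using ptime_not[OF ptime_ball[OF ptime_not[OF f] xs]] by simp

lemma ptime_append [ptime_intros]:
  assumes "ptime xs" "ptime ys"
  shows "ptime (\<lambda>e. xs e @ ys e)"
proof -
  have eq: "xs @ ys = foldr (#) xs ys" for xs ys :: "'c list"
    by (induction xs) auto
  have "ptime (\<lambda>e. foldr (#) (xs e) (ys e))"
    by (intro ptime_foldr[where B = "\<lambda>e. real (esize (xs e)) + real (esize (ys e))"]
        ptime_intros assms pbd_add ptime_pbd) (auto simp flip: eq)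
  then show ?thesis unfolding eq .
qed

lemma ptime_concat [ptime_intros]:
  assumes "ptime xss"
  shows "ptime (\<lambda>e. concat (xss e))"
proof -
  have eq: "concat xss = foldr (@) xss []" for xss :: "'c list list"
    by (induction xss) auto
  have "ptime (\<lambda>e. foldr (@) (xss e) [])"
    by (intro ptime_foldr[where B = "\<lambda>e. real (esize (xss e))"] ptime_intros assms ptime_pbd)
      (simp flip: eq, intro order_trans[OF of_nat_mono[OF esize_concat]], simp)
  then show ?thesis unfolding eq .
qed

lemma ptime_product [ptime_intros]:
  assumes "ptime xs" "ptime ys"
  shows "ptime (\<lambda>e. List.product (xs e) (ys e))"
proof -
  have eq: "List.product (xs e) (ys e) = concat (map (\<lambda>x. map (\<lambda>y. (x, y)) (ys e)) (xs e))" for e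
    by (induction "xs e") (auto simp: product_concat_map)
  have "ptime (\<lambda>p. ys (fst p))"
    by (intro ptime_comp[OF assms(2)] ptime_intros)
  then have "ptime (\<lambda>e. concat (map (\<lambda>x. map (\<lambda>y. (x, y)) (ys e)) (xs e)))"
    by (intro ptime_intros ptime_comp[OF assms(2)] assms)
  then show ?thesis unfolding eq .
qed

text \<open>The primitives only provide tests for emptiness, so equality recurses on trees.\<close>

lemma ptime_tree_eq: "ptime (\<lambda>p :: tree \<times> tree. fst p = snd p)"
proof -
  define T where "T p = real (40 * esize p + 10)" for p :: "tree \<times> tree"
  show ?thesis
  proof (rule ptimeI)
    show "pbd T" unfolding T_def of_nat_add of_nat_mult by (intro pbd_add pbd_mult pbd_const pbd_esize)
    show "pbd (\<lambda>p :: tree \<times> tree. real (esize (fst p = snd p)))"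
      by (rule pbd_mono[OF pbd_const[of 1]]) (use esize_bool in auto)
    fix P :: program
    define g where "g = length P"
    define bdy where "bdy = IfE (LeftE (Var 0))
      (IfE (RightE (Var 0))
        (IfE (Call g [NodeE (LeftE (LeftE (Var 0))) (LeftE (RightE (Var 0)))])
          (Call g [NodeE (RightE (LeftE (Var 0))) (RightE (RightE (Var 0)))]) LeafE) LeafE)
      (IfE (RightE (Var 0)) LeafE (NodeE LeafE LeafE))"
    let ?P = "P @ [bdy]"
    have g: "g < length ?P" "?P ! g = bdy" by (simp_all add: g_def)
    have "\<exists>t \<le> 40 * size u + 10. eval ?P [Node u v] bdy (enc (u = v)) t" for u v
    proof (induction u arbitrary: v)
      case Leaf
      have "eval ?P [Node Leaf v] (LeftE (Var 0)) (left (Node Leaf v)) (1 + 1)"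
        by (intro eval_evals.LeftE eval_Var0)
      then have 1: "eval ?P [Node Leaf v] (LeftE (Var 0)) Leaf 2" by (rule eval_cong) simp_all
      have "eval ?P [Node Leaf v] (RightE (Var 0)) (right (Node Leaf v)) (1 + 1)"
        by (intro eval_evals.RightE eval_Var0)
      then have 2: "eval ?P [Node Leaf v] (RightE (Var 0)) v 2" by (rule eval_cong) simp_all
      show ?case
      proof (cases v)
        case Leaf
        have "eval ?P [Node Leaf v] bdy (Node Leaf Leaf) (2 + (2 + (1 + 1 + 1) + 1) + 1)"
          using eval_evals.IfFalse[OF 1[unfolded Leaf] eval_evals.IfFalse[OF 2[unfolded Leaf] eval_evals.NodeE[OF eval_evals.LeafE eval_evals.LeafE]]]
            Leaf unfolding bdy_def by blast
        then show ?thesis using Leaf by (intro exI[of _ 9]) simp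
      next
        case (Node a b)
        have "eval ?P [Node Leaf v] (IfE (RightE (Var 0)) LeafE (NodeE LeafE LeafE)) Leaf (2 + 1 + 1)"
          using Node by (intro eval_evals.IfTrue[OF 2] eval_evals.LeafE) auto
        from eval_evals.IfFalse[OF 1 this]
        have "eval ?P [Node Leaf v] bdy Leaf (2 + (2 + 1 + 1) + 1)" unfolding bdy_def .
        then show ?thesis using Node by (intro exI[of _ 7]) simp
      qed
    next
      case (Node a b)
      let ?env = "[Node (Node a b) v]"
      have "eval ?P ?env (LeftE (Var 0)) (left (Node (Node a b) v)) (1 + 1)"
        by (intro eval_evals.LeftE eval_Var0)
      then have 1: "eval ?P ?env (LeftE (Var 0)) (Node a b) 2" by (rule eval_cong) simp_all
      have "eval ?P ?env (RightE (Var 0)) (right (Node (Node a b) v)) (1 + 1)"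
        by (intro eval_evals.RightE eval_Var0)
      then have 2: "eval ?P ?env (RightE (Var 0)) v 2" by (rule eval_cong) simp_all
      have n: "Node a b \<noteq> Leaf" by simp
      show ?case
      proof (cases v)
        case Leaf
        from eval_evals.IfTrue[OF 1[unfolded Leaf] n eval_evals.IfFalse[OF 2[unfolded Leaf] eval_evals.LeafE]] Leaf
        have "eval ?P ?env bdy Leaf (2 + (2 + 1 + 1) + 1)" unfolding bdy_def by blast
        then show ?thesis using Leaf by (intro exI[of _ 7]) simp
      next
        case v: (Node c d)
        obtain s where s: "eval ?P [Node a c] (?P ! g) (enc (a = c)) s" "s \<le> 40 * size a + 10"
          using Node.IH(1) g(2) by metis
        obtain t where t: "eval ?P [Node b d] (?P ! g) (enc (b = d)) t" "t \<le> 40 * size b + 10"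
          using Node.IH(2) g(2) by metis
        have "eval ?P ?env (NodeE (LeftE (LeftE (Var 0))) (LeftE (RightE (Var 0))))
          (Node (left (Node a b)) (left v)) ((2 + 1) + (2 + 1) + 1)"
          by (intro eval_evals.NodeE eval_evals.LeftE 1 2)
        then have "eval ?P ?env (NodeE (LeftE (LeftE (Var 0))) (LeftE (RightE (Var 0)))) (Node a c) 7"
          by (rule eval_cong) (simp_all add: v)
        from eval_evals.Call[OF g(1) eval_evals.Cons[OF this eval_evals.Nil] s(1)]
        have 3: "eval ?P ?env (Call g [NodeE (LeftE (LeftE (Var 0))) (LeftE (RightE (Var 0)))])
          (enc (a = c)) (7 + 0 + s + 1)" .
        have "eval ?P ?env (NodeE (RightE (LeftE (Var 0))) (RightE (RightE (Var 0))))
          (Node (right (Node a b)) (right v)) ((2 + 1) + (2 + 1) + 1)"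
          by (intro eval_evals.NodeE eval_evals.RightE 1 2)
        then have "eval ?P ?env (NodeE (RightE (LeftE (Var 0))) (RightE (RightE (Var 0)))) (Node b d) 7"
          by (rule eval_cong) (simp_all add: v)
        from eval_evals.Call[OF g(1) eval_evals.Cons[OF this eval_evals.Nil] t(1)]
        have 4: "eval ?P ?env (Call g [NodeE (RightE (LeftE (Var 0))) (RightE (RightE (Var 0)))])
          (enc (b = d)) (7 + 0 + t + 1)" .
        have v': "v \<noteq> Leaf" using v by simp
        show ?thesis
        proof (cases "a = c")
          case True
          then have "enc (a = c) \<noteq> Leaf" by simp
          from eval_evals.IfTrue[OF 1 n eval_evals.IfTrue[OF 2 v' eval_evals.IfTrue[OF 3 this 4]]]
          have "eval ?P ?env bdy (enc (b = d))
            (2 + (2 + ((7 + 0 + s + 1) + (7 + 0 + t + 1) + 1) + 1) + 1)" unfolding bdy_def by blast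
          then show ?thesis using v True s(2) t(2)
            by (intro exI[of _ "2 + (2 + ((7 + 0 + s + 1) + (7 + 0 + t + 1) + 1) + 1) + 1"]) simp
        next
          case False
          then have "enc (a = c) = Leaf" by simp
          from eval_evals.IfTrue[OF 1 n eval_evals.IfTrue[OF 2 v'
            eval_evals.IfFalse[OF 3[unfolded this] eval_evals.LeafE]]]
          have "eval ?P ?env bdy Leaf (2 + (2 + ((7 + 0 + s + 1) + 1 + 1) + 1) + 1)"
            unfolding bdy_def by blast
          then show ?thesis using v False s(2) t(2)
            by (intro exI[of _ "2 + (2 + ((7 + 0 + s + 1) + 1 + 1) + 1) + 1"]) simp
        qed
      qed
    qed
    then have "computes ?P (length P) (\<lambda>p. fst p = snd p) T"
      by (intro computes_last) (fastforce simp: T_def esize_def enc_prod_def)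
    then show "\<exists>Q i. computes (P @ Q) i (\<lambda>p. fst p = snd p) T" by blast
  qed
qed

lemma ptime_eq [ptime_intros]:
  assumes "ptime f" "ptime g"
  shows "ptime (\<lambda>x. f x = g x)"
proof -
  have "ptime (\<lambda>x. (enc (f x), enc (g x)))"
    using ptime_comp[OF ptime_retype[of "\<lambda>p. (enc (fst p), enc (snd p))"] ptime_Pair[OF assms]]
    by (simp add: enc_prod_def)
  from ptime_comp[OF ptime_tree_eq this] show ?thesis by simp
qed

lemma ptime_member [ptime_intros]:
  assumes "ptime f" "ptime xs"
  shows "ptime (\<lambda>e. f e \<in> set (xs e))"
proof -
  have "ptime (\<lambda>e. \<exists>y\<in>set (xs e). f e = y)"
    by (intro ptime_intros assms ptime_comp[OF assms(1)])
  then show ?thesis by simp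
qed

lemma ptime_hd [ptime_intros]:
  assumes "ptime xs"
  shows "ptime (\<lambda>e. hd (xs e))"
proof -
  \<comment> \<open>The unspecified value \<open>hd []\<close> is some fixed value, so the program
    can contain it as a constant and agrees with \<open>hd\<close> on the empty list as
    well.\<close>
  have "ptime (\<lambda>e. foldr (\<lambda>y a. y) (xs e) (hd []))"
    by (intro ptime_foldr[where B = "\<lambda>e. real (esize (xs e)) + real (esize (hd [] :: 'b))"]
        ptime_intros assms pbd_add ptime_pbd pbd_const) (case_tac ys; auto)
  moreover have "foldr (\<lambda>y a. y) ys (hd []) = hd ys" for ys :: "'b list"
    by (cases ys) auto
  ultimately show ?thesis by simp
qed

text \<open>Dropping one element of \<open>xs e\<close> for each element of \<open>ys e\<close>
  leaves nothing exactly in this case; this replaces arithmetic on lengths.\<close>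

lemma ptime_length_le [ptime_intros]:
  assumes "ptime xs" "ptime ys"
  shows "ptime (\<lambda>e. length (xs e) \<le> length (ys e))"
proof -
  have drop: "foldr (\<lambda>_. tl) ys xs = drop (length ys) xs" for ys :: "'c list" and xs :: "'b list"
    by (induction ys) (auto simp: drop_Suc drop_tl)
  have "esize (drop n zs) \<le> esize zs" for n and zs :: "'b list"
    by (metis append_take_drop_id esize_append le_add2)
  then have "ptime (\<lambda>e. foldr (\<lambda>_. tl) (ys e) (xs e))"
    by (intro ptime_foldr[where B = "\<lambda>e. real (esize (xs e))"] ptime_intros assms ptime_pbd)
      (auto simp: drop)
  then have "ptime (\<lambda>e. foldr (\<lambda>_. tl) (ys e) (xs e) = [])"
    by (intro ptime_intros)
  then show ?thesis by (simp add: drop)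
qed

subsection \<open>Bounded search trees\<close>

text \<open>The conjunction is evaluated as a conditional, so the possibly exponential cost of
  \<open>f\<close> is paid only where \<open>b\<close> holds.\<close>

lemma ctime_guard:
  assumes b: "ptime b" and f: "ctime f W" and W: "\<And>x. 1 \<le> W x"
  shows "ctime (\<lambda>x. b x \<and> f x) (\<lambda>x. if b x then W x else 1)"
proof -
  obtain a where a: "\<And>P. \<exists>Q i. computes (P @ Q) i b (\<lambda>x. (real (esize x) + 2) ^ a)"
    using ptime_programs[OF b] by blast
  obtain d where d: "\<And>P. \<exists>Q i. computes (P @ Q) i f (\<lambda>x. W x * (real (esize x) + 2) ^ d)"
    using f by (auto simp: ctime_def)
  define T where "T x = (real (esize x) + 2) ^ a + (real (esize x) + 2) ^ d + 5" for x :: 'a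
  define V where "V x = (if b x then W x else 1)" for x
  have V: "1 \<le> V x" for x using W by (simp add: V_def)
  have "ctime (\<lambda>x. b x \<and> f x) V"
  proof (rule ctimeI)
    show "pbd T" unfolding T_def by (intro pbd_add pbd_power pbd_const pbd_esize)
    show "0 \<le> V x" for x using V[of x] by linarith
    fix P
    obtain Q i where i: "computes (P @ Q) i b (\<lambda>x. (real (esize x) + 2) ^ a)" using a by blast
    obtain R j where j: "computes ((P @ Q) @ R) j f (\<lambda>x. W x * (real (esize x) + 2) ^ d)"
      using d by blast
    let ?P = "(P @ Q) @ R" and ?b = "IfE (Call i [Var 0]) (Call j [Var 0]) LeafE"
    have "computes (?P @ [?b]) (length ?P) (\<lambda>x. b x \<and> f x) (\<lambda>x. V x * T x)"
    proof (rule computes_last)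
      fix x
      obtain s where s: "eval (?P @ [?b]) [enc x] (Call i [Var 0]) (enc (b x)) s"
        "real s \<le> 1 + (real (esize x) + 2) ^ a + 1"
        using computes_call[OF computes_extend[OF computes_extend[OF i]] eval_Var0] by fastforce
      obtain t where t: "eval (?P @ [?b]) [enc x] (Call j [Var 0]) (enc (f x)) t"
        "real t \<le> 1 + W x * (real (esize x) + 2) ^ d + 1"
        using computes_call[OF computes_extend[OF j] eval_Var0] by fastforce
      have "1 * ((real (esize x) + 2) ^ a + 5) \<le> V x * ((real (esize x) + 2) ^ a + 5)"
        using V by (intro mult_right_mono) auto
      then have VT: "V x * T x \<ge> (real (esize x) + 2) ^ a + 5 + V x * (real (esize x) + 2) ^ d"
        by (simp add: T_def algebra_simps)
      show "\<exists>t. eval (?P @ [?b]) [enc x] ?b (enc (b x \<and> f x)) t \<and> real t \<le> V x * T x"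
      proof (cases "b x")
        case True
        then have "enc (b x) \<noteq> Leaf" by simp
        from eval_evals.IfTrue[OF s(1) this t(1)] True
        have "eval (?P @ [?b]) [enc x] ?b (enc (b x \<and> f x)) (s + t + 1)" by simp
        moreover have "real (s + t + 1) \<le> V x * T x"
          using VT s(2) t(2) True by (simp add: V_def)
        ultimately show ?thesis by blast
      next
        case False
        then have "enc (b x) = Leaf" by simp
        from eval_evals.IfFalse[OF s(1)[unfolded this] eval_evals.LeafE] False
        have "eval (?P @ [?b]) [enc x] ?b (enc (b x \<and> f x)) (s + 1 + 1)" by auto
        moreover have "0 \<le> V x * (real (esize x) + 2) ^ d"
          using V[of x] by (intro mult_nonneg_nonneg) auto
        then have "real (s + 1 + 1) \<le> V x * T x"
          using VT s(2) by simp
        ultimately show ?thesis by blast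
      qed
    qed
    then show "\<exists>Q i. computes (P @ Q) i (\<lambda>x. b x \<and> f x) (\<lambda>x. V x * T x)"
      by (metis append.assoc)
  qed
  then show ?thesis by (simp add: V_def[abs_def])
qed

text \<open>
  The potential \<open>W\<close> bounds the number of leaves of the search tree; as \<open>W\<close> is at least 1 everywhere,
  it drops by at least 1 at each branching, so the search terminates.
\<close>

lemma ctime_search:
  fixes W :: "'a::encodable \<Rightarrow> real"
  assumes b: "ptime b" and c1: "ptime c1" and c2: "ptime c2" and f: "ctime f V"
    and F: "\<And>x. F x \<longleftrightarrow> (if b x then f x else F (c1 x) \<or> F (c2 x))"
    and size: "\<And>x. \<not> b x \<Longrightarrow> esize (c1 x) \<le> esize x" "\<And>x. \<not> b x \<Longrightarrow> esize (c2 x) \<le> esize x"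
    and W: "\<And>x. 1 \<le> W x" "\<And>x. b x \<Longrightarrow> V x \<le> W x"
      "\<And>x. \<not> b x \<Longrightarrow> W (c1 x) + W (c2 x) \<le> W x"
  shows "ctime F W"
proof -
  obtain a where a: "\<And>P. \<exists>Q i. computes (P @ Q) i b (\<lambda>x. (real (esize x) + 2) ^ a)"
    using ptime_programs[OF b] by blast
  obtain d1 where d1: "\<And>P. \<exists>Q i. computes (P @ Q) i c1 (\<lambda>x. (real (esize x) + 2) ^ d1)"
    using ptime_programs[OF c1] by blast
  obtain d2 where d2: "\<And>P. \<exists>Q i. computes (P @ Q) i c2 (\<lambda>x. (real (esize x) + 2) ^ d2)"
    using ptime_programs[OF c2] by blast
  obtain e where e: "\<And>P. \<exists>Q i. computes (P @ Q) i f (\<lambda>x. V x * (real (esize x) + 2) ^ e)"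
    using f by (auto simp: ctime_def)
  define C where "C n = (real n + 2) ^ a + (real n + 2) ^ d1 + (real n + 2) ^ d2 + (real n + 2) ^ e + 20" for n
  have C_mono: "C m \<le> C n" if "m \<le> n" for m n
    unfolding C_def using that by (intro add_mono power_mono) auto
  have C_nonneg: "0 \<le> C n" for n
    unfolding C_def by (intro add_nonneg_nonneg) auto
  show ?thesis
  proof (rule ctimeI)
    show "pbd (\<lambda>x. 2 * C (esize x))"
      unfolding C_def by (intro pbd_mult pbd_add pbd_power pbd_const pbd_esize)
    show "0 \<le> W x" for x using W(1)[of x] by linarith
    fix P
    obtain Q1 h where "computes (P @ Q1) h b (\<lambda>x. (real (esize x) + 2) ^ a)" using a by blast
    moreover obtain Q2 i where "computes ((P @ Q1) @ Q2) i c1 (\<lambda>x. (real (esize x) + 2) ^ d1)"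
      using d1 by blast
    moreover obtain Q3 j where "computes (((P @ Q1) @ Q2) @ Q3) j c2 (\<lambda>x. (real (esize x) + 2) ^ d2)"
      using d2 by blast
    moreover obtain Q4 k where "computes ((((P @ Q1) @ Q2) @ Q3) @ Q4) k f
        (\<lambda>x. V x * (real (esize x) + 2) ^ e)"
      using e by blast
    moreover define P' where "P' = (((P @ Q1) @ Q2) @ Q3) @ Q4"
    ultimately have h: "computes P' h b (\<lambda>x. (real (esize x) + 2) ^ a)"
      and i: "computes P' i c1 (\<lambda>x. (real (esize x) + 2) ^ d1)"
      and j: "computes P' j c2 (\<lambda>x. (real (esize x) + 2) ^ d2)"
      and k: "computes P' k f (\<lambda>x. V x * (real (esize x) + 2) ^ e)"
      by (auto intro: computes_extend simp del: append_assoc)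
    define g where "g = length P'"
    define bdy where "bdy = IfE (Call h [Var 0]) (Call k [Var 0])
      (IfE (Call g [Call i [Var 0]]) (NodeE LeafE LeafE) (Call g [Call j [Var 0]]))"
    let ?P = "P' @ [bdy]"
    have g: "g < length ?P" "?P ! g = bdy" by (simp_all add: g_def)
    \<comment> \<open>A binary tree with \<open>W x\<close> leaves has \<open>2 * W x - 1\<close>
      nodes; each node costs at most \<open>C (esize x)\<close>, since sizes do not grow along the
      search.\<close>
    have "\<exists>t. eval ?P [enc x] bdy (enc (F x)) t \<and> real t \<le> (2 * W x - 1) * C (esize x)" for x
    proof (induction "nat \<lfloor>W x\<rfloor>" arbitrary: x rule: less_induct)
      case less
      let ?n = "real (esize x) + 2"
      have pos: "0 \<le> ?n ^ a" "0 \<le> ?n ^ d1" "0 \<le> ?n ^ d2" "0 \<le> ?n ^ e" by auto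
      obtain r where r: "eval ?P [enc x] (Call h [Var 0]) (enc (b x)) r" "real r \<le> 1 + ?n ^ a + 1"
        using computes_call[OF computes_extend[OF h] eval_Var0] by fastforce
      show ?case
      proof (cases "b x")
        case True
        obtain t where t: "eval ?P [enc x] (Call k [Var 0]) (enc (f x)) t"
          "real t \<le> 1 + V x * ?n ^ e + 1"
          using computes_call[OF computes_extend[OF k] eval_Var0] by fastforce
        have "enc (b x) \<noteq> Leaf" using True by simp
        from eval_evals.IfTrue[OF r(1) this t(1)]
        have ev: "eval ?P [enc x] bdy (enc (F x)) (r + t + 1)"
          using True by (simp add: bdy_def F[of x])
        have "real r + real t + 1 \<le> 1 * (?n ^ a + 5) + V x * ?n ^ e"
          using r(2) t(2) by simp
        also have "\<dots> \<le> (2 * W x - 1) * (?n ^ a + ?n ^ d1 + ?n ^ d2 + 20) + (2 * W x - 1) * ?n ^ e"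
          using W(1)[of x] W(2)[OF True] pos by (intro add_mono mult_mono) auto
        also have "\<dots> = (2 * W x - 1) * C (esize x)"
          by (simp add: C_def algebra_simps)
        finally have "real r + real t + 1 \<le> (2 * W x - 1) * C (esize x)" .
        then have "real (r + t + 1) \<le> (2 * W x - 1) * C (esize x)" by simp
        with ev show ?thesis by blast
      next
        case False
        have lt: "nat \<lfloor>W (c1 x)\<rfloor> < nat \<lfloor>W x\<rfloor>" "nat \<lfloor>W (c2 x)\<rfloor> < nat \<lfloor>W x\<rfloor>"
          using W(3)[OF False] W(1)[of "c1 x"] W(1)[of "c2 x"] by linarith+
        obtain s where s: "eval ?P [enc x] (Call i [Var 0]) (enc (c1 x)) s" "real s \<le> 1 + ?n ^ d1 + 1"
          using computes_call[OF computes_extend[OF i] eval_Var0] by fastforce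
        obtain t where t: "eval ?P [enc x] (Call j [Var 0]) (enc (c2 x)) t" "real t \<le> 1 + ?n ^ d2 + 1"
          using computes_call[OF computes_extend[OF j] eval_Var0] by fastforce
        obtain u where u: "eval ?P [enc (c1 x)] (?P ! g) (enc (F (c1 x))) u"
          "real u \<le> (2 * W (c1 x) - 1) * C (esize (c1 x))"
          using less.hyps[OF lt(1)] g(2) by metis
        obtain v where v: "eval ?P [enc (c2 x)] (?P ! g) (enc (F (c2 x))) v"
          "real v \<le> (2 * W (c2 x) - 1) * C (esize (c2 x))"
          using less.hyps[OF lt(2)] g(2) by metis
        have u2: "real u \<le> (2 * W (c1 x) - 1) * C (esize x)"
          using u(2) W(1)[of "c1 x"] C_mono[OF size(1)[OF False]]
          by (elim order_trans) (intro mult_left_mono; simp)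
        have v2: "real v \<le> (2 * W (c2 x) - 1) * C (esize x)"
          using v(2) W(1)[of "c2 x"] C_mono[OF size(2)[OF False]]
          by (elim order_trans) (intro mult_left_mono; simp)
        have 1: "eval ?P [enc x] (Call g [Call i [Var 0]]) (enc (F (c1 x))) (s + 0 + u + 1)"
          by (rule eval_evals.Call[OF g(1) eval_evals.Cons[OF s(1) eval_evals.Nil] u(1)])
        have 2: "eval ?P [enc x] (Call g [Call j [Var 0]]) (enc (F (c2 x))) (t + 0 + v + 1)"
          by (rule eval_evals.Call[OF g(1) eval_evals.Cons[OF t(1) eval_evals.Nil] v(1)])
        have "enc (b x) = Leaf" using False by simp
        note if1 = eval_evals.IfFalse[OF r(1)[unfolded this]]
        have sum: "real u + real v + C (esize x) \<le> (2 * W x - 1) * C (esize x)"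
        proof -
          have "(W (c1 x) + W (c2 x)) * C (esize x) \<le> W x * C (esize x)"
            using W(3)[OF False] C_nonneg by (intro mult_right_mono) auto
          then show ?thesis using u2 v2 by (simp add: algebra_simps)
        qed
        have "real r + ?n ^ d1 + ?n ^ d2 + 18 \<le> C (esize x)"
          using r(2) pos unfolding C_def by linarith
        with sum have sum': "real r + real u + real v + ?n ^ d1 + ?n ^ d2 + 18 \<le> (2 * W x - 1) * C (esize x)"
          by linarith
        show ?thesis
        proof (cases "F (c1 x)")
          case True
          then have "enc (F (c1 x)) \<noteq> Leaf" by simp
          from if1[OF eval_evals.IfTrue[OF 1 this eval_evals.NodeE[OF eval_evals.LeafE eval_evals.LeafE]]]
          have "eval ?P [enc x] bdy (enc (F x)) (r + ((s + 0 + u + 1) + (1 + 1 + 1) + 1) + 1)"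
            using True False by (simp add: bdy_def F[of x])
          moreover have "real (r + ((s + 0 + u + 1) + (1 + 1 + 1) + 1) + 1) \<le> (2 * W x - 1) * C (esize x)"
            unfolding of_nat_add of_nat_1 of_nat_0 using sum' s(2) pos(3) of_nat_0_le_iff[of v] by linarith
          ultimately show ?thesis by blast
        next
          case F1: False
          then have "enc (F (c1 x)) = Leaf" by simp
          from if1[OF eval_evals.IfFalse[OF 1[unfolded this] 2]]
          have "eval ?P [enc x] bdy (enc (F x)) (r + ((s + 0 + u + 1) + (t + 0 + v + 1) + 1) + 1)"
            using F1 False by (simp add: bdy_def F[of x])
          moreover have "real (r + ((s + 0 + u + 1) + (t + 0 + v + 1) + 1) + 1) \<le> (2 * W x - 1) * C (esize x)"
            using sum' s(2) t(2) by simp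
          ultimately show ?thesis by blast
        qed
      qed
    qed
    moreover have "(2 * W x - 1) * C (esize x) \<le> W x * (2 * C (esize x))" for x
      using C_nonneg by (simp add: algebra_simps)
    ultimately have "computes ?P (length P') F (\<lambda>x. W x * (2 * C (esize x)))"
      by (intro computes_last) (meson order_trans)
    then show "\<exists>Q i. computes (P @ Q) i F (\<lambda>x. W x * (2 * C (esize x)))"
      unfolding P'_def by (metis append.assoc)
  qed
qed

section \<open>Dense sets and cores of multigraphs\<close>

text \<open>This counts the ends of \<open>e\<close> at \<open>v\<close>. A loop has both of its
  ends there, so a vertex with a loop is dense by itself, as it must be if loops are cycles.\<close>

definition occ :: "'v \<Rightarrow> 'v uprod \<Rightarrow> nat" where
  "occ v e = (if v \<in> set_uprod e then if proper_uprod e then 1 else 2 else 0)"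

lemma occ_Upair [simp]: "occ v (Upair a b) = of_bool (a = v) + of_bool (b = v)"
  by (auto simp: occ_def)

lemma set_uprod_nonempty [simp]: "set_uprod e \<noteq> {}"
  by (cases e) auto

lemma occ_eq_0_iff [simp]: "occ v e = 0 \<longleftrightarrow> v \<notin> set_uprod e"
  by (auto simp: occ_def)

definition nedges :: "'v uprod multiset \<Rightarrow> 'v set \<Rightarrow> nat" where
  "nedges M U = size (filter_mset (\<lambda>e. set_uprod e \<subseteq> U) M)"

definition deg :: "'v uprod multiset \<Rightarrow> 'v set \<Rightarrow> 'v \<Rightarrow> nat" where
  "deg M U v = (\<Sum>e\<in>#filter_mset (\<lambda>e. set_uprod e \<subseteq> U) M. occ v e)"

lemma nedges_simps [simp]:
  "nedges {#} U = 0"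
  "nedges (add_mset e M) U = of_bool (set_uprod e \<subseteq> U) + nedges M U"
  by (simp_all add: nedges_def)

lemma deg_simps [simp]:
  "deg {#} U v = 0"
  "deg (add_mset e M) U v = (if set_uprod e \<subseteq> U then occ v e else 0) + deg M U v"
  by (simp_all add: deg_def)

lemma deg_mono: "U \<subseteq> W \<Longrightarrow> deg M U v \<le> deg M W v"
  by (induction M) auto

lemma deg_union: "deg (M + N) U v = deg M U v + deg N U v"
  by (simp add: deg_def)

lemma deg_notin: "v \<notin> U \<Longrightarrow> deg M U v = 0"
  by (induction M) auto

lemma deg_mono_edges: "M \<subseteq># N \<Longrightarrow> deg M U v \<le> deg N U v"
  by (metis deg_union le_add1 subset_mset.add_diff_inverse)

lemma deg_nonzeroE:
  assumes "deg M U v \<noteq> 0"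
  obtains e where "e \<in># M" "set_uprod e \<subseteq> U" "v \<in> set_uprod e"
  using assms by (auto simp: deg_def)

lemma deg_filter: "(\<And>e. set_uprod e \<subseteq> U \<Longrightarrow> P e) \<Longrightarrow> deg (filter_mset P M) U v = deg M U v"
  by (induction M) auto

lemma deg_cong:
  assumes "U \<subseteq> W" "\<And>e. e \<in># M \<Longrightarrow> v \<in> set_uprod e \<Longrightarrow> set_uprod e \<subseteq> W \<Longrightarrow> set_uprod e \<subseteq> U"
  shows "deg M U v = deg M W v"
  using assms by (induction M) auto

text \<open>Each edge contributes to the degree in \<open>W\<close> at least what it contributes in
  \<open>U\<close>. If the sums do not differ, no summand does.\<close>

lemma deg_le_imp_subset:
  assumes "U \<subseteq> W" "deg M W v \<le> deg M U v" "e \<in># M" "v \<in> set_uprod e" "set_uprod e \<subseteq> W"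
  shows "set_uprod e \<subseteq> U"
  using assms(2,3)
proof (induction M)
  case (add f M)
  have "deg M U v \<le> deg M W v" by (rule deg_mono) fact
  then have *: "(if set_uprod f \<subseteq> W then occ v f else 0) \<le> (if set_uprod f \<subseteq> U then occ v f else 0)"
    "deg M W v \<le> deg M U v"
    using add.prems(1) assms(1) by (auto split: if_splits)
  show ?case
  proof (cases "e = f")
    case True
    then show ?thesis using *(1) assms(4,5) by (auto split: if_splits)
  next
    case False
    then show ?thesis using *(2) add by auto
  qed
qed simp

text \<open>The degree sum over \<open>Y\<close> counts edges between \<open>X\<close> and
  \<open>Y\<close> once and edges inside \<open>Y\<close> twice; the second count is balanced on the
  left-hand side.\<close>

lemma nedges_union:
  assumes "finite Y" "X \<inter> Y = {}"
  shows "nedges M (X \<union> Y) + nedges M Y = nedges M X + (\<Sum>v\<in>Y. deg M (X \<union> Y) v)"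
proof (induction M)
  case (add e M)
  obtain a b where e: "e = Upair a b" by (cases e) auto
  have "of_bool (set_uprod e \<subseteq> X \<union> Y) + of_bool (set_uprod e \<subseteq> Y)
    = of_bool (set_uprod e \<subseteq> X) + (\<Sum>v\<in>Y. if set_uprod e \<subseteq> X \<union> Y then occ v e else 0)"
    using assms by (auto simp: e sum.distrib split: if_splits)
  with add show ?case by (simp add: sum.distrib)
qed simp

lemma sum_deg: "finite U \<Longrightarrow> (\<Sum>v\<in>U. deg M U v) = 2 * nedges M U"
proof -
  have "nedges M {} = 0" by (induction M) (auto simp: nedges_def)
  then show "finite U \<Longrightarrow> ?thesis" using nedges_union[of U "{}" M] by simp
qed

definition dense :: "'v uprod multiset \<Rightarrow> 'v set \<Rightarrow> bool" where
  "dense M U \<longleftrightarrow> (\<forall>v\<in>U. 2 \<le> deg M U v)"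

definition core :: "'v uprod multiset \<Rightarrow> 'v set \<Rightarrow> 'v set" where
  "core M A = \<Union>{U. U \<subseteq> A \<and> dense M U}"

lemma core_subset: "core M A \<subseteq> A"
  by (auto simp: core_def)

lemma core_greatest: "U \<subseteq> A \<Longrightarrow> dense M U \<Longrightarrow> U \<subseteq> core M A"
  by (auto simp: core_def)

lemma dense_core: "dense M (core M A)"
  unfolding dense_def
proof
  fix v assume "v \<in> core M A"
  then obtain U where "U \<subseteq> A" "dense M U" "v \<in> U" by (auto simp: core_def)
  then show "2 \<le> deg M (core M A) v"
    using deg_mono[OF core_greatest[of U A M], of M v] by (force simp: dense_def)
qed

lemma core_mono: "A \<subseteq> B \<Longrightarrow> core M A \<subseteq> core M B"
  by (auto simp: core_def)

lemma core_eqI: "core M A \<subseteq> B \<Longrightarrow> B \<subseteq> A \<Longrightarrow> core M B = core M A"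
  by (meson core_greatest core_mono dense_core subset_antisym)

lemma core_of_dense: "dense M U \<Longrightarrow> core M U = U"
  by (meson core_greatest core_subset order_refl subset_antisym)

lemma core_remove_low:
  assumes "deg M U x \<le> 1"
  shows "core M (U - {x}) = core M U"
proof (rule core_eqI)
  have "x \<notin> core M U"
  proof
    assume "x \<in> core M U"
    then have "2 \<le> deg M (core M U) x" using dense_core[of M U] by (simp add: dense_def)
    also have "\<dots> \<le> deg M U x" by (rule deg_mono[OF core_subset])
    finally show False using assms by simp
  qed
  then show "core M U \<subseteq> U - {x}" using core_subset by fast
qed auto

text \<open>Pruning as an induction rule: vertices of degree at most 1 are stripped one at a time
  until the set is dense.\<close>

lemma core_induct [consumes 1, case_names dense remove]:
  assumes "finite U"
    and "\<And>U. finite U \<Longrightarrow> dense M U \<Longrightarrow> P U"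
    and "\<And>U x. finite U \<Longrightarrow> x \<in> U \<Longrightarrow> deg M U x \<le> 1 \<Longrightarrow> P (U - {x}) \<Longrightarrow> P U"
  shows "P U"
  using assms(1)
proof (induction U rule: finite_psubset_induct)
  case (psubset U)
  show ?case
  proof (cases "dense M U")
    case False
    then obtain x where x: "x \<in> U" "deg M U x \<le> 1" by (auto simp: dense_def not_le)
    then have "P (U - {x})" by (intro psubset.IH) auto
    then show ?thesis using assms(3)[OF psubset.hyps x] by blast
  qed (use assms(2)[OF psubset.hyps] in blast)
qed

text \<open>Pruning a vertex of degree at most 1 removes at most one edge, and an empty core means
  that pruning removes everything.\<close>

lemma nedges_le_card:
  assumes "finite U" "core M U = {}"
  shows "nedges M U \<le> card U - 1"
  using assms
proof (induction U rule: core_induct[where M = M])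
  case (dense U)
  then have "U = {}" by (simp add: core_of_dense)
  then show ?case using sum_deg[of "{}" M] by simp
next
  case (remove U x)
  have "nedges M U + nedges M {x} = nedges M (U - {x}) + deg M U x"
    using nedges_union[of "{x}" "U - {x}" M] remove.hyps by (simp add: insert_absorb)
  moreover have "nedges M (U - {x}) \<le> card (U - {x}) - 1"
    using remove by (simp add: core_remove_low)
  moreover have "2 * nedges M {x} \<le> deg M U x"
    using sum_deg[of "{x}" M] deg_mono[of "{x}" U M x] remove.hyps by simp
  moreover have "card U \<noteq> 0" using remove.hyps by auto
  moreover have "card (U - {x}) = card U - 1" using remove.hyps by simp
  ultimately show ?case
  \<comment> \<open>For a single vertex the truncated subtraction does not drop from
    \<open>U\<close> to \<open>U - {x}\<close>. There the degree bound excludes a loop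
    directly.\<close>
  proof (cases "card U = 1")
    case True
    then have "U = {x}" using remove.hyps by (auto simp: card_1_singleton_iff)
    then show ?thesis using sum_deg[of "{x}" M] remove.hyps by simp
  qed (use remove.hyps in linarith)
qed

section \<open>Cycles\<close>

text \<open>Every vertex occurs once in \<open>vs\<close> and once in \<open>rotate1 vs\<close>,
  which gives two edge ends, also when the cycle is a loop or a double edge.\<close>

lemma dense_cycle:
  assumes "distinct vs" "vs \<noteq> []"
  shows "dense (closed_walk_edges vs) (set vs)"
  unfolding dense_def
proof
  fix v assume v: "v \<in> set vs"
  have gen: "deg (mset (map2 Upair xs ys)) U v = count (mset xs) v + count (mset ys) v"
    if "length xs = length ys" "set xs \<subseteq> U" "set ys \<subseteq> U" for xs ys and U :: "'a set"
    using that by (induction xs ys rule: list_induct2) auto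
  have "count (mset vs) v = 1" "mset (rotate1 vs) = mset vs"
    using assms v by (simp_all add: distinct_count_atmost_1) (cases vs; simp)
  then show "2 \<le> deg (closed_walk_edges vs) (set vs) v"
    unfolding closed_walk_edges_def by (subst gen) auto
qed

lemma path_edges_mset:
  assumes "distinct p"
  shows "distinct (map2 Upair p (tl p))"
  using assms
proof (induction p)
  case (Cons x p)
  show ?case
  proof (cases p)
    case (Cons y q)
    have "x \<in> set_uprod (Upair x y)" by simp
    moreover have "\<forall>e\<in>set (map2 Upair p (tl p)). set_uprod e \<subseteq> set p"
      using set_zip_leftD set_zip_rightD Cons by (fastforce dest: list.set_sel(2)[rotated])
    ultimately have "Upair x y \<notin> set (map2 Upair p (tl p))"
      using Cons.prems by force
    then show ?thesis using Cons.IH Cons.prems Cons by simp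
  qed simp
qed simp

lemma path_edges_append: "set (map2 Upair p (tl p)) \<subseteq> set (map2 Upair (p @ q) (tl (p @ q)))"
proof (induction p)
  case (Cons x p)
  then show ?case by (cases p) auto
qed simp

text \<open>The first vertex \<open>x\<close> of a longest path has an edge end that the path does
  not use. By maximality the other end of that edge lies on the path, and the edge closes a cycle.
  Most of the work is the multiplicity count for a double edge.\<close>

lemma dense_imp_cycle:
  assumes fin: "finite U" and ne: "U \<noteq> {}" and dense: "dense M U"
  shows "\<exists>vs. vs \<noteq> [] \<and> distinct vs \<and> set vs \<subseteq> U \<and> closed_walk_edges vs \<subseteq># M"
proof -
  define path where "path p \<longleftrightarrow> p \<noteq> [] \<and> distinct p \<and> set p \<subseteq> U \<and> set (map2 Upair p (tl p)) \<subseteq> set_mset M" for p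
  obtain u where "u \<in> U" using ne by blast
  then have "path [u]" by (simp add: path_def)
  moreover have "length p \<le> card U" if "path p" for p
    using that fin unfolding path_def by (metis card_mono distinct_card)
  ultimately obtain p where p: "path p" and max: "\<And>q. path q \<Longrightarrow> length q \<le> length p"
    using ex_has_greatest_nat[of path "[u]" length "Suc (card U)"] by (metis le_imp_less_Suc)
  obtain x q where x: "p = x # q" using p by (cases p) (auto simp: path_def)
  \<comment> \<open>The path edge at \<open>x\<close>, if there is one. Choosing \<open>e\<close>
    from \<open>M - N\<close> yields another edge or a further parallel copy of this one.\<close>
  define N where "N = (if q = [] then {#} else {#Upair x (hd q)#})"
  have N: "N \<subseteq># M"
    using p by (cases q) (auto simp: N_def path_def x)
  have "x \<notin> set q" using p by (simp add: path_def x)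
  then have "deg N U x \<le> 1"
    by (cases q) (auto simp: N_def)
  moreover have "2 \<le> deg M U x" using dense p by (auto simp: dense_def path_def x)
  moreover have "deg M U x = deg N U x + deg (M - N) U x"
    using N by (metis deg_union subset_mset.add_diff_inverse)
  ultimately have "deg (M - N) U x \<noteq> 0" by linarith
  then obtain e where e: "e \<in># M - N" "set_uprod e \<subseteq> U" "x \<in> set_uprod e"
    by (rule deg_nonzeroE)
  have eM: "e \<in># M" using e(1) by (meson in_diffD)
  obtain y where y: "e = Upair x y" using e(3) by (cases e) auto
  have yp: "y \<in> set p"
  proof (rule ccontr)
    assume "y \<notin> set p"
    moreover have "Upair y x \<in># M" using eM y by (metis Upair_inject)
    ultimately have "path (y # p)"
      using p e(2) y by (auto simp: path_def x)
    from max[OF this] show False by simp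
  qed
  then obtain r s where rs: "p = r @ y # s" by (meson split_list)
  define vs where "vs = r @ [y]"
  have hd_vs: "hd vs = x" "last vs = y" "vs \<noteq> []"
    using rs x by (cases r; auto simp: vs_def)+
  have "closed_walk_edges vs = add_mset (Upair y x) (mset (map2 Upair vs (tl vs)))"
  proof -
    have len: "length r = length (tl vs)" by (simp add: vs_def)
    have "rotate1 vs = tl vs @ [x]" using hd_vs by (cases vs) auto
    then have "map2 Upair vs (rotate1 vs) = map2 Upair (r @ [y]) (tl vs @ [x])"
      by (simp add: vs_def)
    also have "\<dots> = map2 Upair r (tl vs) @ [Upair y x]"
      using len by simp
    also have "map2 Upair r (tl vs) = map2 Upair vs (tl vs)"
      using len by (simp add: zip_append1 vs_def)
    finally show ?thesis by (simp add: closed_walk_edges_def)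
  qed
  moreover have "add_mset (Upair y x) (mset (map2 Upair vs (tl vs))) \<subseteq># M"
  proof -
    have sub: "set (map2 Upair vs (tl vs)) \<subseteq> set_mset M"
    proof -
      have "set (map2 Upair vs (tl vs)) \<subseteq> set (map2 Upair p (tl p))"
        using path_edges_append[of vs s] rs by (simp add: vs_def)
      then show ?thesis using p by (auto simp: path_def)
    qed
    have dist: "distinct (map2 Upair vs (tl vs))"
      using p rs by (intro path_edges_mset) (auto simp: path_def vs_def)
    have xy: "Upair y x = e" using y by simp
    have count_le: "count (mset (map2 Upair vs (tl vs))) f \<le> 1" for f
      using dist by (metis distinct_count_atmost_1 le_numeral_extra(4) zero_le_one)
    show ?thesis
    proof (rule mset_subset_eqI)
      fix f
      show "count (add_mset (Upair y x) (mset (map2 Upair vs (tl vs)))) f \<le> count M f"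
      proof (cases "f \<in> set (map2 Upair vs (tl vs))")
        case False
        then have "count (mset (map2 Upair vs (tl vs))) f = 0" by (simp add: count_eq_zero_iff)
        then show ?thesis using xy eM by (auto simp: Suc_le_eq)
      next
        case True
        then have fM: "f \<in># M" using sub by blast
        show ?thesis
        proof (cases "f = e")
          case False
          then show ?thesis using xy count_le[of f] fM
            by (metis count_add_mset count_greater_eq_one_iff le_trans)
        next
          \<comment> \<open>The closing edge coincides with a path edge only if it joins
            \<open>x\<close> to its successor. Then \<open>N = {#e#}\<close>, so \<open>e\<close>
            was a second copy and has multiplicity at least 2.\<close>
          case feq: True
          obtain x' vs' where vs': "vs = x' # vs'" using hd_vs by (cases vs) auto
          then have x': "x' = x" using hd_vs by simp
          obtain v vs'' where vs'': "vs' = v # vs''" using True vs' by (cases vs') auto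
          have dvs: "distinct vs" using p rs by (auto simp: path_def vs_def)
          have "Upair x y \<notin> set (map2 Upair (v # vs'') vs'')"
            using dvs vs' vs'' x' by (auto elim!: in_set_zipE)
          then have "y = v" using True feq y vs' vs'' x' dvs by auto
          moreover have "q = v # vs'' @ s"
          proof -
            have "x # q = vs @ s" using rs x by (simp add: vs_def)
            then show ?thesis using vs' vs'' x' by simp
          qed
          ultimately have "N = {#e#}" using y by (simp add: N_def)
          then have "e \<in># M - {#e#}" using e(1) by simp
          then have "2 \<le> count M e" by (simp add: in_diff_count)
          then show ?thesis using feq xy count_le[of f] by simp
        qed
      qed
    qed
  qed
  ultimately show ?thesis
    using hd_vs p rs by (intro exI[of _ vs]) (auto simp: path_def vs_def)
qed

lemma forest_iff_core:
  assumes "finite V"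
  shows "forest (delete_verts \<lparr>mverts = V, medges = M\<rparr> S) \<longleftrightarrow> core M (V - S) = {}"
proof -
  let ?M = "filter_mset (\<lambda>e. set_uprod e \<inter> S = {}) M"
  have dense: "dense ?M U \<longleftrightarrow> dense M U" if "U \<subseteq> V - S" for U
    using that unfolding dense_def by (subst deg_filter) auto
  show ?thesis
  proof
    assume L: "forest (delete_verts \<lparr>mverts = V, medges = M\<rparr> S)"
    show "core M (V - S) = {}"
    proof (rule ccontr)
      let ?K = "core M (V - S)"
      assume "?K \<noteq> {}"
      moreover have "dense ?M ?K" using dense[OF core_subset] dense_core by blast
      ultimately obtain vs where "vs \<noteq> []" "distinct vs" "set vs \<subseteq> ?K" "closed_walk_edges vs \<subseteq># ?M"
        using dense_imp_cycle[of ?K ?M] assms core_subset[of M "V - S"] finite_subset by blast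
      then have "is_cycle (delete_verts \<lparr>mverts = V, medges = M\<rparr> S) vs"
        using core_subset[of M "V - S"] by (auto simp: is_cycle_def delete_verts_def)
      then show False using L by (auto simp: forest_def)
    qed
  next
    assume R: "core M (V - S) = {}"
    show "forest (delete_verts \<lparr>mverts = V, medges = M\<rparr> S)"
      unfolding forest_def
    proof
      assume "\<exists>vs. is_cycle (delete_verts \<lparr>mverts = V, medges = M\<rparr> S) vs"
      then obtain vs where vs: "vs \<noteq> []" "distinct vs" "set vs \<subseteq> V - S" "closed_walk_edges vs \<subseteq># ?M"
        by (auto simp: is_cycle_def delete_verts_def)
      then have "dense ?M (set vs)"
        using dense_cycle[of vs] deg_mono_edges by (fastforce simp: dense_def intro: order_trans)
      then have "set vs \<subseteq> core M (V - S)"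
        using dense vs by (intro core_greatest) auto
      then show False using vs R by auto
    qed
  qed
qed

section \<open>Excess degrees\<close>

text \<open>
  Vertices outside \<open>F\<close> contribute only while their degree is below 2. This makes the sum
  monotone under pruning: a vertex of degree 2 outside \<open>F\<close> that loses an edge takes over
  the loss until it is pruned itself.
\<close>

definition balance :: "'v uprod multiset \<Rightarrow> 'v set \<Rightarrow> 'v set \<Rightarrow> 'v \<Rightarrow> int" where
  "balance M F U v = (if v \<in> F then int (deg M U v) - 2 else min 0 (int (deg M U v) - 2))"

definition excess :: "'v uprod multiset \<Rightarrow> 'v set \<Rightarrow> 'v set \<Rightarrow> int" where
  "excess M F U = (\<Sum>v\<in>U. balance M F U v)"

text \<open>Both branches of \<open>balance\<close> fall by at most the loss in degree.\<close>

lemma balance_mono: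
  assumes "U \<subseteq> W"
  shows "balance M F W v - (int (deg M W v) - int (deg M U v)) \<le> balance M F U v"
  using deg_mono[OF assms, of M v] by (auto simp: balance_def)

text \<open>Besides the balances of \<open>X\<close> itself, the remaining vertices lose one unit
  for each edge between \<open>X\<close> and \<open>U - X\<close>, and the number of these edges is
  at most the degree sum of \<open>X\<close>.\<close>

lemma excess_diff:
  assumes "finite U" "X \<subseteq> U"
  shows "excess M F U - (\<Sum>x\<in>X. balance M F U x + int (deg M U x)) \<le> excess M F (U - X)"
proof -
  have U: "U - X \<union> X = U" "(U - X) \<inter> X = {}" "finite X" using assms finite_subset by auto
  have sum_split: "(\<Sum>v\<in>U. f v) = (\<Sum>v\<in>U - X. f v) + (\<Sum>v\<in>X. f v)" for f :: "'a \<Rightarrow> int"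
    using assms by (simp add: sum.subset_diff add.commute)
  have "(\<Sum>v\<in>U - X. int (deg M U v) - int (deg M (U - X) v)) \<le> (\<Sum>x\<in>X. int (deg M U x))"
  proof -
    have "(\<Sum>v\<in>U. int (deg M U v)) = 2 * int (nedges M U)"
      "(\<Sum>v\<in>U - X. int (deg M (U - X) v)) = 2 * int (nedges M (U - X))"
      using sum_deg[of U M] sum_deg[of "U - X" M] assms by (simp_all flip: of_nat_sum)
    moreover have "int (nedges M U) + int (nedges M X) = int (nedges M (U - X)) + (\<Sum>x\<in>X. int (deg M U x))"
      using nedges_union[OF U(3,2), of M] U(1) by (simp flip: of_nat_sum of_nat_add)
    ultimately show ?thesis
      using sum_split[of "\<lambda>v. int (deg M U v)"] by (simp add: sum_subtractf)
  qed
  moreover have "(\<Sum>v\<in>U - X. balance M F U v - (int (deg M U v) - int (deg M (U - X) v))) \<le> excess M F (U - X)"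
    unfolding excess_def by (intro sum_mono balance_mono) auto
  ultimately show ?thesis
    using sum_split[of "balance M F U"] by (simp add: excess_def sum_subtractf sum.distrib)
qed

text \<open>A pruned vertex has degree \<open>d \<le> 1\<close> and balance \<open>d - 2\<close>,
  inside and outside \<open>F\<close>. Its removal changes the lower bound by
  \<open>- (2 d - 2) \<ge> 0\<close>.\<close>

lemma excess_core_ge:
  assumes "finite U"
  shows "excess M F U \<le> excess M F (core M U)"
  using assms
proof (induction U rule: core_induct[where M = M])
  case (remove U x)
  have "excess M F U \<le> excess M F (U - {x})"
    using excess_diff[of U "{x}" M F] remove.hyps by (auto simp: balance_def split: if_splits)
  also have "\<dots> \<le> excess M F (core M U)"
    using remove by (simp add: core_remove_low)
  finally show ?case .
qed (simp add: core_of_dense)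

lemma excess_dense:
  assumes "dense M U" "finite U"
  shows "excess M F U = (\<Sum>v\<in>U \<inter> F. int (deg M U v) - 2)"
proof -
  have "excess M F U = (\<Sum>v\<in>U. if v \<in> F then int (deg M U v) - 2 else 0)"
    unfolding excess_def using assms(1) by (intro sum.cong) (auto simp: balance_def dense_def)
  then show ?thesis using assms(2) by (simp add: sum.inter_restrict)
qed

text \<open>A deleted vertex outside \<open>F\<close> has balance at most 0, so only its degree is
  charged; the pruning that follows does not lower the excess.\<close>

lemma excess_core_remove:
  assumes "finite A" "S \<inter> F = {}"
  shows "excess M F (core M A) - (\<Sum>x\<in>S \<inter> core M A. int (deg M (core M A) x)) \<le> excess M F (core M (A - S))"
proof -
  let ?K = "core M A"
  have fin: "finite ?K" using assms(1) core_subset finite_subset by metis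
  have "core M (?K - S) = core M (A - S)"
    by (rule core_eqI) (use core_mono[of "A - S" A M] core_subset[of M "A - S"] core_subset[of M A] in auto)
  then have "excess M F (?K - S \<inter> ?K) \<le> excess M F (core M (A - S))"
    using excess_core_ge[of "?K - S" M F] fin by (simp add: Diff_Int_distrib Diff_Int)
  moreover have "(\<Sum>x\<in>S \<inter> ?K. balance M F ?K x + int (deg M ?K x)) \<le> (\<Sum>x\<in>S \<inter> ?K. int (deg M ?K x))"
    using assms(2) by (intro sum_mono) (auto simp: balance_def)
  ultimately show ?thesis
    using excess_diff[of ?K "S \<inter> ?K" M F] fin by auto
qed

text \<open>The empty core has excess 0, so the degrees of the solution vertices have to pay for all
  of the excess.\<close>

lemma excess_le_solution:
  assumes "finite A" "S \<inter> F = {}" "core M (A - S) = {}"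
  shows "excess M F (core M A) \<le> (\<Sum>x\<in>S \<inter> core M A. int (deg M (core M A) x))"
  using excess_core_remove[OF assms(1,2), of M] assms(3) by (simp add: excess_def)

section \<open>Interchangeable vertices\<close>

text \<open>The set \<open>core M (A - {u})\<close> is the union of all dense subsets of
  \<open>A\<close> that avoid \<open>u\<close>. Equality of two such unions therefore means that
  \<open>u\<close> and \<open>v\<close> lie in the same dense subsets of \<open>A\<close>.\<close>

lemma label_swap:
  assumes "core M (A - {u}) = core M (A - {v})" "dense M W" "W \<subseteq> A" "u \<in> W"
  shows "v \<in> W"
proof (rule ccontr)
  assume "v \<notin> W"
  then have "W \<subseteq> core M (A - {v})" using assms by (intro core_greatest) auto
  then show False using assms core_subset[of M "A - {u}"] by auto
qed

text \<open>A dense set containing a vertex of degree 2 in the core must retain both edge ends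
  there, hence also all its neighbours in the core. So adjacent vertices of degree 2 belong to the
  same dense sets.\<close>

lemma label_adjacent:
  assumes "Upair v w \<in># M" "v \<in> core M A" "w \<in> core M A"
    and "deg M (core M A) v = 2" "deg M (core M A) w = 2"
  shows "core M (A - {v}) = core M (A - {w})"
proof -
  have "y \<in> W" if W: "dense M W" "W \<subseteq> A" "x \<in> W"
    and xy: "Upair x y \<in># M" "x \<in> core M A" "y \<in> core M A" "deg M (core M A) x = 2" for W x y
  proof -
    have "W \<subseteq> core M A" using W by (intro core_greatest)
    moreover have "deg M (core M A) x \<le> deg M W x" using W xy by (auto simp: dense_def)
    ultimately have "set_uprod (Upair x y) \<subseteq> W"
      by (rule deg_le_imp_subset[where v = x]) (use xy in auto)
    then show ?thesis by simp
  qed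
  moreover have "Upair w v \<in># M" using assms(1) by (metis Upair_inject)
  ultimately have "v \<in> W \<longleftrightarrow> w \<in> W" if "dense M W" "W \<subseteq> A" for W
    using assms that by blast
  then have "U \<subseteq> A - {v} \<and> dense M U \<longleftrightarrow> U \<subseteq> A - {w} \<and> dense M U" for U by blast
  then show ?thesis unfolding core_def by simp
qed

text \<open>The degree-2 vertices of the core are grouped into classes by label. At most
  \<open>card S\<close> classes are hit by \<open>S\<close>. In the forest left by \<open>S\<close>
  each remaining class counts for at least one edge on the vertices of degree at least 3
  (\<open>D3\<close>), so there are at most \<open>card D3\<close> of them, and the excess allows
  \<open>card D3 \<le> 2 * card S\<close>.\<close>

lemma card_labels_le:
  assumes fin: "finite A" and SC: "S \<subseteq> C" and "finite S" and sol: "core M (A - S) = {}"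
    and deg2: "\<And>u. u \<in> C \<Longrightarrow> deg M (core M A) u \<le> 2"
  shows "card ((\<lambda>u. core M (A - {u})) ` (C \<inter> core M A)) \<le> 3 * card S"
proof -
  let ?K = "core M A" and ?lab = "\<lambda>u. core M (A - {u})"
  have finK: "finite ?K" using fin core_subset finite_subset by metis
  have ge2: "2 \<le> deg M ?K v" if "v \<in> ?K" for v using that dense_core[of M A] by (auto simp: dense_def)
  define D3 where "D3 = {v \<in> ?K. 3 \<le> deg M ?K v}"
  define D where "D c = {v \<in> ?K. deg M ?K v = 2 \<and> ?lab v = c}" for c
  define H where "H = ?lab ` (S \<inter> ?K)"
  define Lu where "Lu = ?lab ` (C \<inter> ?K) - H"
  have finD: "finite (D c)" "finite D3" for c using finK by (auto simp: D_def D3_def)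
  \<comment> \<open>Vertices of \<open>D3\<close> lie outside \<open>C\<close>, hence outside
    \<open>S\<close>, and have excess at least 1 each, while a vertex of \<open>S\<close> destroys
    at most 2.\<close>
  have "card D3 \<le> 2 * card S"
  proof -
    have "int (card D3) = (\<Sum>v\<in>D3. 1)" by simp
    also have "\<dots> \<le> (\<Sum>v\<in>D3. int (deg M ?K v) - 2)" by (intro sum_mono) (auto simp: D3_def)
    also have "\<dots> \<le> (\<Sum>v\<in>?K \<inter> (- S). int (deg M ?K v) - 2)"
      using finK SC deg2 ge2 by (intro sum_mono2) (force simp: D3_def)+
    also have "\<dots> = excess M (- S) ?K" using excess_dense[OF dense_core finK] by metis
    also have "\<dots> \<le> (\<Sum>x\<in>S \<inter> ?K. int (deg M ?K x))"
      using fin sol by (intro excess_le_solution) auto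
    also have "\<dots> \<le> (\<Sum>x\<in>S \<inter> ?K. 2)" using SC deg2 by (intro sum_mono) fastforce
    also have "\<dots> \<le> 2 * int (card S)" using \<open>finite S\<close> by (simp add: card_mono)
    finally show ?thesis by linarith
  qed
  moreover have "card Lu \<le> card D3"
  proof -
    \<comment> \<open>A class \<open>D c\<close> has degree sum \<open>2 * card (D c)\<close> but
      spans at most \<open>card (D c) - 1\<close> edges, so adding it brings at least
      \<open>card (D c) + 1\<close> new edges, one more than its vertices.\<close>
    have grow: "card T + card (\<Union>(D ` T)) \<le> nedges M (D3 \<union> \<Union>(D ` T))" if "finite T" "T \<subseteq> Lu" for T
      using that
    proof (induction T)
      case (insert c T)
      let ?X = "D3 \<union> \<Union>(D ` T)"
      have disj: "?X \<inter> D c = {}" using insert.hyps by (auto simp: D_def D3_def)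
      have "D c \<noteq> {}"
      proof -
        obtain u where "u \<in> C" "u \<in> ?K" "?lab u = c" using insert.prems by (auto simp: Lu_def)
        then have "u \<in> D c" using deg2[of u] ge2[of u] by (simp add: D_def)
        then show ?thesis by blast
      qed
      have hit: "D c \<inter> S = {}" using insert.prems by (auto simp: D_def Lu_def H_def)
      have "D c \<subseteq> A - S" using hit core_subset[of M A] by (auto simp: D_def)
      then have "core M (D c) = {}" using sol core_mono by blast
      then have "nedges M (D c) \<le> card (D c) - 1" by (intro nedges_le_card finD)
      \<comment> \<open>Every neighbour in the core has degree at least 3 or, by
        \<open>label_adjacent\<close>, belongs to the same class. So no edge at \<open>v\<close> is
        lost in the smaller set.\<close>
      moreover have "deg M (?X \<union> D c) v = 2" if v: "v \<in> D c" for v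
      proof -
        have "deg M (?X \<union> D c) v = deg M ?K v"
        proof (rule deg_cong)
          show "?X \<union> D c \<subseteq> ?K" by (auto simp: D_def D3_def)
          fix e assume e: "e \<in># M" "v \<in> set_uprod e" "set_uprod e \<subseteq> ?K"
          then obtain w where w: "e = Upair v w" by (cases e) auto
          have "w \<in> D3 \<or> w \<in> D c"
          proof (cases "3 \<le> deg M ?K w")
            case False
            then have "deg M ?K w = 2" using ge2[of w] e w by simp
            moreover from this have "?lab v = ?lab w"
              using label_adjacent[of v w M A] e w v by (auto simp: D_def)
            ultimately show ?thesis using v e w by (auto simp: D_def)
          qed (use e w in \<open>auto simp: D3_def\<close>)
          then show "set_uprod e \<subseteq> ?X \<union> D c" using v w by auto
        qed
        then show ?thesis using v by (simp add: D_def)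
      qed
      then have "(\<Sum>v\<in>D c. deg M (?X \<union> D c) v) = 2 * card (D c)" by simp
      moreover note nedges_union[OF finD(1) disj, of M]
      moreover have "card (D c) > 0" using \<open>D c \<noteq> {}\<close> finD(1) by (simp add: card_gt_0_iff)
      moreover have "card (\<Union>(D ` T) \<union> D c) \<le> card (\<Union>(D ` T)) + card (D c)" by (rule card_Un_le)
      moreover have "card T + card (\<Union>(D ` T)) \<le> nedges M ?X" using insert by auto
      ultimately have "Suc (card T) + card (\<Union>(D ` T) \<union> D c) \<le> nedges M (?X \<union> D c)" by linarith
      then show ?case using insert.hyps by (simp add: Un_ac)
    qed simp
    have finLu: "finite Lu" using finK by (auto simp: Lu_def)
    have "D3 \<union> \<Union>(D ` Lu) \<subseteq> A - S"
    proof -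
      have "D3 \<inter> S = {}" using SC deg2 by (force simp: D3_def)
      moreover have "D c \<inter> S = {}" if "c \<in> Lu" for c using that by (auto simp: D_def Lu_def H_def)
      moreover have "D3 \<subseteq> A" "D c \<subseteq> A" for c using core_subset[of M A] by (auto simp: D_def D3_def)
      ultimately show ?thesis by blast
    qed
    then have "core M (D3 \<union> \<Union>(D ` Lu)) = {}" using core_mono[of _ "A - S" M] sol by blast
    then have "nedges M (D3 \<union> \<Union>(D ` Lu)) \<le> card (D3 \<union> \<Union>(D ` Lu)) - 1"
      by (intro nedges_le_card) (use finD finLu in auto)
    then show ?thesis using grow[OF finLu order_refl] card_Un_le[of D3 "\<Union>(D ` Lu)"] by linarith
  qed
  moreover have "card (?lab ` (C \<inter> ?K)) \<le> card Lu + card H"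
  proof -
    have "?lab ` (C \<inter> ?K) \<subseteq> Lu \<union> H" by (auto simp: Lu_def)
    moreover have "finite (Lu \<union> H)" using finK by (auto simp: Lu_def H_def)
    ultimately show ?thesis using card_Un_le[of Lu H] by (meson card_mono order_trans)
  qed
  moreover have "card H \<le> card S"
  proof -
    have "card H \<le> card (S \<inter> ?K)" unfolding H_def using \<open>finite S\<close> by (intro card_image_le) auto
    also have "\<dots> \<le> card S" using \<open>finite S\<close> by (intro card_mono) auto
    finally show ?thesis .
  qed
  ultimately show ?thesis by linarith
qed

section \<open>Maximum bipartite matchings\<close>

definition matching :: "('a \<times> 'b) set \<Rightarrow> ('a \<times> 'b) list \<Rightarrow> bool" where
  "matching E M \<longleftrightarrow> set M \<subseteq> E \<and> distinct (map fst M) \<and> distinct (map snd M)"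

lemma matching_fst_inj: "matching E M \<Longrightarrow> e \<in> set M \<Longrightarrow> f \<in> set M \<Longrightarrow> fst e = fst f \<Longrightarrow> e = f"
  unfolding matching_def distinct_map by (meson inj_onD)

lemma matching_snd_inj: "matching E M \<Longrightarrow> e \<in> set M \<Longrightarrow> f \<in> set M \<Longrightarrow> snd e = snd f \<Longrightarrow> e = f"
  unfolding matching_def distinct_map by (meson inj_onD)

lemma matching_length: "matching E M \<Longrightarrow> length M = card (set M)"
  unfolding matching_def distinct_map by (metis distinct_card)

text \<open>One step of switching along an alternating path. If the right end of \<open>e\<close> is
  free, nothing is removed and the same operation augments.\<close>

definition replace_edge :: "'a \<times> 'b \<Rightarrow> ('a \<times> 'b) list \<Rightarrow> ('a \<times> 'b) list" where
  "replace_edge e N = e # filter (\<lambda>f. snd f \<noteq> snd e) N"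

definition partner :: "'a \<times> 'b \<Rightarrow> ('a \<times> 'b) list \<Rightarrow> 'a" where
  "partner e N = fst (hd (filter (\<lambda>f. snd f = snd e) N))"

text \<open>
  An entry \<open>(p, N)\<close> of the list \<open>Z\<close> stands for an alternating path from an unmatched left vertex
  to \<open>p\<close>; \<open>N\<close> is the matching obtained by switching along this path, which leaves \<open>p\<close> free.
\<close>

type_synonym ('a, 'b) front = "('a \<times> ('a \<times> 'b) list) list"

definition growing :: "('a \<times> 'b) list \<Rightarrow> ('a, 'b) front \<Rightarrow> (('a \<times> ('a \<times> 'b) list) \<times> ('a \<times> 'b)) list" where
  "growing E Z = filter (\<lambda>c. fst (fst c) = fst (snd c) \<and> snd (snd c) \<in> set (map snd (snd (fst c))) \<and>
     partner (snd c) (snd (fst c)) \<notin> set (map fst Z)) (List.product Z E)"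

definition grow :: "('a \<times> 'b) list \<Rightarrow> ('a, 'b) front \<Rightarrow> ('a, 'b) front" where
  "grow E Z = (if growing E Z = [] then Z
     else (partner (snd (hd (growing E Z))) (snd (fst (hd (growing E Z)))),
           replace_edge (snd (hd (growing E Z))) (snd (fst (hd (growing E Z))))) # Z)"

definition front0 :: "('a \<times> 'b) list \<Rightarrow> ('a \<times> 'b) list \<Rightarrow> ('a, 'b) front" where
  "front0 E M = map (\<lambda>e. (fst e, M)) (filter (\<lambda>e. fst e \<notin> set (map fst M)) E)"

definition front :: "('a \<times> 'b) list \<Rightarrow> ('a \<times> 'b) list \<Rightarrow> ('a, 'b) front" where
  "front E M = foldr (\<lambda>_. grow E) E (front0 E M)"

definition augmenting :: "('a \<times> 'b) list \<Rightarrow> ('a \<times> 'b) list \<Rightarrow> (('a \<times> ('a \<times> 'b) list) \<times> ('a \<times> 'b)) list" where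
  "augmenting E M = filter (\<lambda>c. fst (fst c) = fst (snd c) \<and> snd (snd c) \<notin> set (map snd (snd (fst c))))
     (List.product (front E M) E)"

definition augment :: "('a \<times> 'b) list \<Rightarrow> ('a \<times> 'b) list \<Rightarrow> ('a \<times> 'b) list" where
  "augment E M = (if augmenting E M = [] then M
     else replace_edge (snd (hd (augmenting E M))) (snd (fst (hd (augmenting E M)))))"

definition max_matching :: "('a \<times> 'b) list \<Rightarrow> ('a \<times> 'b) list" where
  "max_matching E = foldr (\<lambda>_. augment E) E []"

section \<open>Correctness of the augmenting-path algorithm\<close>

text \<open>The list is merely a loop counter. Each effective round increases \<open>m\<close>,
  which is below \<open>length xs\<close> before every such round, so the iteration has come to rest
  at the end.\<close>

lemma foldr_until_stuck:
  fixes m :: "'s \<Rightarrow> nat"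
  assumes "I z" "\<And>z. I z \<Longrightarrow> I (f z)"
    and stuck: "\<And>z. I z \<Longrightarrow> stuck z \<Longrightarrow> f z = z"
    and progress: "\<And>z. I z \<Longrightarrow> \<not> stuck z \<Longrightarrow> m z < m (f z) \<and> m z < length xs"
  shows "I (foldr (\<lambda>_. f) xs z)" "stuck (foldr (\<lambda>_. f) xs z)"
proof -
  have I: "I (foldr (\<lambda>_. f) ys z)" for ys by (induction ys) (auto intro: assms)
  then show "I (foldr (\<lambda>_. f) xs z)" .
  have *: "stuck (foldr (\<lambda>_. f) ys z) \<or> length ys \<le> m (foldr (\<lambda>_. f) ys z)" for ys
  proof (induction ys)
    case (Cons y ys)
    then show ?case
      using stuck[OF I[of ys]] progress[OF I[of ys]] by (cases "stuck (foldr (\<lambda>_. f) ys z)") auto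
  qed simp
  then show "stuck (foldr (\<lambda>_. f) xs z)"
    using progress[OF I[of xs]] *[of xs] by fastforce
qed

text \<open>The last clause says that switching has affected only edges of \<open>M\<close> at
  reached left vertices. It is what makes a partner with respect to a switched matching reveal
  whether the partner in \<open>M\<close> is reached.\<close>

definition front_inv :: "('a \<times> 'b) list \<Rightarrow> ('a \<times> 'b) list \<Rightarrow> ('a, 'b) front \<Rightarrow> bool" where
  "front_inv E M Z \<longleftrightarrow>
     (\<forall>e\<in>set E. fst e \<notin> fst ` set M \<longrightarrow> fst e \<in> fst ` set Z) \<and>
     (\<forall>z\<in>set Z. fst z \<in> fst ` set E \<and> fst z \<notin> fst ` set (snd z) \<and>
        matching (set E) (snd z) \<and> length (snd z) = length M \<and> snd ` set (snd z) = snd ` set M \<and>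
        (\<forall>e\<in>set M. fst e \<notin> fst ` set Z \<longrightarrow> e \<in> set (snd z)))"

lemma partner_eq:
  assumes "matching E N" "f \<in> set N" "snd f = snd e"
  shows "partner e N = fst f"
proof -
  have "filter (\<lambda>f. snd f = snd e) N \<noteq> []" using assms by (auto simp: filter_empty_conv)
  then have "hd (filter (\<lambda>f. snd f = snd e) N) \<in> set (filter (\<lambda>f. snd f = snd e) N)"
    by (rule hd_in_set)
  then have "hd (filter (\<lambda>f. snd f = snd e) N) = f"
    using assms by (auto intro: matching_snd_inj)
  then show ?thesis by (simp add: partner_def)
qed

lemma partner_in:
  assumes "snd e \<in> snd ` set N"
  shows "\<exists>f\<in>set N. snd f = snd e \<and> partner e N = fst f"
proof -
  have "filter (\<lambda>f. snd f = snd e) N \<noteq> []" using assms by (force simp: filter_empty_conv)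
  then have "hd (filter (\<lambda>f. snd f = snd e) N) \<in> set (filter (\<lambda>f. snd f = snd e) N)"
    by (rule hd_in_set)
  then show ?thesis by (auto simp: partner_def)
qed

lemma matching_replace:
  assumes "matching E N" "e \<in> E" "fst e \<notin> fst ` set N"
  shows "matching E (replace_edge e N)"
  using assms unfolding matching_def replace_edge_def by (auto intro: distinct_map_filter)

lemma front_inv_0: "matching (set E) M \<Longrightarrow> front_inv E M (front0 E M)"
  by (auto simp: front_inv_def front0_def image_image intro!: rev_image_eqI)

text \<open>Exchanging the matching edge \<open>f\<close> for \<open>e\<close> at the same right
  vertex keeps the size and the covered right vertices, and frees the left end of \<open>f\<close>
  instead of that of \<open>e\<close>.\<close>

lemma front_inv_grow:
  assumes "front_inv E M Z"
  shows "front_inv E M (grow E Z)"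
proof (cases "growing E Z = []")
  case False
  obtain z e where c: "hd (growing E Z) = (z, e)" by (rule prod.exhaust)
  then have "(z, e) \<in> set (growing E Z)" using False hd_in_set by metis
  then have ze: "z \<in> set Z" "e \<in> set E" "fst z = fst e" "snd e \<in> snd ` set (snd z)"
    "partner e (snd z) \<notin> fst ` set Z"
    by (auto simp: growing_def)
  let ?N = "snd z" and ?N' = "replace_edge e (snd z)"
  have N: "matching (set E) ?N" "fst e \<notin> fst ` set ?N" "length ?N = length M" "snd ` set ?N = snd ` set M"
    "\<And>e. e \<in> set M \<Longrightarrow> fst e \<notin> fst ` set Z \<Longrightarrow> e \<in> set ?N"
  proof -
    have "fst z \<notin> fst ` set (snd z) \<and> matching (set E) (snd z) \<and> length (snd z) = length M \<and>
        snd ` set (snd z) = snd ` set M \<and> (\<forall>e\<in>set M. fst e \<notin> fst ` set Z \<longrightarrow> e \<in> set (snd z))"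
      using assms ze(1) unfolding front_inv_def by blast
    then show "matching (set E) ?N" "fst e \<notin> fst ` set ?N" "length ?N = length M" "snd ` set ?N = snd ` set M"
      "\<And>e. e \<in> set M \<Longrightarrow> fst e \<notin> fst ` set Z \<Longrightarrow> e \<in> set ?N"
      unfolding ze(3)[symmetric] by blast+
  qed
  obtain f where f: "f \<in> set ?N" "snd f = snd e" "partner e ?N = fst f"
    using partner_in[OF ze(4)] by blast
  have N': "matching (set E) ?N'" by (rule matching_replace) (use N ze in auto)
  have rest: "set (filter (\<lambda>f. snd f \<noteq> snd e) ?N) = set ?N - {f}"
  proof -
    have "snd g = snd e \<longleftrightarrow> g = f" if "g \<in> set ?N" for g
      using matching_snd_inj[OF N(1) that f(1)] f(2) by auto
    then show ?thesis by auto
  qed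
  have set': "set ?N' = insert e (set ?N - {f})"
    using rest by (simp add: replace_edge_def)
  have "card (set ?N') = card (set ?N)"
  proof -
    have "card (insert e (set ?N - {f})) = Suc (card (set ?N - {f}))"
      by (rule card_insert_disjoint) (use N(2) in auto)
    also have "\<dots> = card (set ?N)" by (rule card_Suc_Diff1) (use f(1) in auto)
    finally show ?thesis unfolding set' .
  qed
  then have len: "length ?N' = length M"
    using N' N by (simp add: matching_length)
  have snds: "snd ` set ?N' = snd ` set M"
  proof -
    have "set ?N = insert f (set ?N - {f})" using f(1) by auto
    then have "snd ` set ?N = insert (snd f) (snd ` (set ?N - {f}))" by (metis image_insert)
    then show ?thesis unfolding set' N(4)[symmetric] using f(2) by simp
  qed
  have fsts: "fst f \<notin> fst ` set ?N'"
  proof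
    assume "fst f \<in> fst ` set ?N'"
    then obtain g where g: "g \<in> insert e (set ?N - {f})" "fst g = fst f"
      unfolding set' by (metis imageE)
    moreover have "fst e \<noteq> fst f" using N(2) f(1) by (metis imageI)
    ultimately show False
      using matching_fst_inj[where e = g and f = f, OF N(1) _ f(1)] by auto
  qed
  have fE: "fst f \<in> fst ` set E" using f(1) N(1) by (auto simp: matching_def)
  have grow: "grow E Z = (fst f, ?N') # Z" using False c f(3) by (simp add: grow_def)
  have agree: "e' \<in> set ?N'" if "e' \<in> set M" "fst e' \<notin> fst ` set (grow E Z)" for e'
    using that N(5)[of e'] unfolding set' grow by auto
  show ?thesis
    unfolding front_inv_def
  proof (rule conjI; rule ballI)
    show "fst e \<notin> fst ` set M \<longrightarrow> fst e \<in> fst ` set (grow E Z)" if "e \<in> set E" for e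
      using assms that by (auto simp: front_inv_def grow)
    fix y assume "y \<in> set (grow E Z)"
    then consider "y = (fst f, ?N')" | "y \<in> set Z" by (auto simp: grow)
    then show "fst y \<in> fst ` set E \<and> fst y \<notin> fst ` set (snd y) \<and>
        matching (set E) (snd y) \<and> length (snd y) = length M \<and> snd ` set (snd y) = snd ` set M \<and>
        (\<forall>e\<in>set M. fst e \<notin> fst ` set (grow E Z) \<longrightarrow> e \<in> set (snd y))"
    proof cases
      case 1
      then show ?thesis using fE fsts N' len snds agree by simp
    next
      case 2
      then show ?thesis using assms by (auto simp: front_inv_def grow)
    qed
  qed
qed (use assms in \<open>simp add: grow_def\<close>)

lemma front_inv_front:
  assumes "matching (set E) M"
  shows "front_inv E M (front E M)" "growing E (front E M) = []"
proof -
  define m where "m Z = card (fst ` set Z)" for Z :: "('a, 'b) front"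
  have progress: "m Z < m (grow E Z) \<and> m Z < length E" if inv: "front_inv E M Z" and "growing E Z \<noteq> []" for Z
  proof -
    obtain z e where c: "hd (growing E Z) = (z, e)" by (rule prod.exhaust)
    then have "(z, e) \<in> set (growing E Z)" using that hd_in_set by metis
    then have ze: "partner e (snd z) \<notin> fst ` set Z" by (auto simp: growing_def)
    have "fst ` set (grow E Z) = insert (partner e (snd z)) (fst ` set Z)"
      using that c by (simp add: grow_def)
    with ze have lt: "m Z < m (grow E Z)" by (simp add: m_def)
    have "fst ` set (grow E Z) \<subseteq> fst ` set E"
      using front_inv_grow[OF inv] by (auto simp: front_inv_def)
    then have "m (grow E Z) \<le> card (fst ` set E)" unfolding m_def by (intro card_mono) auto
    also have "\<dots> \<le> length E" by (meson card_image_le card_length finite_set order_trans)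
    finally show ?thesis using lt by simp
  qed
  show "front_inv E M (front E M)" "growing E (front E M) = []"
    unfolding front_def
    using foldr_until_stuck[of "front_inv E M" "front0 E M" "grow E" "\<lambda>Z. growing E Z = []" m E,
        OF front_inv_0[OF assms] front_inv_grow _ progress]
    by (auto simp: grow_def)
qed

lemma matching_augment:
  assumes "matching (set E) M"
  shows "matching (set E) (augment E M)" "augmenting E M \<noteq> [] \<Longrightarrow> length M < length (augment E M)"
proof -
  have *: "matching (set E) (augment E M) \<and> length M < length (augment E M)" if "augmenting E M \<noteq> []"
  proof -
    obtain z e where c: "hd (augmenting E M) = (z, e)" by (rule prod.exhaust)
    then have "(z, e) \<in> set (augmenting E M)" using that hd_in_set by metis
    then have ze: "z \<in> set (front E M)" "e \<in> set E" "fst z = fst e" "snd e \<notin> snd ` set (snd z)"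
      by (auto simp: augmenting_def)
    then have N: "matching (set E) (snd z)" "fst e \<notin> fst ` set (snd z)" "length (snd z) = length M"
      using front_inv_front(1)[OF assms] unfolding front_inv_def ze(3)[symmetric] by blast+
    have "filter (\<lambda>f. snd f \<noteq> snd e) (snd z) = snd z" by (rule filter_True) (metis ze(4) imageI)
    then have "length (replace_edge e (snd z)) = length M + 1"
      using N(3) by (simp add: replace_edge_def)
    then show ?thesis using matching_replace[OF N(1) ze(2) N(2)] that c by (simp add: augment_def)
  qed
  then show "matching (set E) (augment E M)" using assms by (cases "augmenting E M = []") (auto simp: augment_def)
  show "augmenting E M \<noteq> [] \<Longrightarrow> length M < length (augment E M)" using * by blast
qed

text \<open>
  If no alternating path ends in a free right vertex, then the unreached left vertices together
  with the neighbours of the reached ones form a vertex cover in which every vertex belongs to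
  its own edge of \<open>M\<close> (Koenig).
\<close>

lemma augmenting_Nil_imp_maximum:
  assumes M: "matching (set E) M" and stuck: "augmenting E M = []" and M': "matching (set E) M'"
  shows "length M' \<le> length M"
proof -
  let ?Z = "front E M"
  define V where "V = fst ` set ?Z"
  note inv = front_inv_front[OF M]
  \<comment> \<open>The relation assigns to \<open>e\<close> the edge of \<open>M\<close> at its
    cover vertex: the right end if the left end is reached, otherwise the left end.\<close>
  define P where "P e f \<longleftrightarrow> (if fst e \<in> V then snd f = snd e \<and> fst f \<in> V else fst f = fst e \<and> fst f \<notin> V)"
    for e f :: "'a \<times> 'b"
  have ex: "\<exists>f\<in>set M. P e f"
    if e: "e \<in> set M'" for e
  proof (cases "fst e \<in> V")
    case True
    have eE: "e \<in> set E" using e M' by (auto simp: matching_def)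
    obtain z where z: "z \<in> set ?Z" "fst z = fst e" using True by (auto simp: V_def)
    then have N: "matching (set E) (snd z)" "snd ` set (snd z) = snd ` set M"
      "\<And>f. f \<in> set M \<Longrightarrow> fst f \<notin> V \<Longrightarrow> f \<in> set (snd z)"
      using inv(1) by (auto simp: front_inv_def V_def)
    have "(z, e) \<notin> set (augmenting E M)" "(z, e) \<notin> set (growing E ?Z)" using stuck inv(2) by auto
    then have q: "snd e \<in> snd ` set (snd z)" "partner e (snd z) \<in> V"
      using z eE by (auto simp: augmenting_def growing_def V_def)
    then obtain f where f: "f \<in> set M" "snd f = snd e" using N(2) by (metis imageE)
    have "fst f \<in> V"
    proof (rule ccontr)
      assume "fst f \<notin> V"
      then show False using partner_eq[OF N(1) N(3)[OF f(1)] f(2)] q(2) by simp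
    qed
    then show ?thesis using True f by (auto simp: P_def)
  next
    case False
    then have "fst e \<in> fst ` set M"
      using inv(1) e M' by (auto simp: front_inv_def matching_def V_def)
    then obtain f where "f \<in> set M" "fst f = fst e" by (metis imageE)
    then show ?thesis using False by (auto simp: P_def)
  qed
  define g where "g e = (SOME f. f \<in> set M \<and> P e f)" for e
  have g: "g e \<in> set M \<and> P e (g e)" if "e \<in> set M'" for e
    unfolding g_def by (rule someI_ex) (use ex[OF that] in blast)
  have "inj_on g (set M')"
  proof (rule inj_onI)
    fix e f assume ef: "e \<in> set M'" "f \<in> set M'" "g e = g f"
    then have Pe: "P e (g e)" and Pf: "P f (g e)" using g by metis+
    show "e = f"
    \<comment> \<open>Whether its left end is reached tells which end of the edge \<open>g e\<close>
      is the cover vertex, and this vertex is then common to \<open>e\<close> and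
      \<open>f\<close>.\<close>
    proof (cases "fst (g e) \<in> V")
      case True
      then have "snd e = snd f" using Pe Pf unfolding P_def by (simp split: if_splits)
      then show ?thesis using matching_snd_inj[OF M' ef(1,2)] by blast
    next
      case False
      then have "fst e = fst f" using Pe Pf unfolding P_def by (simp split: if_splits)
      then show ?thesis using matching_fst_inj[OF M' ef(1,2)] by blast
    qed
  qed
  then have "card (set M') \<le> card (set M)"
    using g by (intro card_inj_on_le[of g]) auto
  then show ?thesis using M M' by (simp add: matching_length)
qed

lemma max_matching:
  shows "matching (set E) (max_matching E)"
    and "matching (set E) M \<Longrightarrow> length M \<le> length (max_matching E)"
proof -
  have len: "length M \<le> length E" if "matching (set E) M" for M
  proof -
    have "length M = card (set M)" by (rule matching_length[OF that])
    also have "\<dots> \<le> card (set E)" using that by (intro card_mono) (auto simp: matching_def)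
    finally show ?thesis using card_length le_trans by blast
  qed
  have progress: "length M < length (augment E M) \<and> length M < length E"
    if "matching (set E) M" "augmenting E M \<noteq> []" for M
    using matching_augment[OF that(1)] that(2) len[of "augment E M"] by auto
  have "matching (set E) []" by (simp add: matching_def)
  note * = foldr_until_stuck[of "matching (set E)" "[]" "augment E" "\<lambda>M. augmenting E M = []" length E,
      OF this matching_augment(1) _ progress]
  show mm: "matching (set E) (max_matching E)"
    unfolding max_matching_def by (rule *(1)) (auto simp: augment_def)
  have "augmenting E (max_matching E) = []"
    unfolding max_matching_def by (rule *(2)) (auto simp: augment_def)
  then show "matching (set E) M \<Longrightarrow> length M \<le> length (max_matching E)"
    using augmenting_Nil_imp_maximum[OF mm] by blast
qed

subsection \<open>Covering two families of labels\<close>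

text \<open>One vertex for each matching edge covers two labels at once; every other label gets a
  vertex of its own.\<close>

lemma cover_of_matching:
  fixes f :: "'v \<Rightarrow> 'a" and g :: "'v \<Rightarrow> 'b"
  assumes "finite X" "finite Y" "X \<subseteq> f ` C" "Y \<subseteq> g ` C"
    and M: "matching {(x, y). x \<in> X \<and> y \<in> Y \<and> (\<exists>s\<in>C. f s = x \<and> g s = y)} M"
  shows "\<exists>S\<subseteq>C. finite S \<and> X \<subseteq> f ` S \<and> Y \<subseteq> g ` S \<and> card S + length M \<le> card X + card Y"
proof -
  obtain h where h: "\<And>e. e \<in> set M \<Longrightarrow> h e \<in> C \<and> f (h e) = fst e \<and> g (h e) = snd e"
  proof -
    have "\<forall>e\<in>set M. \<exists>s\<in>C. f s = fst e \<and> g s = snd e" using M by (fastforce simp: matching_def)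
    then show thesis using that by metis
  qed
  define a where "a = inv_into C f"
  have a: "a x \<in> C \<and> f (a x) = x" if "x \<in> X" for x
    using that assms(3) by (auto simp: a_def intro: inv_into_into f_inv_into_f)
  define b where "b = inv_into C g"
  have b: "b y \<in> C \<and> g (b y) = y" if "y \<in> Y" for y
    using that assms(4) by (auto simp: b_def intro: inv_into_into f_inv_into_f)
  let ?S1 = "h ` set M" and ?S2 = "a ` (X - fst ` set M)" and ?S3 = "b ` (Y - snd ` set M)"
  have sub: "fst ` set M \<subseteq> X" "snd ` set M \<subseteq> Y" using M by (auto simp: matching_def)
  have cards: "card (fst ` set M) = length M" "card (snd ` set M) = length M"
    using M unfolding matching_def by (metis distinct_card length_map set_map)+
  have "card ?S1 \<le> length M" by (meson card_image_le card_length finite_set order_trans)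
  moreover have "card ?S2 \<le> card X - length M"
    using assms(1) sub cards by (metis card_Diff_subset card_image_le finite_Diff finite_subset)
  moreover have "card ?S3 \<le> card Y - length M"
    using assms(2) sub cards by (metis card_Diff_subset card_image_le finite_Diff finite_subset)
  moreover have "length M \<le> card X" "length M \<le> card Y"
    using sub cards assms(1,2) by (metis card_mono)+
  moreover have "card (?S1 \<union> ?S2 \<union> ?S3) \<le> card ?S1 + card ?S2 + card ?S3"
    using card_Un_le[of "?S1 \<union> ?S2" ?S3] card_Un_le[of ?S1 ?S2] by linarith
  ultimately have "card (?S1 \<union> ?S2 \<union> ?S3) + length M \<le> card X + card Y" by linarith
  moreover have "?S1 \<union> ?S2 \<union> ?S3 \<subseteq> C" using h a b by auto
  moreover have "X \<subseteq> f ` (?S1 \<union> ?S2 \<union> ?S3)"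
  proof
    fix x assume x: "x \<in> X"
    show "x \<in> f ` (?S1 \<union> ?S2 \<union> ?S3)"
    proof (cases "x \<in> fst ` set M")
      case True
      then obtain e where "e \<in> set M" "fst e = x" by auto
      then show ?thesis using h by (intro image_eqI[of _ _ "h e"]) auto
    next
      case False
      then show ?thesis using a x by (intro image_eqI[of _ _ "a x"]) auto
    qed
  qed
  moreover have "Y \<subseteq> g ` (?S1 \<union> ?S2 \<union> ?S3)"
  proof
    fix y assume y: "y \<in> Y"
    show "y \<in> g ` (?S1 \<union> ?S2 \<union> ?S3)"
    proof (cases "y \<in> snd ` set M")
      case True
      then obtain e where "e \<in> set M" "snd e = y" by auto
      then show ?thesis using h by (intro image_eqI[of _ _ "h e"]) auto
    next
      case False
      then show ?thesis using b y by (intro image_eqI[of _ _ "b y"]) auto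
    qed
  qed
  ultimately show ?thesis
    using assms(1,2) by (intro exI[of _ "?S1 \<union> ?S2 \<union> ?S3"]) auto
qed

text \<open>A vertex of \<open>S\<close> is selected for each label. Vertices selected in both
  families yield the matching edges, and inclusion-exclusion gives the count.\<close>

lemma matching_of_cover:
  fixes f :: "'v \<Rightarrow> 'a" and g :: "'v \<Rightarrow> 'b"
  assumes S: "finite S" "S \<subseteq> C" "X \<subseteq> f ` S" "Y \<subseteq> g ` S"
  shows "\<exists>M. matching {(x, y). x \<in> X \<and> y \<in> Y \<and> (\<exists>s\<in>C. f s = x \<and> g s = y)} M \<and>
    card X + card Y \<le> card S + length M"
proof -
  define a where "a = inv_into S f"
  have a: "a x \<in> S \<and> f (a x) = x" if "x \<in> X" for x
    using that assms(3) by (auto simp: a_def intro: inv_into_into f_inv_into_f)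
  define b where "b = inv_into S g"
  have b: "b y \<in> S \<and> g (b y) = y" if "y \<in> Y" for y
    using that assms(4) by (auto simp: b_def intro: inv_into_into f_inv_into_f)
  have inj: "inj_on a X" "inj_on b Y" by (metis a inj_onI, metis b inj_onI)
  define T where "T = a ` X \<inter> b ` Y"
  have finT: "finite T" by (rule finite_subset[OF _ S(1)]) (use a in \<open>auto simp: T_def\<close>)
  obtain ts where ts: "set ts = T" "distinct ts" using finite_distinct_list[OF finT] by blast
  have T: "f t \<in> X" "a (f t) = t" "g t \<in> Y" "b (g t) = t" "t \<in> S" if tT: "t \<in> T" for t
  proof -
    obtain x y where "x \<in> X" "t = a x" "y \<in> Y" "t = b y" using tT unfolding T_def by blast
    then show "f t \<in> X" "a (f t) = t" "g t \<in> Y" "b (g t) = t" "t \<in> S" using a b by metis+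
  qed
  define M where "M = map (\<lambda>t. (f t, g t)) ts"
  have "matching {(x, y). x \<in> X \<and> y \<in> Y \<and> (\<exists>s\<in>C. f s = x \<and> g s = y)} M"
  proof -
    have "inj_on f T" by (rule inj_on_inverseI[of T a]) (rule T)
    moreover have "inj_on g T" by (rule inj_on_inverseI[of T b]) (rule T)
    moreover have "\<exists>s\<in>C. f s = f t \<and> g s = g t" if "t \<in> T" for t
      using T(5)[OF that] S(2) by blast
    ultimately show ?thesis
      unfolding matching_def M_def using ts T(1,3) by (auto simp: distinct_map comp_def)
  qed
  moreover have "card X + card Y \<le> card S + length M"
  proof -
    have fins: "finite (a ` X)" "finite (b ` Y)"
      using a b S(1) by (auto intro: finite_subset[of _ S])
    have "card X + card Y = card (a ` X) + card (b ` Y)" using inj by (simp add: card_image)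
    also have "\<dots> = card (a ` X \<union> b ` Y) + card T" unfolding T_def using fins by (rule card_Un_Int)
    also have "\<dots> \<le> card S + card T" using a b S(1) by (intro add_right_mono card_mono) auto
    also have "card T = length M" using ts by (simp add: M_def flip: distinct_card)
    finally show ?thesis .
  qed
  ultimately show ?thesis by blast
qed

subsection \<open>Running time\<close>

lemma ptime_replace_edge [ptime_intros]:
  assumes "ptime e" "ptime N"
  shows "ptime (\<lambda>x. replace_edge (e x) (N x))"
  unfolding replace_edge_def by (intro ptime_intros assms ptime_comp[OF assms(1)])

lemma ptime_partner [ptime_intros]:
  assumes "ptime e" "ptime N"
  shows "ptime (\<lambda>x. partner (e x) (N x))"
  unfolding partner_def by (intro ptime_intros assms ptime_comp[OF assms(1)])

lemma ptime_growing [ptime_intros]: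
  assumes "ptime E" "ptime Z"
  shows "ptime (\<lambda>x. growing (E x) (Z x))"
  unfolding growing_def
  by (intro ptime_intros assms ptime_comp[OF assms(1)] ptime_comp[OF assms(2)])

lemma ptime_grow [ptime_intros]:
  assumes "ptime E" "ptime Z"
  shows "ptime (\<lambda>x. grow (E x) (Z x))"
  unfolding grow_def by (intro ptime_intros assms)

text \<open>Polynomial time is claimed for all inputs, whereas \<open>front_inv\<close> is
  established only for matchings. This coarse invariant bounds sizes in every case: a round adds one
  entry and lengthens a stored list by at most one.\<close>

definition entries_in :: "('a \<times> 'b) set \<Rightarrow> nat \<Rightarrow> ('a, 'b) front \<Rightarrow> bool" where
  "entries_in A n Z \<longleftrightarrow> length Z \<le> n \<and> (\<forall>z\<in>set Z. fst z \<in> fst ` A \<and> set (snd z) \<subseteq> A \<and> length (snd z) \<le> n)"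

lemma entries_in_grow:
  assumes "entries_in A n Z" "set E \<subseteq> A"
  shows "entries_in A (Suc n) (grow E Z)"
proof (cases "growing E Z = []")
  case False
  obtain z e where c: "hd (growing E Z) = (z, e)" by (rule prod.exhaust)
  then have "(z, e) \<in> set (growing E Z)" using False hd_in_set by metis
  then have ze: "z \<in> set Z" "e \<in> set E" "snd e \<in> snd ` set (snd z)"
    by (auto simp: growing_def)
  then have "partner e (snd z) \<in> fst ` A"
    using partner_in[OF ze(3)] assms by (auto simp: entries_in_def)
  moreover have "set (replace_edge e (snd z)) \<subseteq> A" "length (replace_edge e (snd z)) \<le> Suc n"
    using ze assms by (auto simp: entries_in_def replace_edge_def intro: le_trans[OF length_filter_le])
  ultimately show ?thesis using False c assms(1) by (auto simp: grow_def entries_in_def)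
qed (use assms in \<open>auto simp: grow_def entries_in_def\<close>)

lemma entries_in_front:
  "entries_in (set E \<union> set M) (length ys + length E + length M) (foldr (\<lambda>_. grow E) ys (front0 E M))"
proof (induction ys)
  case Nil
  then show ?case by (auto simp: entries_in_def front0_def intro: trans_le_add1)
next
  case (Cons y ys)
  then show ?case using entries_in_grow[of _ _ _ E] by fastforce
qed

lemma esize_entries:
  fixes Z :: "('a::encodable, 'b::encodable) front"
  assumes "entries_in A n Z" "\<And>e. e \<in> A \<Longrightarrow> esize e \<le> b"
  shows "esize Z \<le> n * (b + n * (b + 1) + 2)"
proof -
  have "esize z \<le> b + n * (b + 1) + 1" if "z \<in> set Z" for z
  proof -
    have "fst z \<in> fst ` A" using assms(1) that by (simp add: entries_in_def)
    then obtain e where e: "fst z = fst e" "e \<in> A" by (rule imageE)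
    have "esize (fst z) \<le> b" using assms(2)[OF e(2)] e(1) by (simp add: esize_fst_snd)
    moreover have "esize (snd z) \<le> length (snd z) * (b + 1)"
      using assms that by (intro esize_list_le) (auto simp: entries_in_def)
    moreover have "length (snd z) * (b + 1) \<le> n * (b + 1)"
      using assms(1) that by (intro mult_right_mono) (auto simp: entries_in_def)
    ultimately show ?thesis by (simp add: esize_fst_snd[of z])
  qed
  then have "esize Z \<le> length Z * (b + n * (b + 1) + 1 + 1)" by (rule esize_list_le)
  also have "\<dots> \<le> n * (b + n * (b + 1) + 1 + 1)"
    using assms(1) by (intro mult_right_mono) (auto simp: entries_in_def)
  finally show ?thesis by simp
qed

lemma ptime_front [ptime_intros]:
  assumes "ptime E" "ptime M"
  shows "ptime (\<lambda>x. front (E x) (M x))"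
proof -
  let ?n = "\<lambda>x. 2 * esize (E x) + esize (M x)" and ?b = "\<lambda>x. esize (E x) + esize (M x)"
  let ?B = "\<lambda>x. real (?n x * (?b x + ?n x * (?b x + 1) + 2))"
  show ?thesis
    unfolding front_def
  proof (intro ptime_foldr[where B = ?B])
    show "ptime (\<lambda>p. grow (E (fst (fst p))) (snd p))"
      by (intro ptime_intros ptime_comp[OF assms(1)])
    show "ptime (\<lambda>e. front0 (E e) (M e))"
      unfolding front0_def by (intro ptime_intros assms ptime_comp[OF assms(2)])
    show "pbd ?B"
      unfolding of_nat_mult of_nat_add by (intro pbd_add pbd_mult pbd_const ptime_pbd assms)
    fix x ys zs
    assume eq: "E x = zs @ ys"
    have "entries_in (set (E x) \<union> set (M x)) (?n x) (foldr (\<lambda>_. grow (E x)) ys (front0 (E x) (M x)))"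
    proof -
      have "length ys + length (E x) + length (M x) \<le> ?n x"
        using length_le_esize[of "E x"] length_le_esize[of "M x"] arg_cong[OF eq, of length] by simp
      then show ?thesis
        using entries_in_front[of "E x" "M x" ys] by (fastforce simp: entries_in_def)
    qed
    then show "real (esize (foldr (\<lambda>_. grow (E x)) ys (front0 (E x) (M x)))) \<le> ?B x"
      by (intro of_nat_mono esize_entries) (auto dest!: esize_member)
  qed fact
qed

lemma ptime_augmenting [ptime_intros]:
  assumes "ptime E" "ptime M"
  shows "ptime (\<lambda>x. augmenting (E x) (M x))"
  unfolding augmenting_def by (intro ptime_intros assms)

lemma ptime_augment [ptime_intros]:
  assumes "ptime E" "ptime M"
  shows "ptime (\<lambda>x. augment (E x) (M x))"
  unfolding augment_def by (intro ptime_intros assms)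

lemma augment_bounds:
  assumes "set M \<subseteq> set E"
  shows "set (augment E M) \<subseteq> set E" "length (augment E M) \<le> length M + 2 * length E + 1"
proof -
  have *: "set (augment E M) \<subseteq> set E \<and> length (augment E M) \<le> length M + 2 * length E + 1"
  proof (cases "augmenting E M = []")
    case False
    obtain z e where c: "hd (augmenting E M) = (z, e)" by (rule prod.exhaust)
    then have "(z, e) \<in> set (augmenting E M)" using False hd_in_set by metis
    then have ze: "z \<in> set (front E M)" "e \<in> set E" by (auto simp: augmenting_def)
    have "set (snd z) \<subseteq> set E" "length (snd z) \<le> length E + length E + length M"
      using entries_in_front[of E M E] ze(1) assms unfolding front_def[symmetric] entries_in_def by auto
    then show ?thesis using False c ze(2)
      by (auto simp: augment_def replace_edge_def intro: le_trans[OF length_filter_le])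
  qed (use assms in \<open>auto simp: augment_def\<close>)
  then show "set (augment E M) \<subseteq> set E" "length (augment E M) \<le> length M + 2 * length E + 1" by auto
qed

lemma ptime_max_matching [ptime_intros]:
  assumes "ptime E"
  shows "ptime (\<lambda>x. max_matching (E x))"
proof -
  let ?B = "\<lambda>x. real (esize (E x) * (2 * esize (E x) + 1) * (esize (E x) + 1))"
  show ?thesis
    unfolding max_matching_def
  proof (intro ptime_foldr[where B = ?B])
    show "ptime (\<lambda>p. augment (E (fst (fst p))) (snd p))"
      by (intro ptime_intros ptime_comp[OF assms(1)])
    show "ptime (\<lambda>e. [])" by (rule ptime_const)
    show "pbd ?B"
      unfolding of_nat_mult of_nat_add by (intro pbd_add pbd_mult pbd_const ptime_pbd assms)
    fix x ys zs
    assume eq: "E x = zs @ ys"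
    let ?M = "\<lambda>ys. foldr (\<lambda>_. augment (E x)) ys []"
    have M: "set (?M ys) \<subseteq> set (E x) \<and> length (?M ys) \<le> length ys * (2 * length (E x) + 1)" for ys :: "('b \<times> 'c) list"
    proof (induction ys)
      case (Cons y ys)
      then show ?case using augment_bounds[of "?M ys" "E x"] by auto
    qed simp
    have "esize (?M ys) \<le> length (?M ys) * (esize (E x) + 1)"
      using M[of ys] by (intro esize_list_le) (meson esize_member less_imp_le subsetD)
    also have "\<dots> \<le> esize (E x) * (2 * esize (E x) + 1) * (esize (E x) + 1)"
    proof (intro mult_right_mono)
      have "length ys \<le> esize (E x)" "length (E x) \<le> esize (E x)"
        using length_le_esize[of "E x"] arg_cong[OF eq, of length] by simp_all
      then show "length (?M ys) \<le> esize (E x) * (2 * esize (E x) + 1)"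
        using M[of ys] by (meson add_le_mono le_trans mult_le_mono order_refl)
    qed simp
    finally show "real (esize (?M ys)) \<le> ?B x" by (rule of_nat_mono)
  qed fact
qed

section \<open>The algorithm\<close>

type_synonym edges = "(nat \<times> nat) list"

definition mg :: "edges \<Rightarrow> nat uprod multiset" where
  "mg es = mset (map (\<lambda>(u, v). Upair u v) es)"

text \<open>The degree in unary: a loop occurs in both sublists and so counts twice.\<close>

definition incidences :: "edges \<Rightarrow> nat list \<Rightarrow> nat \<Rightarrow> edges" where
  "incidences es K v =
     filter (\<lambda>e. fst e = v \<and> fst e \<in> set K \<and> snd e \<in> set K) es @
     filter (\<lambda>e. snd e = v \<and> fst e \<in> set K \<and> snd e \<in> set K) es"

lemma length_incidences [simp]: "length (incidences es K v) = deg (mg es) (set K) v"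
  by (induction es) (auto simp: incidences_def mg_def)

definition prune :: "edges \<Rightarrow> nat list \<Rightarrow> nat list" where
  "prune es K = filter (\<lambda>v. length [v, v] \<le> length (incidences es K v)) K"

definition core_list :: "edges \<Rightarrow> nat list \<Rightarrow> nat list" where
  "core_list es A = foldr (\<lambda>_. prune es) A A"

text \<open>Pruning never removes a vertex of the core, and a list at rest under pruning is dense.
  The order of \<open>A\<close> is preserved, so the result is a definite list and not just a list
  with the right elements.\<close>

lemma core_list_eq: "core_list es A = filter (\<lambda>v. v \<in> core (mg es) (set A)) A"
proof -
  let ?C = "core (mg es) (set A)"
  define I where "I K \<longleftrightarrow> (\<exists>p. K = filter p A) \<and> ?C \<subseteq> set K" for K
  have "I A"
    unfolding I_def using core_subset[of "mg es" "set A"] by (auto intro!: exI[of _ "\<lambda>_. True"])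
  moreover have "I (prune es K)" if IK: "I K" for K
  proof -
    obtain p where p: "K = filter p A" using IK by (auto simp: I_def)
    have "2 \<le> deg (mg es) (set K) v" if "v \<in> ?C" for v
      using IK that dense_core[of "mg es" "set A"] deg_mono[of ?C "set K" "mg es" v]
      by (force simp: I_def dense_def)
    then have "?C \<subseteq> set (prune es K)"
      using IK by (auto simp: I_def prune_def numeral_2_eq_2)
    moreover have "\<exists>q. prune es K = filter q A" unfolding p prune_def filter_filter by blast
    ultimately show ?thesis by (simp add: I_def)
  qed
  moreover have "length A - length K < length A - length (prune es K) \<and> length A - length K < length A"
    if "I K" "prune es K \<noteq> K" for K
  proof -
    have "length (prune es K) < length K"
      using that(2) unfolding prune_def by (metis filter_id_conv length_filter_less)
    moreover have "length K \<le> length A" using that(1) by (auto simp: I_def)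
    ultimately show ?thesis by linarith
  qed
  ultimately have *: "I (core_list es A)" "prune es (core_list es A) = core_list es A"
    unfolding core_list_def
    using foldr_until_stuck[of I A "prune es" "\<lambda>K. prune es K = K" "\<lambda>K. length A - length K" A]
    by blast+
  then obtain p where p: "core_list es A = filter p A" and sub: "?C \<subseteq> set (core_list es A)"
    by (auto simp: I_def)
  have "dense (mg es) (set (core_list es A))"
    unfolding dense_def
  proof
    fix v assume "v \<in> set (core_list es A)"
    then have "v \<in> set (prune es (core_list es A))" using *(2) by simp
    then show "2 \<le> deg (mg es) (set (core_list es A)) v" by (simp add: prune_def)
  qed
  then have "set (core_list es A) \<subseteq> ?C" by (intro core_greatest) (auto simp: p)
  with sub have "set (filter p A) = ?C" unfolding p by blast
  then have "filter p A = filter (\<lambda>v. v \<in> ?C) A" by (intro filter_cong) auto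
  then show ?thesis using p by simp
qed

lemma set_core_list [simp]: "set (core_list es A) = core (mg es) (set A)"
  using core_subset[of "mg es" "set A"] by (auto simp: core_list_eq)

lemma core_list_filter_Nil_iff:
  "core_list es (filter (\<lambda>v. v \<notin> set R) A) = [] \<longleftrightarrow> core (mg es) (set A - set R) = {}"
proof -
  have "set (filter (\<lambda>v. v \<notin> set R) A) = set A - set R" by auto
  then show ?thesis unfolding set_empty[symmetric] set_core_list by (simp only:)
qed

definition label_list :: "edges \<Rightarrow> nat list \<Rightarrow> nat \<Rightarrow> nat list" where
  "label_list es A u = core_list es (filter (\<lambda>v. v \<noteq> u) A)"

abbreviation label :: "edges \<Rightarrow> nat list \<Rightarrow> nat \<Rightarrow> nat set" where
  "label es A u \<equiv> core (mg es) (set A - {u})"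

lemma set_label_list [simp]: "set (label_list es A u) = label es A u"
  unfolding label_list_def set_core_list by (rule arg_cong[where f = "core (mg es)"]) auto

text \<open>All label lists are sublists of \<open>A\<close> in its order, so equality of lists,
  which a program can test, is equality of labels.\<close>

lemma label_list_eq_iff: "label_list es A u = label_list es A v \<longleftrightarrow> label es A u = label es A v"
proof -
  have eq: "label_list es A u = filter (\<lambda>v. v \<in> label es A u) A" for u
  proof -
    have "set (filter (\<lambda>v. v \<noteq> u) A) = set A - {u}" by auto
    then have "label_list es A u = filter (\<lambda>v. v \<in> label es A u) (filter (\<lambda>v. v \<noteq> u) A)"
      by (simp only: label_list_def core_list_eq)
    also have "\<dots> = filter (\<lambda>v. v \<in> label es A u) A"
      unfolding filter_filter using core_subset[of "mg es" "set A - {u}"] by (intro filter_cong) auto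
    finally show ?thesis .
  qed
  then show ?thesis by (metis set_label_list)
qed

definition representatives :: "edges \<Rightarrow> nat list \<Rightarrow> nat list \<Rightarrow> nat list" where
  "representatives es A C =
     foldr (\<lambda>v R. if \<exists>u\<in>set R. label_list es A u = label_list es A v then R else v # R)
       (filter (\<lambda>v. v \<in> set (core_list es A)) C) []"

lemma representatives:
  shows "set (representatives es A C) \<subseteq> set C \<inter> core (mg es) (set A)"
    and "distinct (map (label_list es A) (representatives es A C))"
    and "label_list es A ` set (representatives es A C) = label_list es A ` (set C \<inter> core (mg es) (set A))"
proof -
  define f where "f = (\<lambda>v R. if \<exists>u\<in>set R. label_list es A u = label_list es A v then R else v # R)"
  have "set (foldr f xs []) \<subseteq> set xs \<and> distinct (map (label_list es A) (foldr f xs [])) \<and>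
    label_list es A ` set (foldr f xs []) = label_list es A ` set xs" for xs
  proof (induction xs)
    case (Cons v xs)
    let ?R = "foldr f xs []"
    show ?case
    proof (cases "\<exists>u\<in>set ?R. label_list es A u = label_list es A v")
      case True
      then have "label_list es A v \<in> label_list es A ` set xs" using Cons.IH by (metis imageI)
      then show ?thesis using True Cons.IH by (auto simp: f_def insert_absorb)
    next
      case False
      then have "foldr f (v # xs) [] = v # ?R" by (simp add: f_def)
      moreover have "label_list es A v \<notin> label_list es A ` set ?R" using False by auto
      ultimately show ?thesis using Cons.IH by auto
    qed
  qed simp
  from this[of "filter (\<lambda>v. v \<in> set (core_list es A)) C"]
  show "set (representatives es A C) \<subseteq> set C \<inter> core (mg es) (set A)"
    "distinct (map (label_list es A) (representatives es A C))"
    "label_list es A ` set (representatives es A C) = label_list es A ` (set C \<inter> core (mg es) (set A))"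
    by (auto simp: representatives_def f_def Int_def)
qed

lemma length_representatives:
  "length (representatives es A C) = card (label es A ` (set C \<inter> core (mg es) (set A)))"
proof -
  have "length (representatives es A C) = card (set (map (label_list es A) (representatives es A C)))"
    using representatives(2)[of es A C] by (metis distinct_card length_map)
  also have "\<dots> = card (label_list es A ` (set C \<inter> core (mg es) (set A)))"
    using representatives(3)[of es A C] by simp
  also have "\<dots> = card (set ` label_list es A ` (set C \<inter> core (mg es) (set A)))"
  proof (rule card_image[symmetric])
    show "inj_on set (label_list es A ` (set C \<inter> core (mg es) (set A)))"
    proof (rule inj_onI)
      fix x y assume "x \<in> label_list es A ` (set C \<inter> core (mg es) (set A))"
        "y \<in> label_list es A ` (set C \<inter> core (mg es) (set A))" and eq: "set x = set y"
      then obtain u v where uv: "x = label_list es A u" "y = label_list es A v" by blast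
      then show "x = y" using eq by (simp add: label_list_eq_iff)
    qed
  qed
  also have "set ` label_list es A ` (set C \<inter> core (mg es) (set A)) = label es A ` (set C \<inter> core (mg es) (set A))"
    by (simp add: image_image)
  finally show ?thesis .
qed

subsection \<open>Choosing the segments to be hit\<close>

text \<open>
  Numbers that are counted down are represented by lists of that length: \<open>p_k\<close> is the number of
  deletions left. \<open>p_A\<close> are the vertices that are not deleted, \<open>p_C\<close> those not yet decided.
\<close>

type_synonym params = "(edges \<times> edges) \<times> nat list \<times> nat list \<times> nat list"

abbreviation p_e1 :: "params \<Rightarrow> edges" where "p_e1 p \<equiv> fst (fst p)"
abbreviation p_e2 :: "params \<Rightarrow> edges" where "p_e2 p \<equiv> snd (fst p)"
abbreviation p_A :: "params \<Rightarrow> nat list" where "p_A p \<equiv> fst (snd p)"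
abbreviation p_C :: "params \<Rightarrow> nat list" where "p_C p \<equiv> fst (snd (snd p))"
abbreviation p_k :: "params \<Rightarrow> nat list" where "p_k p \<equiv> snd (snd (snd p))"

text \<open>The bipartite graph between labels of the two colors; an edge means that some undecided
  vertex hits both.\<close>

definition compat :: "params \<Rightarrow> nat list \<Rightarrow> nat list \<Rightarrow> (nat list \<times> nat list) list" where
  "compat p R1 R2 = filter (\<lambda>l. \<exists>s\<in>set (p_C p). label_list (p_e1 p) (p_A p) s = fst l \<and> label_list (p_e2 p) (p_A p) s = snd l)
     (List.product (map (label_list (p_e1 p) (p_A p)) R1) (map (label_list (p_e2 p) (p_A p)) R2))"

text \<open>The last conjunct compares the number of chosen labels minus the size of the matching
  with the deletions left, written additively and in unary; the entries 0 only adapt the element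
  type.\<close>

definition hits :: "params \<Rightarrow> nat list \<Rightarrow> nat list \<Rightarrow> bool" where
  "hits p R1 R2 \<longleftrightarrow>
     core_list (p_e1 p) (filter (\<lambda>v. v \<notin> set R1) (p_A p)) = [] \<and>
     core_list (p_e2 p) (filter (\<lambda>v. v \<notin> set R2) (p_A p)) = [] \<and>
     length (R1 @ R2) \<le> length (p_k p @ map (\<lambda>_. 0) (max_matching (compat p R1 R2)))"

text \<open>The tag of a representative is its color, \<open>True\<close> for the first one.\<close>

type_synonym choice = "params \<times> (bool \<times> nat) list \<times> (bool \<times> nat) list"

definition choice_ok :: "choice \<Rightarrow> bool" where
  "choice_ok c = hits (fst c) (map snd (filter (\<lambda>r. fst r) (snd (snd c))))
     (map snd (filter (\<lambda>r. \<not> fst r) (snd (snd c))))"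

definition choice_in :: "choice \<Rightarrow> choice" where
  "choice_in c = (fst c, tl (fst (snd c)), hd (fst (snd c)) # snd (snd c))"

definition choice_out :: "choice \<Rightarrow> choice" where
  "choice_out c = (fst c, tl (fst (snd c)), snd (snd c))"

function choose_segments :: "choice \<Rightarrow> bool" where
  "choose_segments c = (if fst (snd c) = [] then choice_ok c
     else choose_segments (choice_in c) \<or> choose_segments (choice_out c))"
  by pat_completeness auto
termination
  by (relation "measure (\<lambda>c. length (fst (snd c)))") (auto simp: choice_in_def choice_out_def)

declare choose_segments.simps [simp del]

lemma choose_segments_iff:
  "choose_segments (p, todo, R) \<longleftrightarrow> (\<exists>ys\<in>set (subseqs todo). choice_ok (p, [], rev ys @ R))"
proof (induction todo arbitrary: R)
  case Nil
  then show ?case by (simp add: choose_segments.simps)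
next
  case (Cons x todo)
  have "choose_segments (p, x # todo, R) \<longleftrightarrow> choose_segments (p, todo, x # R) \<or> choose_segments (p, todo, R)"
    by (subst choose_segments.simps) (simp add: choice_in_def choice_out_def)
  then show ?case unfolding Cons.IH subseqs.simps Let_def set_append set_map bex_Un by simp
qed

definition candidates :: "params \<Rightarrow> choice" where
  "candidates p = (p, map (\<lambda>v. (True, v)) (representatives (p_e1 p) (p_A p) (p_C p)) @
     map (\<lambda>v. (False, v)) (representatives (p_e2 p) (p_A p) (p_C p)), [])"

definition few_candidates :: "params \<Rightarrow> bool" where
  "few_candidates p \<longleftrightarrow>
     length (representatives (p_e1 p) (p_A p) (p_C p)) \<le> length (p_k p @ p_k p @ p_k p) \<and>
     length (representatives (p_e2 p) (p_A p) (p_C p)) \<le> length (p_k p @ p_k p @ p_k p)"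

definition solvable :: "params \<Rightarrow> bool" where
  "solvable p \<longleftrightarrow> (\<exists>S\<subseteq>set (p_C p). card S \<le> length (p_k p) \<and>
     core (mg (p_e1 p)) (set (p_A p) - S) = {} \<and> core (mg (p_e2 p)) (set (p_A p) - S) = {})"

section \<open>Correctness of the choice of segments\<close>

text \<open>Only labels matter: a dense set that survived \<open>S\<close> would contain some
  \<open>r\<close> in \<open>R\<close>, and then by \<open>label_swap\<close> the vertex of
  \<open>S\<close> with the same label.\<close>

lemma core_empty_transfer:
  assumes "core M (A - R) = {}"
    and "\<And>r. r \<in> R \<Longrightarrow> r \<in> core M A \<Longrightarrow> \<exists>s\<in>S. core M (A - {s}) = core M (A - {r})"
  shows "core M (A - S) = {}"
proof (rule ccontr)
  let ?W = "core M (A - S)"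
  assume ne: "?W \<noteq> {}"
  have W: "dense M ?W" "?W \<subseteq> A" "?W \<subseteq> core M A"
    using dense_core core_subset[of M "A - S"] core_mono[of "A - S" A M] by auto
  have "\<not> ?W \<subseteq> A - R"
    using core_greatest[of ?W "A - R" M] W(1) assms(1) ne by auto
  then obtain r where r: "r \<in> ?W" "r \<in> R" using W(2) by auto
  then obtain s where s: "s \<in> S" "core M (A - {s}) = core M (A - {r})" using assms(2) W(3) by blast
  have "s \<in> ?W" using label_swap[OF s(2)[symmetric] W(1,2) r(1)] .
  then show False using core_subset[of M "A - S"] s(1) by auto
qed

text \<open>A vertex has one label in each color, so vertices are saved exactly by letting some of
  them serve one label of each color; the best saving is a maximum matching.\<close>

lemma hits_iff_cover:
  assumes "distinct (map (label_list (p_e1 p) (p_A p)) R1)" "distinct (map (label_list (p_e2 p) (p_A p)) R2)"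
    and "set R1 \<subseteq> set (p_C p)" "set R2 \<subseteq> set (p_C p)"
  shows "length (R1 @ R2) \<le> length (p_k p @ map (\<lambda>_. 0) (max_matching (compat p R1 R2))) \<longleftrightarrow>
    (\<exists>S\<subseteq>set (p_C p). card S \<le> length (p_k p) \<and>
      label_list (p_e1 p) (p_A p) ` set R1 \<subseteq> label_list (p_e1 p) (p_A p) ` S \<and>
      label_list (p_e2 p) (p_A p) ` set R2 \<subseteq> label_list (p_e2 p) (p_A p) ` S)" (is "?L \<longleftrightarrow> ?R")
proof -
  let ?f = "label_list (p_e1 p) (p_A p)" and ?g = "label_list (p_e2 p) (p_A p)"
  let ?X = "?f ` set R1" and ?Y = "?g ` set R2" and ?C = "set (p_C p)"
  have card: "card ?X = length R1" "card ?Y = length R2"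
    using assms(1,2) by (metis distinct_card length_map set_map)+
  have E: "set (compat p R1 R2) = {(x, y). x \<in> ?X \<and> y \<in> ?Y \<and> (\<exists>s\<in>?C. ?f s = x \<and> ?g s = y)}"
    by (auto simp: compat_def)
  note mm = max_matching[of "compat p R1 R2", unfolded E]
  show ?thesis
  proof
    assume L: ?L
    obtain S where "S \<subseteq> ?C" "?X \<subseteq> ?f ` S" "?Y \<subseteq> ?g ` S"
      "card S + length (max_matching (compat p R1 R2)) \<le> card ?X + card ?Y"
      using cover_of_matching[OF finite_imageI[OF finite_set] finite_imageI[OF finite_set]
        image_mono[OF assms(3)] image_mono[OF assms(4)] mm(1)] by blast
    then show ?R using L card by (intro exI[of _ S]) auto
  next
    assume ?R
    then obtain S where S: "S \<subseteq> ?C" "card S \<le> length (p_k p)" "?X \<subseteq> ?f ` S" "?Y \<subseteq> ?g ` S" by blast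
    have "finite S" using S(1) finite_subset by blast
    from matching_of_cover[OF this S(1,3,4)] obtain M where
      M: "matching {(x, y). x \<in> ?X \<and> y \<in> ?Y \<and> (\<exists>s\<in>?C. ?f s = x \<and> ?g s = y)} M"
      "card ?X + card ?Y \<le> card S + length M" by blast
    have "length M \<le> length (max_matching (compat p R1 R2))" by (rule mm(2)[OF M(1)])
    then show ?L using M(2) S(2) card by simp
  qed
qed

lemma filter_in_subseqs: "filter P xs \<in> set (subseqs xs)"
  by (induction xs) (auto simp: Let_def)

lemma choose_segments_sound:
  assumes "choose_segments (candidates p)"
  shows "solvable p"
proof -
  let ?r1 = "representatives (p_e1 p) (p_A p) (p_C p)" and ?r2 = "representatives (p_e2 p) (p_A p) (p_C p)"
  obtain ys where ys: "ys \<in> set (subseqs (map (\<lambda>v. (True, v)) ?r1 @ map (\<lambda>v. (False, v)) ?r2))"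
    "choice_ok (p, [], rev ys)"
    using assms by (auto simp: candidates_def choose_segments_iff)
  define R1 where "R1 = map snd (filter (\<lambda>r. fst r) (rev ys))"
  define R2 where "R2 = map snd (filter (\<lambda>r. \<not> fst r) (rev ys))"
  have h: "hits p R1 R2" using ys(2) by (simp add: choice_ok_def R1_def R2_def)
  have d: "distinct ?r1" "distinct ?r2"
    using representatives(2) unfolding distinct_map by blast+
  have "distinct (map (\<lambda>v. (True, v)) ?r1 @ map (\<lambda>v. (False, v)) ?r2)"
    using d by (auto simp: distinct_map inj_on_def)
  then have dy: "distinct ys" using ys(1) subseqs_distinctD by blast
  have sy: "set ys \<subseteq> Pair True ` set ?r1 \<union> Pair False ` set ?r2"
  proof -
    have "set ys \<in> Pow (set (map (\<lambda>v. (True, v)) ?r1 @ map (\<lambda>v. (False, v)) ?r2))"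
      using ys(1) subseqs_powset by (metis image_eqI)
    then show ?thesis by auto
  qed
  then have sub: "set R1 \<subseteq> set ?r1" "set R2 \<subseteq> set ?r2" by (auto simp: R1_def R2_def)
  have dR: "distinct R1" "distinct R2"
    using dy by (auto simp: R1_def R2_def distinct_map inj_on_def)
  have dl: "distinct (map (label_list (p_e1 p) (p_A p)) R1)" "distinct (map (label_list (p_e2 p) (p_A p)) R2)"
    using dR sub representatives(2)[of "p_e1 p" "p_A p" "p_C p"] representatives(2)[of "p_e2 p" "p_A p" "p_C p"]
    by (auto simp: distinct_map intro: inj_on_subset)
  have C: "set R1 \<subseteq> set (p_C p)" "set R2 \<subseteq> set (p_C p)"
    using sub representatives(1) by blast+
  from h hits_iff_cover[OF dl C] obtain S where S: "S \<subseteq> set (p_C p)" "card S \<le> length (p_k p)"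
    "label_list (p_e1 p) (p_A p) ` set R1 \<subseteq> label_list (p_e1 p) (p_A p) ` S"
    "label_list (p_e2 p) (p_A p) ` set R2 \<subseteq> label_list (p_e2 p) (p_A p) ` S"
    unfolding hits_def by blast
  have emp: "core (mg (p_e1 p)) (set (p_A p) - set R1) = {}" "core (mg (p_e2 p)) (set (p_A p) - set R2) = {}"
    using h unfolding hits_def core_list_filter_Nil_iff by simp_all
  have "core (mg (p_e1 p)) (set (p_A p) - S) = {}"
  proof (rule core_empty_transfer[OF emp(1)])
    fix r assume "r \<in> set R1"
    then have "label_list (p_e1 p) (p_A p) r \<in> label_list (p_e1 p) (p_A p) ` S" using S(3) by blast
    then obtain s where s: "label_list (p_e1 p) (p_A p) r = label_list (p_e1 p) (p_A p) s" "s \<in> S"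
      by (rule imageE)
    then show "\<exists>s\<in>S. label (p_e1 p) (p_A p) s = label (p_e1 p) (p_A p) r"
      unfolding label_list_eq_iff by (intro bexI[of _ s]) simp_all
  qed
  moreover have "core (mg (p_e2 p)) (set (p_A p) - S) = {}"
  proof (rule core_empty_transfer[OF emp(2)])
    fix r assume "r \<in> set R2"
    then have "label_list (p_e2 p) (p_A p) r \<in> label_list (p_e2 p) (p_A p) ` S" using S(4) by blast
    then obtain s where s: "label_list (p_e2 p) (p_A p) r = label_list (p_e2 p) (p_A p) s" "s \<in> S"
      by (rule imageE)
    then show "\<exists>s\<in>S. label (p_e2 p) (p_A p) s = label (p_e2 p) (p_A p) r"
      unfolding label_list_eq_iff by (intro bexI[of _ s]) simp_all
  qed
  ultimately show ?thesis using S(1,2) unfolding solvable_def by blast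
qed

text \<open>For a solution \<open>S\<close> the right guess consists of the representatives whose
  labels occur among the core vertices of \<open>S\<close>; then \<open>S\<close> is itself a cover.
  The degree bounds enter through \<open>card_labels_le\<close>.\<close>

lemma choose_segments_complete:
  assumes "solvable p"
    and deg2: "\<And>u. u \<in> set (p_C p) \<Longrightarrow> deg (mg (p_e1 p)) (core (mg (p_e1 p)) (set (p_A p))) u \<le> 2"
      "\<And>u. u \<in> set (p_C p) \<Longrightarrow> deg (mg (p_e2 p)) (core (mg (p_e2 p)) (set (p_A p))) u \<le> 2"
  shows "few_candidates p" "choose_segments (candidates p)"
proof -
  let ?r1 = "representatives (p_e1 p) (p_A p) (p_C p)" and ?r2 = "representatives (p_e2 p) (p_A p) (p_C p)"
  let ?f = "label_list (p_e1 p) (p_A p)" and ?g = "label_list (p_e2 p) (p_A p)"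
  let ?K1 = "core (mg (p_e1 p)) (set (p_A p))" and ?K2 = "core (mg (p_e2 p)) (set (p_A p))"
  obtain S where S: "S \<subseteq> set (p_C p)" "card S \<le> length (p_k p)"
    "core (mg (p_e1 p)) (set (p_A p) - S) = {}" "core (mg (p_e2 p)) (set (p_A p) - S) = {}"
    using assms(1) by (auto simp: solvable_def)
  have finS: "finite S" using S(1) finite_subset by blast
  show "few_candidates p"
    unfolding few_candidates_def length_representatives
    using card_labels_le[OF _ S(1) finS S(3) deg2(1)] card_labels_le[OF _ S(1) finS S(4) deg2(2)] S(2)
    by simp
  define R1 where "R1 = filter (\<lambda>r. ?f r \<in> ?f ` (S \<inter> ?K1)) ?r1"
  define R2 where "R2 = filter (\<lambda>r. ?g r \<in> ?g ` (S \<inter> ?K2)) ?r2"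
  define q where "q = (\<lambda>(b, r). if b then ?f r \<in> ?f ` (S \<inter> ?K1) else ?g r \<in> ?g ` (S \<inter> ?K2))"
  let ?todo = "map (\<lambda>v. (True, v)) ?r1 @ map (\<lambda>v. (False, v)) ?r2"
  have ys: "rev (filter q ?todo) = map (\<lambda>v. (False, v)) (rev R2) @ map (\<lambda>v. (True, v)) (rev R1)"
    by (simp add: q_def R1_def R2_def filter_map comp_def rev_map)
  have "hits p (rev R1) (rev R2)"
  proof -
    have "distinct (map ?f (rev R1))" "distinct (map ?g (rev R2))"
      unfolding rev_map[symmetric] distinct_rev R1_def R2_def
      by (intro distinct_map_filter representatives(2))+
    moreover have "set (rev R1) \<subseteq> set (p_C p)" "set (rev R2) \<subseteq> set (p_C p)"
      using representatives(1) by (auto simp: R1_def R2_def)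
    moreover have "?f ` set (rev R1) \<subseteq> ?f ` S" "?g ` set (rev R2) \<subseteq> ?g ` S"
      by (auto simp: R1_def R2_def)
    ultimately have len: "length (rev R1 @ rev R2) \<le> length (p_k p @ map (\<lambda>_. 0) (max_matching (compat p (rev R1) (rev R2))))"
      using S(1,2) hits_iff_cover[of p "rev R1" "rev R2"] by blast
      have "core (mg (p_e1 p)) (set (p_A p) - set (rev R1)) = {}"
    proof (rule core_empty_transfer[OF S(3)])
      fix s assume s: "s \<in> S" "s \<in> ?K1"
      have "?f s \<in> ?f ` set ?r1" unfolding representatives(3) using s S(1) by blast
      then obtain r where r: "?f s = ?f r" "r \<in> set ?r1" by (rule imageE)
      have "?f r \<in> ?f ` (S \<inter> ?K1)" unfolding r(1)[symmetric] using s by blast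
      then have "r \<in> set (rev R1)" using r(2) by (simp add: R1_def)
      then show "\<exists>r\<in>set (rev R1). label (p_e1 p) (p_A p) r = label (p_e1 p) (p_A p) s"
        using r(1) unfolding label_list_eq_iff by (intro bexI[of _ r]) simp_all
    qed
    moreover have "core (mg (p_e2 p)) (set (p_A p) - set (rev R2)) = {}"
    proof (rule core_empty_transfer[OF S(4)])
      fix s assume s: "s \<in> S" "s \<in> ?K2"
      have "?g s \<in> ?g ` set ?r2" unfolding representatives(3) using s S(1) by blast
      then obtain r where r: "?g s = ?g r" "r \<in> set ?r2" by (rule imageE)
      have "?g r \<in> ?g ` (S \<inter> ?K2)" unfolding r(1)[symmetric] using s by blast
      then have "r \<in> set (rev R2)" using r(2) by (simp add: R2_def)
      then show "\<exists>r\<in>set (rev R2). label (p_e2 p) (p_A p) r = label (p_e2 p) (p_A p) s"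
        using r(1) unfolding label_list_eq_iff by (intro bexI[of _ r]) simp_all
    qed
    ultimately show ?thesis
      using len unfolding hits_def core_list_filter_Nil_iff by simp
  qed
  then have "choice_ok (p, [], rev (filter q ?todo))"
    unfolding ys choice_ok_def by (simp add: filter_map comp_def)
  then show "choose_segments (candidates p)"
    unfolding candidates_def choose_segments_iff using filter_in_subseqs[of q ?todo]
    by (intro bexI[of _ "filter q ?todo"]) simp_all
qed

subsection \<open>Branching on vertices of high degree\<close>

text \<open>The second component of a state is the number of vertices that may still be kept.\<close>

type_synonym state = "params \<times> nat list"

definition longer :: "'a list \<Rightarrow> 'a list \<Rightarrow> 'a list" where
  "longer xs ys = (if length xs \<le> length ys then ys else xs)"

definition max_inc :: "params \<Rightarrow> nat \<Rightarrow> edges" where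
  "max_inc p v = longer (incidences (p_e1 p) (core_list (p_e1 p) (p_A p)) v)
     (incidences (p_e2 p) (core_list (p_e2 p) (p_A p)) v)"

definition heavy :: "params \<Rightarrow> nat list" where
  "heavy p = filter (\<lambda>v. length [v, v, v] \<le> length (max_inc p v) \<and>
     (\<forall>u\<in>set (p_C p). length (max_inc p u) \<le> length (max_inc p v))) (p_C p)"

definition finished :: "state \<Rightarrow> bool" where
  "finished s \<longleftrightarrow> p_k (fst s) = [] \<or> snd s = [] \<or> heavy (fst s) = []"

text \<open>The first conjunct is the guard of \<open>ctime_guard\<close>: it keeps the exponential
  search to at most \<open>6 * length (p_k (fst s))\<close> candidates, and it rejects states in
  which a heavy vertex is left because a counter ran out.\<close>

definition leaf_ok :: "state \<Rightarrow> bool" where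
  "leaf_ok s \<longleftrightarrow> (heavy (fst s) = [] \<and> few_candidates (fst s)) \<and> choose_segments (candidates (fst s))"

definition delete :: "state \<Rightarrow> state" where
  "delete s = ((fst (fst s), filter (\<lambda>u. u \<noteq> hd (heavy (fst s))) (p_A (fst s)),
     filter (\<lambda>u. u \<noteq> hd (heavy (fst s))) (p_C (fst s)), tl (p_k (fst s))), snd s)"

definition keep :: "state \<Rightarrow> state" where
  "keep s = ((fst (fst s), p_A (fst s),
     filter (\<lambda>u. u \<noteq> hd (heavy (fst s))) (p_C (fst s)), p_k (fst s)), tl (snd s))"

function branch :: "state \<Rightarrow> bool" where
  "branch s = (if finished s then leaf_ok s else branch (delete s) \<or> branch (keep s))"
  by pat_completeness auto
termination
  by (relation "measure (\<lambda>s. length (p_k (fst s)) + length (snd s))")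
    (auto simp: finished_def delete_def keep_def)

declare branch.simps [simp del]

section \<open>Correctness of the branching\<close>

abbreviation deg1 :: "params \<Rightarrow> nat \<Rightarrow> nat" where
  "deg1 p v \<equiv> deg (mg (p_e1 p)) (core (mg (p_e1 p)) (set (p_A p))) v"
abbreviation deg2 :: "params \<Rightarrow> nat \<Rightarrow> nat" where
  "deg2 p v \<equiv> deg (mg (p_e2 p)) (core (mg (p_e2 p)) (set (p_A p))) v"

lemma length_max_inc [simp]: "length (max_inc p v) = max (deg1 p v) (deg2 p v)"
  by (simp add: max_inc_def longer_def)

text \<open>Only vertices of maximal degree are listed as heavy, so the argument passes from
  \<open>u\<close> to a vertex attaining the maximum.\<close>

lemma heavy_NilD:
  assumes "heavy p = []" "u \<in> set (p_C p)"
  shows "max (deg1 p u) (deg2 p u) \<le> 2"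
proof (rule ccontr)
  assume "\<not> max (deg1 p u) (deg2 p u) \<le> 2"
  let ?m = "\<lambda>v. max (deg1 p v) (deg2 p v)"
  have "Max (?m ` set (p_C p)) \<in> ?m ` set (p_C p)" using assms(2) by (intro Max_in) auto
  then obtain v where v: "v \<in> set (p_C p)" "?m v = Max (?m ` set (p_C p))" by auto
  have le: "?m w \<le> ?m v" if "w \<in> set (p_C p)" for w
    by (subst v(2)) (rule Max_ge[OF finite_imageI[OF finite_set] imageI[OF that]])
  then have "3 \<le> ?m v" using le[OF assms(2)] \<open>\<not> ?m u \<le> 2\<close> by linarith
  then have "v \<in> set (heavy p)" unfolding heavy_def using v(1) le by (simp del: max.bounded_iff)
  then show False using assms(1) by simp
qed

lemma heavyD:
  assumes "heavy p \<noteq> []"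
  shows "hd (heavy p) \<in> set (p_C p)" "3 \<le> max (deg1 p (hd (heavy p))) (deg2 p (hd (heavy p)))"
    "u \<in> set (p_C p) \<Longrightarrow> max (deg1 p u) (deg2 p u) \<le> max (deg1 p (hd (heavy p))) (deg2 p (hd (heavy p)))"
  using hd_in_set[OF assms] by (auto simp: heavy_def simp del: max.bounded_iff)

lemma solvable_delete:
  assumes "\<not> finished s" "solvable (fst (delete s))"
  shows "solvable (fst s)"
proof -
  let ?v = "hd (heavy (fst s))" and ?p = "fst s"
  have v: "?v \<in> set (p_C ?p)" using assms(1) heavyD(1)[of ?p] by (auto simp: finished_def)
  obtain S where S: "S \<subseteq> set (p_C ?p) - {?v}" "card S \<le> length (tl (p_k ?p))"
    "core (mg (p_e1 ?p)) ((set (p_A ?p) - {?v}) - S) = {}"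
    "core (mg (p_e2 ?p)) ((set (p_A ?p) - {?v}) - S) = {}"
  proof -
    have "{x \<in> X. x \<noteq> ?v} = X - {?v}" for X by auto
    then show thesis using assms(2) that by (auto simp: solvable_def delete_def)
  qed
  have "finite S" using S(1) finite_subset by blast
  then have "card (insert ?v S) \<le> length (p_k ?p)"
    using S(1,2) assms(1) by (cases "p_k ?p") (auto simp: finished_def card_insert_if)
  moreover have "X - insert ?v S = X - {?v} - S" for X by auto
  ultimately show ?thesis using S v unfolding solvable_def
    by (intro exI[of _ "insert ?v S"]) auto
qed

lemma solvable_keep: "solvable (fst (keep s)) \<Longrightarrow> solvable (fst s)"
  unfolding solvable_def keep_def fst_conv snd_conv set_filter by blast

lemma solvable_cases:
  assumes "\<not> finished s" "solvable (fst s)"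
  shows "solvable (fst (delete s)) \<or> solvable (fst (keep s))"
proof -
  let ?v = "hd (heavy (fst s))" and ?p = "fst s"
  have set': "{x \<in> X. x \<noteq> ?v} = X - {?v}" for X by auto
  obtain S where S: "S \<subseteq> set (p_C ?p)" "card S \<le> length (p_k ?p)"
    "core (mg (p_e1 ?p)) (set (p_A ?p) - S) = {}" "core (mg (p_e2 ?p)) (set (p_A ?p) - S) = {}"
    using assms(2) by (auto simp: solvable_def)
  have "finite S" using S(1) finite_subset by blast
  show ?thesis
  proof (cases "?v \<in> S")
    case True
    then have "X - {?v} - (S - {?v}) = X - S" for X by auto
    moreover have "card (S - {?v}) \<le> length (p_k ?p) - 1" using S(2) True \<open>finite S\<close> by simp
    ultimately have "solvable (fst (delete s))"
      using S unfolding solvable_def delete_def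
      by (intro exI[of _ "S - {?v}"]) (auto simp: set')
    then show ?thesis ..
  next
    case False
    then have "solvable (fst (keep s))"
      using S unfolding solvable_def keep_def by (intro exI[of _ S]) (auto simp: set')
    then show ?thesis ..
  qed
qed

lemma branch_sound: "branch s \<Longrightarrow> solvable (fst s)"
proof (induction s rule: branch.induct)
  case (1 s)
  show ?case
  proof (cases "finished s")
    case True
    then have "leaf_ok s" using "1.prems" branch.simps[of s] by simp
    then show ?thesis using choose_segments_sound by (simp add: leaf_ok_def)
  next
    case False
    then have "branch (delete s) \<or> branch (keep s)" using 1 branch.simps[of s] by simp
    then show ?thesis using 1 False solvable_delete solvable_keep by blast
  qed
qed

text \<open>
  Each kept vertex had excess degree at least \<open>D - 2\<close>, and each deletion destroys at most
  \<open>2 D \<le> 6 (D - 2)\<close> of excess, where \<open>D\<close> is the current bound on the degrees of undecided vertices.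
  As the search starts with \<open>k\<^sub>0\<close> deletions and \<open>6 k\<^sub>0 + 1\<close> keeps, \<open>6 k + 1 - f\<close> is the number of
  kept vertices minus six times the number of deletions when \<open>k\<close> and \<open>f\<close> of them are left.
\<close>

definition excess_sum :: "params \<Rightarrow> int" where
  "excess_sum p = excess (mg (p_e1 p)) (- set (p_C p)) (core (mg (p_e1 p)) (set (p_A p))) +
     excess (mg (p_e2 p)) (- set (p_C p)) (core (mg (p_e2 p)) (set (p_A p)))"

definition balanced :: "state \<Rightarrow> bool" where
  "balanced s \<longleftrightarrow> (\<exists>D\<ge>3. (\<forall>u\<in>set (p_C (fst s)). max (deg1 (fst s) u) (deg2 (fst s) u) \<le> D) \<and>
     (int D - 2) * (6 * int (length (p_k (fst s))) + 1 - int (length (snd s))) \<le> excess_sum (fst s))"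

lemma excess_core_nonneg: "finite A \<Longrightarrow> 0 \<le> excess M F (core M A)"
proof -
  assume "finite A"
  then have "finite (core M A)" using core_subset finite_subset by metis
  then show ?thesis
    using excess_dense[OF dense_core, of M A F] dense_core[of M A]
    by (auto simp: dense_def intro!: sum_nonneg)
qed

lemma balanced_budget:
  assumes "balanced s" "solvable (fst s)"
  shows "snd s \<noteq> []"
proof
  assume f: "snd s = []"
  let ?p = "fst s"
  let ?k = "int (length (p_k ?p))"
  obtain D where D: "3 \<le> D" "\<And>u. u \<in> set (p_C ?p) \<Longrightarrow> max (deg1 ?p u) (deg2 ?p u) \<le> D"
    "(int D - 2) * (6 * ?k + 1) \<le> excess_sum ?p"
    using assms(1) f unfolding balanced_def by (auto simp del: max.bounded_iff)
  obtain S where S: "S \<subseteq> set (p_C ?p)" "card S \<le> length (p_k ?p)"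
    "core (mg (p_e1 ?p)) (set (p_A ?p) - S) = {}" "core (mg (p_e2 ?p)) (set (p_A ?p) - S) = {}"
    using assms(2) by (auto simp: solvable_def)
  have fin: "finite S" using S(1) finite_subset by blast
  have bound: "(\<Sum>x\<in>S \<inter> K. int (d x)) \<le> int D * ?k" if "\<And>u. u \<in> S \<Longrightarrow> d u \<le> D" for K d
  proof -
    have "(\<Sum>x\<in>S \<inter> K. int (d x)) \<le> (\<Sum>x\<in>S \<inter> K. int D)" using that by (intro sum_mono) auto
    also have "\<dots> = int (card (S \<inter> K)) * int D" by simp
    also have "\<dots> \<le> ?k * int D"
      using S(2) fin card_mono[of S "S \<inter> K"] by (intro mult_right_mono) auto
    finally show ?thesis by (simp add: mult.commute)
  qed
  have "excess (mg (p_e1 ?p)) (- set (p_C ?p)) (core (mg (p_e1 ?p)) (set (p_A ?p))) \<le> int D * ?k"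
  proof -
    have "S \<inter> - set (p_C ?p) = {}" using S(1) by auto
    from order_trans[OF excess_le_solution[OF finite_set this S(3)] bound] show ?thesis
      using S(1) D(2) by auto
  qed
  moreover have "excess (mg (p_e2 ?p)) (- set (p_C ?p)) (core (mg (p_e2 ?p)) (set (p_A ?p))) \<le> int D * ?k"
  proof -
    have "S \<inter> - set (p_C ?p) = {}" using S(1) by auto
    from order_trans[OF excess_le_solution[OF finite_set this S(4)] bound] show ?thesis
      using S(1) D(2) by auto
  qed
  ultimately have "(int D - 2) * (6 * ?k + 1) \<le> 2 * (int D * ?k)"
    using D(3) unfolding excess_sum_def by linarith
  \<comment> \<open>This is where 6 keeps per deletion and one extra keep suffice: the coefficient
    of \<open>?k\<close> is nonnegative from \<open>D = 3\<close> on, and the extra keep leaves the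
    positive term \<open>D - 2\<close>.\<close>
  then have "4 * (int D - 3) * ?k + (int D - 2) \<le> 0" by (simp add: algebra_simps)
  moreover have "0 \<le> 4 * (int D - 3) * ?k" using D(1) by (intro mult_nonneg_nonneg) auto
  ultimately show False using D(1) by linarith
qed

lemma excess_core_subset_cong:
  assumes "v \<notin> U"
  shows "excess M (- (C - {v})) U = excess M (- C) U"
  unfolding excess_def using assms by (intro sum.cong) (auto simp: balance_def)

lemma excess_delete:
  assumes "finite A" "v \<in> C"
  shows "excess M (- C) (core M A) - int (deg M (core M A) v) \<le> excess M (- (C - {v})) (core M (A - {v}))"
proof -
  have "v \<notin> core M (A - {v})" using core_subset[of M "A - {v}"] by auto
  then have "excess M (- (C - {v})) (core M (A - {v})) = excess M (- C) (core M (A - {v}))"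
    by (rule excess_core_subset_cong)
  moreover have "(\<Sum>x\<in>{v} \<inter> core M A. int (deg M (core M A) x)) \<le> int (deg M (core M A) v)"
    by (cases "v \<in> core M A") auto
  ultimately show ?thesis
    using excess_core_remove[of A "{v}" "- C" M] assms by simp
qed

text \<open>On joining the kept vertices, the balance of a core vertex rises from 0 to its degree
  minus 2. The maximum with 0 covers a vertex outside the core, whose degree there is 0.\<close>

lemma excess_keep:
  assumes "finite A" "v \<in> C"
  shows "excess M (- C) (core M A) + max 0 (int (deg M (core M A) v) - 2) \<le> excess M (- (C - {v})) (core M A)"
proof (cases "v \<in> core M A")
  case True
  let ?K = "core M A"
  have fin: "finite ?K" using assms(1) core_subset finite_subset by metis
  have "?K \<inter> - (C - {v}) = insert v (?K \<inter> - C)" using True by auto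
  then have "(\<Sum>u\<in>?K \<inter> - (C - {v}). int (deg M ?K u) - 2) =
      (int (deg M ?K v) - 2) + (\<Sum>u\<in>?K \<inter> - C. int (deg M ?K u) - 2)"
    using fin assms(2) by (simp add: sum.insert)
  moreover have "2 \<le> deg M ?K v" using True dense_core[of M A] by (auto simp: dense_def)
  ultimately show ?thesis
    using excess_dense[OF dense_core fin, of "- C"] excess_dense[OF dense_core fin, of "- (C - {v})"]
    by simp
next
  case False
  then show ?thesis using excess_core_subset_cong[OF False, of M C] deg_notin[OF False, of M] by simp
qed

lemma balanced_delete_keep:
  assumes s: "balanced s" and nf: "\<not> finished s"
  shows "balanced (delete s)" "balanced (keep s)"
proof -
  let ?p = "fst s" and ?v = "hd (heavy (fst s))"
  let ?d = "max (deg1 ?p ?v) (deg2 ?p ?v)"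
  let ?t = "6 * int (length (p_k ?p)) + 1 - int (length (snd s))"
  have ne: "heavy ?p \<noteq> []" "p_k ?p \<noteq> []" "snd s \<noteq> []" using nf by (auto simp: finished_def)
  note v = heavyD[OF ne(1)]
  obtain D where D: "3 \<le> D" "\<And>u. u \<in> set (p_C ?p) \<Longrightarrow> max (deg1 ?p u) (deg2 ?p u) \<le> D"
    "(int D - 2) * ?t \<le> excess_sum ?p"
    using s unfolding balanced_def by (auto simp del: max.bounded_iff)
  have dD: "?d \<le> D" using D(2) v(1) by blast
  have d3: "3 \<le> int ?d" using v(2) by linarith
  have dle: "int (deg1 ?p ?v) \<le> int ?d" "int (deg2 ?p ?v) \<le> int ?d" by simp_all
  have nonneg: "0 \<le> excess_sum ?p"
    unfolding excess_sum_def by (intro add_nonneg_nonneg excess_core_nonneg) auto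
  \<comment> \<open>The bound \<open>D\<close> may be lowered to the current maximal degree: for
    \<open>?t \<ge> 0\<close> the left side shrinks, and for \<open>?t < 0\<close> it is negative
    while the excess is not.\<close>
  have inv: "(int ?d - 2) * ?t \<le> excess_sum ?p"
  proof (cases "0 \<le> ?t")
    case True
    then have "(int ?d - 2) * ?t \<le> (int D - 2) * ?t" using dD by (intro mult_right_mono) auto
    then show ?thesis using D(3) by linarith
  next
    case False
    then have "(int ?d - 2) * ?t \<le> 0" using d3 by (intro mult_nonneg_nonpos) auto
    then show ?thesis using nonneg by linarith
  qed
  have set': "{x \<in> X. x \<noteq> ?v} = X - {?v}" for X by auto
  have set'': "set (filter (\<lambda>u. u \<noteq> ?v) X) = set X - {?v}" for X by auto
  show "balanced (delete s)"
    unfolding balanced_def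
  proof (intro exI[of _ ?d] conjI ballI)
    show "3 \<le> ?d" by (rule v(2))
    fix u assume "u \<in> set (p_C (fst (delete s)))"
    then have u: "u \<in> set (p_C ?p)" by (simp add: delete_def)
    have "deg M (core M (set (p_A ?p) - {?v})) u \<le> deg M (core M (set (p_A ?p))) u" for M
      by (intro deg_mono core_mono) auto
    then have "max (deg1 (fst (delete s)) u) (deg2 (fst (delete s)) u) \<le> max (deg1 ?p u) (deg2 ?p u)"
      by (intro max.mono) (simp_all add: delete_def set')
    then show "max (deg1 (fst (delete s)) u) (deg2 (fst (delete s)) u) \<le> ?d" using v(3)[OF u] by linarith
  next
    have ex: "excess_sum ?p - int (deg1 ?p ?v) - int (deg2 ?p ?v) \<le> excess_sum (fst (delete s))"
      using excess_delete[OF _ v(1), of "set (p_A ?p)" "mg (p_e1 ?p)"]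
        excess_delete[OF _ v(1), of "set (p_A ?p)" "mg (p_e2 ?p)"]
      by (simp add: excess_sum_def delete_def set')
    \<comment> \<open>The sum is at most \<open>2 * ?d\<close>, which is at most
      \<open>6 * (?d - 2)\<close> because \<open>?d \<ge> 3\<close>.\<close>
    have le: "int (deg1 ?p ?v) + int (deg2 ?p ?v) \<le> 6 * int ?d - 12"
      using d3 dle by linarith
    have "6 * int (length (p_k (fst (delete s)))) + 1 - int (length (snd (delete s))) = ?t - 6"
      using ne(2) by (cases "p_k ?p") (simp_all add: delete_def)
    then have eq: "(int ?d - 2) * (6 * int (length (p_k (fst (delete s)))) + 1 - int (length (snd (delete s)))) =
        (int ?d - 2) * ?t - (6 * int ?d - 12)"
      by (simp only:) (simp add: algebra_simps)
    have arith: "x - y \<le> e'" if "x \<le> e" "e - a - b \<le> e'" "a + b \<le> y" for x y a b e e' :: int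
      using that by linarith
    show "(int ?d - 2) * (6 * int (length (p_k (fst (delete s)))) + 1 - int (length (snd (delete s))))
      \<le> excess_sum (fst (delete s))" unfolding eq by (rule arith[OF inv ex le])
  qed
  show "balanced (keep s)"
    unfolding balanced_def
  proof (intro exI[of _ ?d] conjI ballI)
    show "3 \<le> ?d" by (rule v(2))
    fix u assume "u \<in> set (p_C (fst (keep s)))"
    then have u: "u \<in> set (p_C ?p)" by (simp add: keep_def)
    have "deg1 (fst (keep s)) u = deg1 ?p u" "deg2 (fst (keep s)) u = deg2 ?p u" by (simp_all add: keep_def)
    then show "max (deg1 (fst (keep s)) u) (deg2 (fst (keep s)) u) \<le> ?d" using v(3)[OF u] by simp
  next
    have ex: "excess_sum ?p + max 0 (int (deg1 ?p ?v) - 2) + max 0 (int (deg2 ?p ?v) - 2) \<le> excess_sum (fst (keep s))"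
      using excess_keep[OF _ v(1), of "set (p_A ?p)" "mg (p_e1 ?p)"]
        excess_keep[OF _ v(1), of "set (p_A ?p)" "mg (p_e2 ?p)"]
      by (simp add: excess_sum_def keep_def set')
    have le: "int ?d - 2 \<le> max 0 (int (deg1 ?p ?v) - 2) + max 0 (int (deg2 ?p ?v) - 2)" by linarith
    have "6 * int (length (p_k (fst (keep s)))) + 1 - int (length (snd (keep s))) = ?t + 1"
      using ne(3) by (cases "snd s") (simp_all add: keep_def)
    then have eq: "(int ?d - 2) * (6 * int (length (p_k (fst (keep s)))) + 1 - int (length (snd (keep s)))) =
        (int ?d - 2) * ?t + (int ?d - 2)"
      by (simp only:) (simp add: algebra_simps)
    have arith: "x + y \<le> e'" if "x \<le> e" "e + a + b \<le> e'" "y \<le> a + b" for x y a b e e' :: int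
      using that by linarith
    show "(int ?d - 2) * (6 * int (length (p_k (fst (keep s)))) + 1 - int (length (snd (keep s))))
      \<le> excess_sum (fst (keep s))" unfolding eq by (rule arith[OF inv ex le])
  qed
qed

lemma branch_complete: "solvable (fst s) \<Longrightarrow> balanced s \<Longrightarrow> branch s"
proof (induction s rule: branch.induct)
  case (1 s)
  show ?case
  proof (cases "finished s")
    case True
    \<comment> \<open>By \<open>balanced_budget\<close> the keeps cannot have run out, so a
      remaining heavy vertex means that no deletion is left. Then the solution is empty, and both
      cores are empty as well.\<close>
    have "heavy (fst s) = []"
    proof (rule ccontr)
      assume h: "heavy (fst s) \<noteq> []"
      then have "p_k (fst s) = []" using True balanced_budget 1 by (auto simp: finished_def)
      then obtain S where "card S = 0" "S \<subseteq> set (p_C (fst s))"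
        and S: "core (mg (p_e1 (fst s))) (set (p_A (fst s)) - S) = {}"
          "core (mg (p_e2 (fst s))) (set (p_A (fst s)) - S) = {}"
        using 1 by (auto simp: solvable_def)
      then have "S = {}" using finite_subset by fastforce
      then have "deg1 (fst s) v = 0" "deg2 (fst s) v = 0" for v using S by (simp_all add: deg_notin)
      then show False using heavyD(2)[OF h] by simp
    qed
    moreover from heavy_NilD[OF this] have "few_candidates (fst s)" "choose_segments (candidates (fst s))"
      using choose_segments_complete[OF 1(3)] by auto
    ultimately show ?thesis using True branch.simps[of s] by (simp add: leaf_ok_def)
  next
    case False
    then have "branch (delete s) \<or> branch (keep s)"
      using 1 solvable_cases balanced_delete_keep by blast
    then show ?thesis using False branch.simps[of s] by simp
  qed
qed

subsection \<open>Running time\<close>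

lemma ptime_incidences [ptime_intros]:
  assumes "ptime E" "ptime K" "ptime v"
  shows "ptime (\<lambda>x. incidences (E x) (K x) (v x))"
  unfolding incidences_def
  by (intro ptime_intros assms ptime_comp[OF assms(2)] ptime_comp[OF assms(3)])

lemma ptime_prune [ptime_intros]:
  assumes "ptime E" "ptime K"
  shows "ptime (\<lambda>x. prune (E x) (K x))"
  unfolding prune_def
  by (intro ptime_intros assms ptime_comp[OF assms(1)] ptime_comp[OF assms(2)])

lemma ptime_core_list [ptime_intros]:
  assumes "ptime E" "ptime A"
  shows "ptime (\<lambda>x. core_list (E x) (A x))"
proof -
  have "esize (foldr (\<lambda>_. prune es) ys A) \<le> esize A" for es ys A
    by (induction ys) (auto simp: prune_def intro: order_trans[OF esize_filter])
  then show ?thesis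
    unfolding core_list_def
    by (intro ptime_foldr[where B = "\<lambda>x. real (esize (A x))"] ptime_intros assms ptime_pbd
        ptime_comp[OF assms(1)] of_nat_mono)
qed

lemma ptime_label_list [ptime_intros]:
  assumes "ptime E" "ptime A" "ptime u"
  shows "ptime (\<lambda>x. label_list (E x) (A x) (u x))"
  unfolding label_list_def by (intro ptime_intros assms ptime_comp[OF assms(3)])

lemma ptime_representatives [ptime_intros]:
  assumes "ptime E" "ptime A" "ptime C"
  shows "ptime (\<lambda>x. representatives (E x) (A x) (C x))"
proof -
  let ?f = "\<lambda>es A v R. if \<exists>u\<in>set R. label_list es A u = label_list es A v then R else v # R"
  have bound: "esize (foldr (?f es A) ys []) \<le> esize ys" for es A ys
    by (induction ys) auto
  show ?thesis
    unfolding representatives_def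
  proof (intro ptime_foldr[where B = "\<lambda>x. real (esize (C x))"])
    show "ptime (\<lambda>p. ?f (E (fst (fst p))) (A (fst (fst p))) (snd (fst p)) (snd p))"
      by (intro ptime_intros ptime_comp[OF assms(1)] ptime_comp[OF assms(2)])
    show "ptime (\<lambda>e. filter (\<lambda>v. v \<in> set (core_list (E e) (A e))) (C e))"
      by (intro ptime_intros assms ptime_comp[OF assms(1)] ptime_comp[OF assms(2)])
    show "ptime (\<lambda>_. [])" by (rule ptime_const)
    show "pbd (\<lambda>x. real (esize (C x)))" by (rule ptime_pbd) fact
    fix x ys zs assume "filter (\<lambda>v. v \<in> set (core_list (E x) (A x))) (C x) = zs @ ys"
    from arg_cong[OF this, of esize] have "esize ys \<le> esize (C x)"
      using esize_filter[of "\<lambda>v. v \<in> set (core_list (E x) (A x))" "C x"] by simp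
    then show "real (esize (foldr (?f (E x) (A x)) ys [])) \<le> real (esize (C x))"
      using bound order_trans by (intro of_nat_mono) blast
  qed
qed

lemma ptime_compat [ptime_intros]:
  assumes "ptime p" "ptime R1" "ptime R2"
  shows "ptime (\<lambda>x. compat (p x) (R1 x) (R2 x))"
  unfolding compat_def
  by (intro ptime_intros assms ptime_comp[OF assms(1)])

lemma ptime_hits [ptime_intros]:
  assumes "ptime p" "ptime R1" "ptime R2"
  shows "ptime (\<lambda>x. hits (p x) (R1 x) (R2 x))"
  unfolding hits_def
  by (intro ptime_intros assms ptime_comp[OF assms(2)] ptime_comp[OF assms(3)])

lemma ptime_choice_ok: "ptime choice_ok"
  unfolding choice_ok_def[abs_def] by (intro ptime_intros)

lemma ctime_choose_segments: "ctime choose_segments (\<lambda>c. 2 ^ length (fst (snd c)))"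
proof (rule ctime_search[where f = choice_ok and V = "\<lambda>_. 1"])
  show "ptime (\<lambda>c :: choice. fst (snd c) = [])" "ptime choice_in" "ptime choice_out"
    unfolding choice_in_def[abs_def] choice_out_def[abs_def] by (intro ptime_intros)+
  show "ctime choice_ok (\<lambda>_. 1)" using ptime_choice_ok by (simp add: ptime_def)
  fix c :: choice
  show "choose_segments c = (if fst (snd c) = [] then choice_ok c
      else choose_segments (choice_in c) \<or> choose_segments (choice_out c))"
    by (rule choose_segments.simps)
  show "(1::real) \<le> 2 ^ length (fst (snd c))" by simp
  then show "(1::real) \<le> 2 ^ length (fst (snd c))" .
  assume ne: "fst (snd c) \<noteq> []"
  obtain p x todo R where c: "c = (p, x # todo, R)"
    using ne by (cases c; cases "fst (snd c)") auto
  show "esize (choice_in c) \<le> esize c" "esize (choice_out c) \<le> esize c"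
    by (simp_all add: c choice_in_def choice_out_def)
  show "(2::real) ^ length (fst (snd (choice_in c))) + 2 ^ length (fst (snd (choice_out c))) \<le> 2 ^ length (fst (snd c))"
    by (simp add: c choice_in_def choice_out_def)
qed

lemma ptime_candidates [ptime_intros]:
  assumes "ptime p"
  shows "ptime (\<lambda>x. candidates (p x))"
  unfolding candidates_def by (intro ptime_intros assms)

lemma ptime_few_candidates [ptime_intros]:
  assumes "ptime p"
  shows "ptime (\<lambda>x. few_candidates (p x))"
  unfolding few_candidates_def by (intro ptime_intros assms)

lemma ptime_longer [ptime_intros]:
  assumes "ptime xs" "ptime ys"
  shows "ptime (\<lambda>x. longer (xs x) (ys x))"
  unfolding longer_def by (intro ptime_intros assms)

lemma ptime_max_inc [ptime_intros]:
  assumes "ptime p" "ptime v"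
  shows "ptime (\<lambda>x. max_inc (p x) (v x))"
  unfolding max_inc_def by (intro ptime_intros assms)

lemma ptime_heavy [ptime_intros]:
  assumes "ptime p"
  shows "ptime (\<lambda>x. heavy (p x))"
  unfolding heavy_def by (intro ptime_intros assms ptime_comp[OF assms])

lemma ptime_finished: "ptime finished" and ptime_delete: "ptime delete" and ptime_keep: "ptime keep"
  unfolding finished_def[abs_def] delete_def[abs_def] keep_def[abs_def]
  by (intro ptime_intros)+

text \<open>A deletion leaves the fraction \<open>1 / 64\<close> of the potential and a keep the
  fraction \<open>63 / 64\<close>, which sum to 1. The power of 64 alone pays for the
  \<open>2 ^ (6 k)\<close> choices at a leaf.\<close>

definition potential :: "state \<Rightarrow> real" where
  "potential s = 64 ^ length (p_k (fst s)) * (64 / 63) ^ length (snd s)"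

lemma potential_ge_1: "1 \<le> potential s"
proof -
  have "1 * 1 \<le> potential s"
    unfolding potential_def by (intro mult_mono one_le_power) auto
  then show ?thesis by simp
qed

lemma ctime_branch: "ctime branch potential"
proof (rule ctime_search[where f = leaf_ok and V = "\<lambda>s. if heavy (fst s) = [] \<and> few_candidates (fst s)
    then 2 ^ length (fst (snd (candidates (fst s)))) else 1"])
  show "ptime finished" "ptime delete" "ptime keep"
    by (fact ptime_finished ptime_delete ptime_keep)+
  have "ctime (\<lambda>s :: state. choose_segments (candidates (fst s)))
      (\<lambda>s. 2 ^ length (fst (snd (candidates (fst s)))))"
    by (rule ctime_comp[OF ctime_choose_segments]) (intro ptime_intros, simp)
  from ctime_guard[OF _ this, of "\<lambda>s. heavy (fst s) = [] \<and> few_candidates (fst s)"]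
  show "ctime leaf_ok (\<lambda>s. if heavy (fst s) = [] \<and> few_candidates (fst s)
      then 2 ^ length (fst (snd (candidates (fst s)))) else 1)"
    unfolding leaf_ok_def[abs_def] by (simp add: ptime_intros)
  fix s
  show "branch s = (if finished s then leaf_ok s else branch (delete s) \<or> branch (keep s))"
    by (rule branch.simps)
  show "1 \<le> potential s" by (rule potential_ge_1)
  show "(if heavy (fst s) = [] \<and> few_candidates (fst s)
      then 2 ^ length (fst (snd (candidates (fst s)))) else 1) \<le> potential s"
  proof (cases "few_candidates (fst s)")
    case True
    then have "length (fst (snd (candidates (fst s)))) \<le> 6 * length (p_k (fst s))"
      by (simp add: few_candidates_def candidates_def)
    then have "(2::real) ^ length (fst (snd (candidates (fst s)))) \<le> 2 ^ (6 * length (p_k (fst s)))"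
      by (intro power_increasing) auto
    also have "\<dots> = 64 ^ length (p_k (fst s)) * 1" by (simp add: power_mult)
    also have "\<dots> \<le> potential s" unfolding potential_def by (intro mult_left_mono) auto
    finally show ?thesis using potential_ge_1[of s] by simp
  qed (use potential_ge_1[of s] in simp)
  assume nf: "\<not> finished s"
  show "esize (delete s) \<le> esize s" "esize (keep s) \<le> esize s"
    unfolding delete_def keep_def esize_fst_snd[of s] esize_fst_snd[of "fst s"]
      esize_fst_snd[of "snd (fst s)"] esize_fst_snd[of "snd (snd (fst s))"]
    by (auto intro!: add_mono esize_filter esize_tl)
  obtain I A C a k b f where s: "s = ((I, A, C, a # k), b # f)"
    using nf unfolding finished_def by (cases s; cases "p_k (fst s)"; cases "snd s") auto
  show "potential (delete s) + potential (keep s) \<le> potential s"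
    by (simp add: s delete_def keep_def potential_def field_simps)
qed

subsection \<open>Reading the budget\<close>

text \<open>A number and its list of bits are encoded by the same tree, so reading the bits costs
  nothing.\<close>

fun bits :: "nat \<Rightarrow> bool list" where
  "bits n = (if n = 0 then [] else odd n # bits (n div 2))"

declare bits.simps [simp del]

fun bits_value :: "bool list \<Rightarrow> nat" where
  "bits_value [] = 0"
| "bits_value (b # bs) = of_bool b + 2 * bits_value bs"

lemma bits_value_bits [simp]: "bits_value (bits n) = n"
proof (induction n rule: bits.induct)
  case (1 n)
  then show ?case by (subst bits.simps) (auto simp: of_bool_def elim!: oddE evenE)
qed

lemma enc_bits: "enc (bits n) = enc n"
proof (induction n rule: bits.induct)
  case (1 n)
  then show ?case by (subst bits.simps, subst enc_nat_eq, subst enc_nat.simps) simp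
qed

lemma ptime_bits [ptime_intros]: "ptime f \<Longrightarrow> ptime (\<lambda>x. bits (f x))"
  by (rule ptime_comp[OF ptime_retype[OF enc_bits]])

definition nonzero :: "bool list \<Rightarrow> bool" where
  "nonzero bs \<longleftrightarrow> (\<exists>b\<in>set bs. b)"

text \<open>Decrement with borrow, least significant bit first. The fold also carries the unchanged
  tail, since a leading \<open>True\<close> absorbs the borrow and leaves the rest as it
  was.\<close>

definition dec :: "bool list \<Rightarrow> bool list" where
  "dec bs = snd (foldr (\<lambda>b r. (b # fst r, if b then False # fst r else True # snd r)) bs ([], []))"

lemma nonzero_iff: "nonzero bs \<longleftrightarrow> bits_value bs \<noteq> 0"
  unfolding nonzero_def by (induction bs) auto

lemma dec_simps [simp]: "dec [] = []" "dec (b # bs) = (if b then False # bs else True # dec bs)"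
proof -
  have "fst (foldr (\<lambda>b r. (b # fst r, if b then False # fst r else True # snd r)) bs ([], [])) = bs" for bs
    by (induction bs) auto
  then show "dec (b # bs) = (if b then False # bs else True # dec bs)" by (simp add: dec_def)
qed (simp add: dec_def)

lemma bits_value_dec: "bits_value bs \<noteq> 0 \<Longrightarrow> bits_value (dec bs) = bits_value bs - 1"
  by (induction bs) auto

lemma length_dec [simp]: "length (dec bs) = length bs"
  by (induction bs) auto

lemma esize_bools: "esize (bs :: bool list) \<le> 2 * length bs"
  using esize_list_le[of bs 1] esize_bool by auto

lemma ptime_dec [ptime_intros]:
  assumes "ptime f"
  shows "ptime (\<lambda>x. dec (f x))"
proof -
  let ?g = "\<lambda>b r. (b # fst r, if b then False # fst r else True # snd r)"
  have len: "length (fst (foldr ?g bs ([], []))) = length bs \<and> length (snd (foldr ?g bs ([], []))) = length bs" for bs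
    by (induction bs) auto
  show ?thesis
    unfolding dec_def
  proof (intro ptime_snd ptime_foldr[where B = "\<lambda>x. real (4 * esize (f x) + 1)"])
    show "ptime (\<lambda>p. ?g (snd (fst p)) (snd p))" by (intro ptime_intros)
    show "ptime (\<lambda>x. ([], []))" by (rule ptime_const)
    show "pbd (\<lambda>x. real (4 * esize (f x) + 1))"
      unfolding of_nat_add of_nat_mult by (intro pbd_add pbd_mult pbd_const ptime_pbd assms)
    fix x ys zs assume eq: "f x = zs @ ys"
    have "esize (foldr ?g ys ([], [])) \<le> 2 * length ys + 2 * length ys + 1"
      unfolding esize_fst_snd[of "foldr ?g ys ([], [])"]
      using esize_bools[of "fst (foldr ?g ys ([], []))"] esize_bools[of "snd (foldr ?g ys ([], []))"] len[of ys] by simp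
    also have "\<dots> \<le> 4 * esize (f x) + 1"
      using length_le_esize[of "f x"] arg_cong[OF eq, of length] by simp
    finally show "real (esize (foldr ?g ys ([], []))) \<le> real (4 * esize (f x) + 1)" by (rule of_nat_mono)
  qed fact
qed

text \<open>The binary number may be exponential in the input size, so its unary form is capped at
  the number of vertices.\<close>

definition budget :: "nat list \<Rightarrow> bool list \<Rightarrow> nat list" where
  "budget vs bs = snd (foldr (\<lambda>v r. if nonzero (fst r) then (dec (fst r), v # snd r) else r) vs (bs, []))"

lemma length_budget: "length (budget vs bs) = min (bits_value bs) (length vs)"
proof -
  let ?g = "\<lambda>v r. if nonzero (fst r) then (dec (fst r), v # snd r) else r"
  have "bits_value (fst (foldr ?g vs (bs, []))) = bits_value bs - length vs \<and>
    length (snd (foldr ?g vs (bs, []))) = min (bits_value bs) (length vs)"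
    by (induction vs) (auto simp: nonzero_iff bits_value_dec)
  then show ?thesis by (simp add: budget_def)
qed

lemma ptime_budget [ptime_intros]:
  assumes "ptime vs" "ptime bs"
  shows "ptime (\<lambda>x. budget (vs x) (bs x))"
proof -
  let ?g = "\<lambda>v r. if nonzero (fst r) then (dec (fst r), v # snd r) else r"
  have len: "length (fst (foldr ?g us (cs, []))) = length cs \<and> esize (snd (foldr ?g us (cs, []))) \<le> esize us"
    for us :: "nat list" and cs
    by (induction us) auto
  show ?thesis
    unfolding budget_def
  proof (intro ptime_snd ptime_foldr[where B = "\<lambda>x. real (2 * esize (bs x) + esize (vs x) + 1)"])
    show "ptime (\<lambda>p. ?g (snd (fst p)) (snd p))" unfolding nonzero_def by (intro ptime_intros)
    show "ptime (\<lambda>x. (bs x, []))" by (intro ptime_intros assms)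
    show "pbd (\<lambda>x. real (2 * esize (bs x) + esize (vs x) + 1))"
      unfolding of_nat_add of_nat_mult by (intro pbd_add pbd_mult pbd_const ptime_pbd assms)
    fix x ys zs assume eq: "vs x = zs @ ys"
    have "esize (foldr ?g ys (bs x, [])) \<le> 2 * length (bs x) + esize ys + 1"
      unfolding esize_fst_snd[of "foldr ?g ys (bs x, [])"]
      using esize_bools[of "fst (foldr ?g ys (bs x, []))"] len[of ys "bs x"] by simp
    also have "\<dots> \<le> 2 * esize (bs x) + esize (vs x) + 1"
      using length_le_esize[of "bs x"] arg_cong[OF eq, of esize] by simp
    finally show "real (esize (foldr ?g ys (bs x, []))) \<le> real (2 * esize (bs x) + esize (vs x) + 1)"
      by (rule of_nat_mono)
  qed fact
qed

type_synonym input = "nat list \<times> edges \<times> edges \<times> nat"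

text \<open>The extra 0 is the one keep beyond six per deletion; with it the factor
  \<open>6 k + 1 - f\<close> in \<open>balanced\<close> is 0 at the start.\<close>

definition start :: "input \<Rightarrow> state" where
  "start i = (((fst (snd i), fst (snd (snd i))), fst i, fst i, budget (fst i) (bits (snd (snd (snd i))))),
     0 # concat (map (\<lambda>_. budget (fst i) (bits (snd (snd (snd i))))) [0, 0, 0, 0, 0, 0 :: nat]))"

definition decide :: "input \<Rightarrow> bool" where
  "decide i = branch (start i)"

lemma ctime_decide: "ctime decide (\<lambda>i. 64 / 63 * 81 ^ snd (snd (snd i)))"
proof -
  have "ctime decide (\<lambda>i. potential (start i))"
    unfolding decide_def[abs_def]
  proof (rule ctime_comp[OF ctime_branch])
    show "ptime start" unfolding start_def[abs_def] by (intro ptime_intros)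
    show "1 \<le> potential s" for s by (rule potential_ge_1)
  qed
  moreover have "potential (start i) \<le> 64 / 63 * 81 ^ snd (snd (snd i))" for i
  proof -
    let ?n = "length (budget (fst i) (bits (snd (snd (snd i)))))"
    have "potential (start i) = 64 / 63 * (64 * (64 / 63) ^ 6) ^ ?n"
      by (simp add: potential_def start_def power_add power_mult_distrib power_mult[symmetric]
          flip: power_mult) (simp add: power_add[symmetric] mult.commute)
    \<comment> \<open>Uses \<open>64 (64 / 63) ^ 6 \<le> 81\<close>; the separate factor
      \<open>64 / 63\<close> comes from the extra keep.\<close>
    also have "\<dots> \<le> 64 / 63 * 81 ^ ?n"
      by (intro mult_left_mono power_mono) (auto simp: power_divide)
    also have "\<dots> \<le> 64 / 63 * 81 ^ snd (snd (snd i))"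
      by (intro mult_left_mono power_increasing) (auto simp: length_budget)
    finally show ?thesis .
  qed
  ultimately show ?thesis
    unfolding ctime_def computes_def by (meson mult_right_mono order_trans zero_le_power add_nonneg_nonneg of_nat_0_le_iff zero_le_numeral)
qed

lemma deg_le_size: "deg M U v \<le> 2 * size M"
proof (induction M)
  case (add e M)
  obtain a b where "e = Upair a b" by (cases e) auto
  then show ?case using add by auto
qed simp

lemma decide_iff:
  "decide (vs, es1, es2, k) \<longleftrightarrow> (\<exists>S\<subseteq>set vs. card S \<le> min k (length vs) \<and>
     core (mg es1) (set vs - S) = {} \<and> core (mg es2) (set vs - S) = {})"
proof -
  let ?s = "start (vs, es1, es2, k)"
  have sol: "solvable (fst ?s) \<longleftrightarrow> (\<exists>S\<subseteq>set vs. card S \<le> min k (length vs) \<and>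
     core (mg es1) (set vs - S) = {} \<and> core (mg es2) (set vs - S) = {})"
    by (simp add: solvable_def start_def length_budget)
  have "balanced ?s"
    unfolding balanced_def
  \<comment> \<open>Any bound on the degrees will do, because it is multiplied by 0 at the start;
    the summand 3 ensures that it is at least 3.\<close>
  proof (intro exI[of _ "3 + 2 * size (mg es1) + 2 * size (mg es2)"] conjI ballI)
    show "max (deg1 (fst ?s) u) (deg2 (fst ?s) u) \<le> 3 + 2 * size (mg es1) + 2 * size (mg es2)" for u
      using deg_le_size[of "mg es1" "core (mg es1) (set vs)" u] deg_le_size[of "mg es2" "core (mg es2) (set vs)" u]
      by (simp add: start_def)
    have "0 \<le> excess_sum (fst ?s)"
      unfolding excess_sum_def by (intro add_nonneg_nonneg excess_core_nonneg) auto
    then show "(int (3 + 2 * size (mg es1) + 2 * size (mg es2)) - 2) *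
        (6 * int (length (p_k (fst ?s))) + 1 - int (length (snd ?s))) \<le> excess_sum (fst ?s)"
      by (simp add: start_def)
  qed simp
  then show ?thesis
    unfolding decide_def using branch_sound branch_complete sol by blast
qed

section \<open>The program\<close>

text \<open>Makes room for the main function, which has to stand at position 0.\<close>

primrec shift :: "expr \<Rightarrow> expr" where
  "shift (Var i) = Var i"
| "shift LeafE = LeafE"
| "shift (NodeE a b) = NodeE (shift a) (shift b)"
| "shift (LeftE a) = LeftE (shift a)"
| "shift (RightE a) = RightE (shift a)"
| "shift (IfE a b c) = IfE (shift a) (shift b) (shift c)"
| "shift (LetE a b) = LetE (shift a) (shift b)"
| "shift (Call f as) = Call (Suc f) (map shift as)"

lemma eval_shift:
  "eval P env a v t \<Longrightarrow> eval (h # map shift P) env (shift a) v t"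
  "evals P env as vs t \<Longrightarrow> evals (h # map shift P) env (map shift as) vs t"
proof (induction rule: eval_evals.inducts)
  case (Call f env as vs s w t)
  then show ?case unfolding shift.simps by (intro eval_evals.Call) auto
qed (simp_all only: shift.simps list.map, (blast intro: eval_evals.intros)+)

theorem theorem2:
  "\<exists>P :: program.
     decides_in_Ostar P (\<lambda>G k. \<exists>S. sim_fvs G S \<and> card S \<le> k) (\<lambda>k. 81 ^ k)"
proof -
  obtain d Q g where "computes ([] @ Q) g decide (\<lambda>i. 64 / 63 * 81 ^ snd (snd (snd i)) * (real (esize i) + 2) ^ d)"
    using ctime_decide unfolding ctime_def by blast
  then have g: "g < length Q" and run: "\<And>i. \<exists>t. eval Q [enc i] (Q ! g) (enc (decide i)) t \<and>
      real t \<le> 64 / 63 * 81 ^ snd (snd (snd i)) * (real (esize i) + 2) ^ d"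
    by (auto simp: computes_def)
  let ?P = "Call (Suc g) [Var 0] # map shift Q"
  \<comment> \<open>The polynomial \<open>8 * (n + 2) ^ d\<close>: its coefficient covers the factor
    \<open>64 / 63\<close> and the 4 additional steps of the two outer calls.\<close>
  let ?p = "[:8:] * [:2, 1:] ^ d :: nat poly"
  have "\<exists>t. runs ?P x (\<exists>S. sim_fvs G S \<and> card S \<le> k) t \<and> t \<le> 81 ^ k * poly ?p (size x)"
    if wf: "wf_colored_graph G" and en: "encodes x G k" for G k x
  proof -
    obtain vs es1 es2 where vs: "distinct vs" "set vs = verts G" and es: "mg es1 = edges1 G" "mg es2 = edges2 G"
      and x: "x = Node (enc_list enc_nat vs) (Node (enc_list enc_pair es1) (Node (enc_list enc_pair es2) (enc_nat k)))"
      using en by (auto simp: encodes_def mg_def)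
    let ?i = "(vs, es1, es2, k)"
    have "enc_list enc_pair es = enc_list enc es" for es :: edges
      by (induction es) auto
    moreover have "enc_list enc_nat vs = enc_list enc vs" for vs :: "nat list"
      by (induction vs) auto
    ultimately have enc: "enc ?i = x" by (simp add: x enc_list_eq)
    \<comment> \<open>Capping the budget at the number of vertices changes nothing, since a solution
      is a set of vertices.\<close>
    have correct: "decide ?i \<longleftrightarrow> (\<exists>S. sim_fvs G S \<and> card S \<le> k)"
    proof -
      have "card S \<le> length vs" if "S \<subseteq> set vs" for S
        using that by (metis List.finite_set card_length card_mono le_trans)
      then show ?thesis
        unfolding decide_iff sim_fvs_def class1_def class2_def vs(2)[symmetric] forest_iff_core[OF List.finite_set] es
        by auto
    qed
    obtain t where t: "eval Q [x] (Q ! g) (enc (decide ?i)) t"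
      "real t \<le> 64 / 63 * 81 ^ k * (real (esize ?i) + 2) ^ d"
      using run[of ?i] enc by auto
    have v: "eval ?P [x] (Var 0) x 1" by (rule eval_Var0)
    have "eval ?P [x] (?P ! Suc g) (enc (decide ?i)) t"
      using eval_shift(1)[OF t(1), of "Call (Suc g) [Var 0]"] g by simp
    then have "eval ?P [x] (Call (Suc g) [Var 0]) (enc (decide ?i)) (1 + 0 + t + 1)"
      using g by (intro eval_evals.Call[OF _ eval_evals.Cons[OF v eval_evals.Nil]]) auto
    then have "eval ?P [x] (Call 0 [Var 0]) (enc (decide ?i)) (1 + 0 + (1 + 0 + t + 1) + 1)"
      by (intro eval_evals.Call[OF _ eval_evals.Cons[OF v eval_evals.Nil]]) auto
    then have "runs ?P x (\<exists>S. sim_fvs G S \<and> card S \<le> k) (1 + 0 + (1 + 0 + t + 1) + 1)"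
      unfolding runs_def using correct by (intro exI[of _ "enc (decide ?i)"] conjI) simp_all
    moreover have "1 + 0 + (1 + 0 + t + 1) + 1 \<le> 81 ^ k * poly ?p (size x)"
    proof -
      let ?N = "81 ^ k * (real (esize ?i) + 2) ^ d"
      have "1 * 1 \<le> ?N" by (intro mult_mono one_le_power) auto
      then have "real t + 4 \<le> 8 * ?N" using t(2) by simp
      also have "8 * ?N = real (81 ^ k * poly ?p (size x))"
        using enc by (simp add: esize_def add.commute)
      finally show ?thesis by linarith
    qed
    ultimately show ?thesis by blast
  qed
  then show ?thesis unfolding decides_in_Ostar_def by blast
qed

end
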